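(* Let $d\ge2$ and let $g$ be a measurable function on $\mathbb{R}^+=(0,\infty)$. Then $\operatorname{ext}g\in BV(\mathbb{R}^d)$ if and only if $g\in BV(\mathbb{R}^+,t^{d-1})$, and $$\|\operatorname{ext}g|BV(\mathbb{R}^d)\|\asymp\|g|BV(\mathbb{R}^+,t^{d-1})\|,$$ i.e. each side is bounded by a constant, independent of $g$, times the other.
   Context: $(\operatorname{ext}g)(x)=g(|x|)$ for $x\in\mathbb{R}^d\setminus\{0\}$. $BV(\mathbb{R}^d)$ is the space of all $f\in L_1(\mathbb{R}^d)$ such that for every $i=1,\dots,d$ there is a signed Radon measure $\mu_i$ of finite total variation with $\int_{\mathbb{R}^d}f(x)\frac{\partial\phi}{\partial x_i}(x)\,dx=-\int_{\mathbb{R}^d}\phi(x)\,d\mu_i(x)$ for all continuously differentiable, compactly supported $\phi$ on $\mathbb{R}^d$. The norm is $\|f|BV(\mathbb{R}^d)\|=\|f|L_1(\mathbb{R}^d)\|+\sum_{i=1}^d\|\mu_i|\mathcal{M}\|$, where $\|\mu_i|\mathcal{M}\|$ is the total variation of $\mu_i$. A function $\varphi\in C([0,\infty))$ belongs to $C_c^1([0,\infty))$ if it is continuously differentiable on $\mathbb{R}^+$, has compact support, satisfies $\varphi(0)=0$, and $\lim_{t\to0^+}\varphi'(t)=\varphi'(0)=\lim_{t\to0^+}\frac{\varphi(t)}t$ exists and is finite. A function $g\in L_1(\mathbb{R}^+,t^{d-1})$ (i.e. $\int_0^\infty|g(t)|t^{d-1}dt<\infty$) belongs to $BV(\mathbb{R}^+,t^{d-1})$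 if there is a signed Radon measure $\nu$ on $\mathbb{R}^+$ such that $$\int_0^\infty g(t)\,[\varphi(s)s^{d-1}]'(t)\,dt=-\int_0^\infty\varphi(t)\,t^{d-1}\,d\nu(t)\qquad\text{for all }\varphi\in C_c^1([0,\infty)),$$ and $\|g|BV(\mathbb{R}^+,t^{d-1})\|:=\|g|L_1(\mathbb{R}^+,t^{d-1})\|+\int_0^\infty r^{d-1}\,d|\nu|(r)$ is finite, where $|\nu|$ is the total variation of $\nu$. Here $[\varphi(s)s^{d-1}]'(t)$ is the derivative of $s\mapsto\varphi(s)s^{d-1}$ at $t$. *)

theory Defs
  imports "HOL-Analysis.Analysis"
begin

(* The value at the origin is irrelevant (a null set); fixing it as 0 makes the extension
   depend on the values of g on the open half-line only. *)
definition radial_ext :: "(real \<Rightarrow> real) \<Rightarrow> 'a::euclidean_space \<Rightarrow> real" where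
  "radial_ext g x = (if x = 0 then 0 else g (norm x))"

(* For U open in a Euclidean space, every locally finite Borel measure on U is regular,
   so local finiteness is all that has to be required of a Radon measure. *)
definition radon_measure_on :: "'a::euclidean_space set \<Rightarrow> 'a measure \<Rightarrow> bool" where
  "radon_measure_on U M \<longleftrightarrow>
     sets M = sets (restrict_space borel U) \<and>
     (\<forall>K. compact K \<and> K \<subseteq> U \<longrightarrow> emeasure M K < \<infinity>)"

definition mutually_singular :: "'a measure \<Rightarrow> 'a measure \<Rightarrow> bool" where
  "mutually_singular P N \<longleftrightarrow>
     (\<exists>A \<in> sets P. emeasure P (space P - A) = 0 \<and> emeasure N A = 0)"

(* A signed Radon measure of infinite total variation is not a set function on all Borel sets
   (its positive and negative part may both be infinite). It is therefore represented by its
   Jordan decomposition, i.e. by the pair of its positive and its negative part, which are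
   mutually singular; the representation is unique. *)
type_synonym 'a signed_measure = "'a measure \<times> 'a measure"

definition signed_radon_measure_on :: "'a::euclidean_space set \<Rightarrow> 'a signed_measure \<Rightarrow> bool" where
  "signed_radon_measure_on U \<mu> \<longleftrightarrow>
     radon_measure_on U (fst \<mu>) \<and> radon_measure_on U (snd \<mu>) \<and>
     mutually_singular (fst \<mu>) (snd \<mu>)"

definition variation_measure :: "'a signed_measure \<Rightarrow> 'a measure" where
  "variation_measure \<mu> =
     measure_of (space (fst \<mu>)) (sets (fst \<mu>)) (\<lambda>A. emeasure (fst \<mu>) A + emeasure (snd \<mu>) A)"

definition signed_integral :: "'a signed_measure \<Rightarrow> ('a \<Rightarrow> real) \<Rightarrow> real" where
  "signed_integral \<mu> f = (LINT x|fst \<mu>. f x) - (LINT x|snd \<mu>. f x)"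

definition finite_variation :: "'a signed_measure \<Rightarrow> bool" where
  "finite_variation \<mu> \<longleftrightarrow> emeasure (variation_measure \<mu>) (space (variation_measure \<mu>)) < \<infinity>"

definition total_variation :: "'a signed_measure \<Rightarrow> real" where
  "total_variation \<mu> = measure (variation_measure \<mu>) (space (variation_measure \<mu>))"


definition partial_deriv :: "'a::euclidean_space \<Rightarrow> ('a \<Rightarrow> real) \<Rightarrow> 'a \<Rightarrow> real" where
  "partial_deriv i \<phi> x = frechet_derivative \<phi> (at x) i"

definition C1_compact_support :: "('a::euclidean_space \<Rightarrow> real) set" where
  "C1_compact_support =
     {\<phi>. (\<forall>x. \<phi> differentiable (at x)) \<and>
          (\<forall>i\<in>Basis. continuous_on UNIV (partial_deriv i \<phi>)) \<and>
          compact (closure {x. \<phi> x \<noteq> 0})}"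

definition has_weak_partial_measure ::
    "'a::euclidean_space \<Rightarrow> ('a \<Rightarrow> real) \<Rightarrow> 'a signed_measure \<Rightarrow> bool" where
  "has_weak_partial_measure i f \<mu> \<longleftrightarrow>
     signed_radon_measure_on UNIV \<mu> \<and> finite_variation \<mu> \<and>
     (\<forall>\<phi> \<in> C1_compact_support.
        (LINT x|lebesgue. f x * partial_deriv i \<phi> x) = - signed_integral \<mu> \<phi>)"

definition BV :: "('a::euclidean_space \<Rightarrow> real) set" where
  "BV = {f. integrable lebesgue f \<and> (\<forall>i\<in>Basis. \<exists>\<mu>. has_weak_partial_measure i f \<mu>)}"

(* Meaningful for f in BV only, where the measures exist and are unique. *)
definition BV_norm :: "('a::euclidean_space \<Rightarrow> real) \<Rightarrow> real" where
  "BV_norm f =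
     (LINT x|lebesgue. \<bar>f x\<bar>) +
     (\<Sum>i\<in>Basis. total_variation (THE \<mu>. has_weak_partial_measure i f \<mu>))"


(* L is the one-sided derivative of \<phi> at 0; nothing is required of \<phi> on negative arguments. *)
definition C1_compact_support_halfline :: "(real \<Rightarrow> real) set" where
  "C1_compact_support_halfline =
     {\<phi>. continuous_on {0..} \<phi> \<and>
          (\<forall>t>0. \<phi> differentiable (at t)) \<and> continuous_on {0<..} (deriv \<phi>) \<and>
          compact (closure {t. 0 \<le> t \<and> \<phi> t \<noteq> 0}) \<and>
          \<phi> 0 = 0 \<and>
          (\<exists>L. ((\<lambda>t. \<phi> t / t) \<longlongrightarrow> L) (at_right 0) \<and> (deriv \<phi> \<longlongrightarrow> L) (at_right 0))}"

definition weighted_L1 :: "nat \<Rightarrow> (real \<Rightarrow> real) set" where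
  "weighted_L1 d =
     {g. g \<in> borel_measurable (lebesgue_on {0<..}) \<and>
         integrable (lebesgue_on {0<..}) (\<lambda>t. \<bar>g t\<bar> * t ^ (d - 1))}"

definition has_weighted_derivative_measure ::
    "nat \<Rightarrow> (real \<Rightarrow> real) \<Rightarrow> real signed_measure \<Rightarrow> bool" where
  "has_weighted_derivative_measure d g \<nu> \<longleftrightarrow>
     signed_radon_measure_on {0<..} \<nu> \<and>
     (\<integral>\<^sup>+ r. ennreal (r ^ (d - 1)) \<partial>variation_measure \<nu>) < \<infinity> \<and>
     (\<forall>\<phi> \<in> C1_compact_support_halfline.
        (LINT t|lebesgue_on {0<..}. g t * deriv (\<lambda>s. \<phi> s * s ^ (d - 1)) t) =
        - signed_integral \<nu> (\<lambda>t. \<phi> t * t ^ (d - 1)))"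

definition weighted_BV :: "nat \<Rightarrow> (real \<Rightarrow> real) set" where
  "weighted_BV d = {g \<in> weighted_L1 d. \<exists>\<nu>. has_weighted_derivative_measure d g \<nu>}"

(* As for BV_norm: meaningful for g in weighted_BV d, where the measure exists and is unique. *)
definition weighted_BV_norm :: "nat \<Rightarrow> (real \<Rightarrow> real) \<Rightarrow> real" where
  "weighted_BV_norm d g =
     (LINT t|lebesgue_on {0<..}. \<bar>g t\<bar> * t ^ (d - 1)) +
     (LINT r|variation_measure (THE \<nu>. has_weighted_derivative_measure d g \<nu>). r ^ (d - 1))"

end

theory Submission
  imports Defs
begin

text \<open>
  In polar coordinates Lebesgue measure is the product of \<open>r\<^sup>d\<^sup>-\<^sup>1 dr\<close> and a finite measure \<open>\<sigma>\<close>
  on the unit sphere. Write \<open>f = ext g\<close> and \<open>\<omega> = \<sigma>(S)\<close>.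

  If \<open>g\<close> has the weighted derivative \<open>\<nu>\<close>, test \<open>f\<close> with \<open>\<phi>\<close>. The flux
  \<open>\<Phi>(r) = \<integral> \<phi>(r\<theta>) \<theta>\<^sub>i d\<sigma>(\<theta>)\<close> is an admissible radial test function and satisfies
  \<open>(\<Phi> r\<^sup>d\<^sup>-\<^sup>1)' = r\<^sup>d\<^sup>-\<^sup>1 \<integral> \<partial>\<^sub>i\<phi>(r\<theta>) d\<sigma>(\<theta>)\<close>, a divergence theorem on balls. Hence \<open>\<partial>\<^sub>i f\<close> is the image of
  \<open>r\<^sup>d\<^sup>-\<^sup>1\<nu> \<otimes> \<theta>\<^sub>i\<sigma>\<close> under \<open>(r, \<theta>) \<mapsto> r\<theta>\<close>, of total variation at most \<open>\<omega> \<integral> r\<^sup>d\<^sup>-\<^sup>1 d|\<nu>|\<close>.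

  Conversely, let \<open>\<partial>\<^sub>i f = \<mu>\<^sub>i\<close>. A radial test function \<open>\<phi>\<close> gives the \<open>C\<^sup>1\<close> vector field \<open>\<phi>(|x|) x/|x|\<close>,
  whose divergence is \<open>(\<phi> r\<^sup>d\<^sup>-\<^sup>1)' / r\<^sup>d\<^sup>-\<^sup>1\<close> at \<open>r = |x|\<close>. So \<open>\<omega> r\<^sup>d\<^sup>-\<^sup>1\<nu>\<close> is the image of
  \<open>\<Sum>\<^sub>i (x\<^sub>i/|x|) \<mu>\<^sub>i\<close> under the norm, of total variation at most \<open>\<Sum>\<^sub>i \<parallel>\<mu>\<^sub>i\<parallel>\<close>.
\<close>

subsection \<open>Signed measures given by densities\<close>

text \<open>Two features of the definitions shape the argument. First, \<nu> may have infinite mass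
  near 0; only r^(d-1)|\<nu>| is finite. Computations are therefore moved to finite measures on the
  whole line or space, with all signs kept in a density, and the weight is divided out last: compact
  subsets of the open half-line stay away from 0, so the quotient is again Radon. An atom of a
  measure mu_i at the origin does no harm, because \<open>sgn 0 = 0\<close>. Second, both norms
  speak of the measure chosen by \<open>THE\<close>, so an estimate for a constructed measure says
  something about a norm only after uniqueness is known. Uniqueness is tested on boxes and must
  avoid differences of infinite masses. The formula for the derivative of the weighted flux is first
  obtained only in integrated form, against functions e(r^2); continuity in r then makes it
  pointwise. With L the weighted L_1 norm of g, W the integral of r^(d-1) d|\<nu>| and T the sum of
  the total variations of the mu_i, the two constructions give T \<le> d \<omega> W and W \<le> T /
  \<omega>, while f has L_1 norm \<omega> L. Hence the constants d \<omega> and 1 /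
  \<omega>.\<close>

lemma
  assumes "sets P = sets N"
  shows space_variation_measure: "space (variation_measure (P, N)) = space P"
    and sets_variation_measure: "sets (variation_measure (P, N)) = sets P"
  by (simp_all add: variation_measure_def)

text \<open>\<open>measure_of\<close> returns the given set function only once it is known to be a
  measure; countable additivity is the addition of two series with nonnegative terms.\<close>

lemma emeasure_variation_measure:
  assumes eq: "sets P = sets N" and A: "A \<in> sets P"
  shows "emeasure (variation_measure (P, N)) A = emeasure P A + emeasure N A"
proof -
  show "emeasure (variation_measure (P, N)) A = emeasure P A + emeasure N A"
    unfolding variation_measure_def fst_conv snd_conv
  proof (rule emeasure_measure_of_sigma)
    show "sigma_algebra (space P) (sets P)" ..
    show "positive (sets P) (\<lambda>A. emeasure P A + emeasure N A)"
      by (simp add: positive_def)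
    show "countably_additive (sets P) (\<lambda>A. emeasure P A + emeasure N A)"
    proof (rule countably_additiveI)
      fix B :: "nat \<Rightarrow> _" assume B: "range B \<subseteq> sets P" "disjoint_family B"
      then have "(\<Sum>i. emeasure P (B i)) = emeasure P (\<Union>i. B i)"
        "(\<Sum>i. emeasure N (B i)) = emeasure N (\<Union>i. B i)"
        using eq by (auto intro!: suminf_emeasure)
      then show "(\<Sum>i. emeasure P (B i) + emeasure N (B i)) =
          emeasure P (\<Union>i. B i) + emeasure N (\<Union>i. B i)"
        by (simp add: suminf_add[symmetric])
    qed
    show "A \<in> sets P" by fact
  qed
qed

lemma finite_measure_variation_measure:
  assumes "finite_measure P" "finite_measure N" and eq: "sets P = sets N"
  shows "finite_measure (variation_measure (P, N))"
  using assms emeasure_variation_measure[OF eq, of "space P"] space_variation_measure[OF eq]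
    sets_eq_imp_space_eq[OF eq]
  by (intro finite_measureI) (auto simp: finite_measure.emeasure_eq_measure)

text \<open>The set witnessing singularity is a Hahn set: \<open>P\<close> is carried by it and
  \<open>N\<close> by its complement. Arguing with null sets rather than with Radon-Nikodym covers
  the possibly infinite measures on the half-line.\<close>

lemma mutually_singular_density:
  assumes eq: "sets P = sets N" and "mutually_singular P N"
  obtains A where "A \<in> sets P"
    and "P = density (variation_measure (P, N)) (indicator A)"
    and "N = density (variation_measure (P, N)) (indicator (space P - A))"
proof -
  obtain A where A: "A \<in> sets P" "emeasure P (space P - A) = 0" "emeasure N A = 0"
    using assms by (auto simp: mutually_singular_def)
  have P: "emeasure P (A \<inter> B) = emeasure P B" and N: "emeasure N (A \<inter> B) = 0"
    and P': "emeasure P ((space P - A) \<inter> B) = 0"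
    and N': "emeasure N ((space P - A) \<inter> B) = emeasure N B" if "B \<in> sets P" for B
  proof -
    show "emeasure N (A \<inter> B) = 0"
      using A eq by (metis Int_lower1 emeasure_mono le_zero_eq)
    show "emeasure P ((space P - A) \<inter> B) = 0"
      using A by (metis Int_lower1 emeasure_mono le_zero_eq sets.compl_sets)
    have "emeasure P B = emeasure P ((A \<inter> B) \<union> ((space P - A) \<inter> B))"
      using sets.sets_into_space[OF that] by (intro arg_cong[where f="emeasure P"]) auto
    also have "\<dots> = emeasure P (A \<inter> B)"
      using A that \<open>emeasure P ((space P - A) \<inter> B) = 0\<close>
      by (intro emeasure_Un_null_set) (auto simp: null_sets_def)
    finally show "emeasure P (A \<inter> B) = emeasure P B" ..
    have "emeasure N B = emeasure N (((space P - A) \<inter> B) \<union> (A \<inter> B))"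
      using sets.sets_into_space[OF that] by (intro arg_cong[where f="emeasure N"]) auto
    also have "\<dots> = emeasure N ((space P - A) \<inter> B)"
      using A that eq \<open>emeasure N (A \<inter> B) = 0\<close>
      by (intro emeasure_Un_null_set) (auto simp: null_sets_def)
    finally show "emeasure N ((space P - A) \<inter> B) = emeasure N B" ..
  qed
  note s = sets_variation_measure[OF eq]
  have ind: "(indicator C :: _ \<Rightarrow> ennreal) \<in> borel_measurable (variation_measure (P, N))"
    if "C \<in> sets P" for C
    using that s by simp
  have dens: "emeasure (density (variation_measure (P, N)) (indicator C)) B =
      emeasure P (C \<inter> B) + emeasure N (C \<inter> B)" if "C \<in> sets P" "B \<in> sets P" for C B
    using that s eq
    by (simp add: emeasure_density ind indicator_inter_arith[symmetric] emeasure_variation_measure)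
  show ?thesis
  proof (rule that)
    show "A \<in> sets P" by fact
    show "P = density (variation_measure (P, N)) (indicator A)"
      using A s by (intro measure_eqI) (simp_all add: dens P N)
    show "N = density (variation_measure (P, N)) (indicator (space P - A))"
    proof (rule measure_eqI)
      fix B assume "B \<in> sets N"
      then have B: "B \<in> sets P" using eq by simp
      have "space P - A \<in> sets P" using A(1) by auto
      from dens[OF this B] P'[OF B] N'[OF B] show "emeasure N B =
          emeasure (density (variation_measure (P, N)) (indicator (space P - A))) B" by simp
    qed (use eq s in simp)
  qed
qed

text \<open>Polar decomposition of the signed measure: its density with respect to the variation is
  1 on the Hahn set and -1 off it. Integrability against the variation lets the two halves of
  \<open>signed_integral\<close> be recombined into one integral.\<close>

lemma signed_integral_sign_density:
  assumes eq: "sets P = sets N" and "mutually_singular P N"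
  obtains A where "A \<in> sets P"
    and "\<And>f. integrable (variation_measure (P, N)) f \<Longrightarrow>
      signed_integral (P, N) f =
        (LINT x|variation_measure (P, N). f x * (indicator A x - indicator (space P - A) x))"
proof -
  let ?V = "variation_measure (P, N)"
  obtain A where A: "A \<in> sets P" and P: "P = density ?V (indicator A)"
    and N: "N = density ?V (indicator (space P - A))"
    using mutually_singular_density[OF assms] by blast
  note s = sets_variation_measure[OF eq]
  have dens: "integral\<^sup>L (density ?V (indicator C)) f = (LINT x|?V. f x * indicator C x)"
    if C: "C \<in> sets P" and f: "integrable ?V f" for C and f :: "_ \<Rightarrow> real"
  proof -
    have "integral\<^sup>L (density ?V (\<lambda>x. ennreal (indicator C x))) f = (LINT x|?V. indicator C x *\<^sub>R f x)"
      using C f s by (intro integral_density) auto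
    then show ?thesis by (simp add: ennreal_indicator mult.commute)
  qed
  have ii: "integrable ?V (\<lambda>x. f x * indicator C x)"
    if C: "C \<in> sets P" and f: "integrable ?V f" for C and f :: "_ \<Rightarrow> real"
    using C f s integrable_mult_indicator[of C ?V f] by (simp add: mult.commute)
  show ?thesis
  proof (rule that[OF A])
    fix f :: "_ \<Rightarrow> real" assume f: "integrable ?V f"
    have "integral\<^sup>L P f = (LINT x|?V. f x * indicator A x)"
      using dens[OF A f] P by simp
    moreover have "integral\<^sup>L N f = (LINT x|?V. f x * indicator (space P - A) x)"
      using dens[OF _ f, of "space P - A"] A N by simp
    ultimately show "signed_integral (P, N) f =
        (LINT x|?V. f x * (indicator A x - indicator (space P - A) x))"
      using ii[OF A f] ii[OF _ f, of "space P - A"] A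
      by (simp add: signed_integral_def right_diff_distrib)
  qed
qed

text \<open>\<open>ennreal\<close> sends negative reals to 0, so the two densities are the positive
  and the negative part of \<open>h\<close>, and the pair is automatically a Jordan
  decomposition.\<close>

definition signed_density :: "'a measure \<Rightarrow> ('a \<Rightarrow> real) \<Rightarrow> 'a signed_measure" where
  "signed_density M h = (density M (\<lambda>x. ennreal (h x)), density M (\<lambda>x. ennreal (- h x)))"

lemma mutually_singular_signed_density:
  assumes [measurable]: "h \<in> borel_measurable M"
  shows "mutually_singular (fst (signed_density M h)) (snd (signed_density M h))"
proof -
  have "emeasure (density M (\<lambda>x. ennreal (h x))) (space M - {x \<in> space M. 0 < h x}) = 0"
    by (auto simp: emeasure_density nn_integral_0_iff_AE ennreal_neg indicator_def)
  moreover have "emeasure (density M (\<lambda>x. ennreal (- h x))) {x \<in> space M. 0 < h x} = 0"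
    by (auto simp: emeasure_density nn_integral_0_iff_AE ennreal_neg indicator_def)
  ultimately show ?thesis
    unfolding mutually_singular_def signed_density_def
    by (intro bexI[of _ "{x \<in> space M. 0 < h x}"]) auto
qed

lemma variation_measure_signed_density:
  assumes [measurable]: "h \<in> borel_measurable M"
  shows "variation_measure (signed_density M h) = density M (\<lambda>x. ennreal \<bar>h x\<bar>)"
proof (rule measure_eqI)
  show "sets (variation_measure (signed_density M h)) = sets (density M (\<lambda>x. ennreal \<bar>h x\<bar>))"
    by (simp add: signed_density_def sets_variation_measure)
  fix B assume "B \<in> sets (variation_measure (signed_density M h))"
  then have B: "B \<in> sets M" by (simp add: signed_density_def sets_variation_measure)
  have "ennreal (h x) + ennreal (- h x) = ennreal \<bar>h x\<bar>" for x
    by (cases "0 \<le> h x") (auto simp: ennreal_neg)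
  with B show "emeasure (variation_measure (signed_density M h)) B =
      emeasure (density M (\<lambda>x. ennreal \<bar>h x\<bar>)) B"
    by (simp add: signed_density_def emeasure_variation_measure emeasure_density_add)
qed

lemma signed_integral_signed_density:
  assumes [measurable]: "h \<in> borel_measurable M" "f \<in> borel_measurable M"
    and int: "integrable M (\<lambda>x. f x * h x)"
  shows "signed_integral (signed_density M h) f = (LINT x|M. f x * h x)"
proof -
  have eq: "integral\<^sup>L (density M (\<lambda>x. ennreal (k x))) f = (LINT x|M. f x * max 0 (k x))"
    if [measurable]: "k \<in> borel_measurable M" for k :: "_ \<Rightarrow> real"
  proof -
    have "(\<lambda>x. ennreal (k x)) = (\<lambda>x. ennreal (max 0 (k x)))"
      by (auto simp: max_def ennreal_neg)
    then show ?thesis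
      using integral_density[of f M "\<lambda>x. max 0 (k x)"] by (simp add: mult.commute)
  qed
  have "integrable M (\<lambda>x. f x * max 0 (h x))" "integrable M (\<lambda>x. f x * max 0 (- h x))"
    by (auto intro!: Bochner_Integration.integrable_bound[OF int] simp: abs_mult mult_left_mono)
  then have "(LINT x|M. f x * max 0 (h x)) - (LINT x|M. f x * max 0 (- h x)) =
      (LINT x|M. f x * max 0 (h x) - f x * max 0 (- h x))"
    by (rule Bochner_Integration.integral_diff[symmetric])
  also have "(\<lambda>x. f x * max 0 (h x) - f x * max 0 (- h x)) = (\<lambda>x. f x * h x)"
    by (auto simp: max_def)
  finally show ?thesis
    by (simp add: signed_integral_def signed_density_def eq)
qed

lemma (in finite_measure) integrable_bounded_mult:
  fixes f h :: "'a \<Rightarrow> real"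
  assumes "integrable M h" "f \<in> borel_measurable M" "bounded (range f)"
  shows "integrable M (\<lambda>x. f x * h x)"
proof -
  obtain B where B: "\<And>x. \<bar>f x\<bar> \<le> B"
    using assms(3) by (auto simp: bounded_iff)
  have "integrable M (\<lambda>x. B * h x)" using assms(1) by simp
  then show ?thesis
  proof (rule Bochner_Integration.integrable_bound)
    show "(\<lambda>x. f x * h x) \<in> borel_measurable M" using assms by simp
    have "\<bar>f x\<bar> \<le> \<bar>B\<bar>" for x using B[of x] by linarith
    then show "AE x in M. norm (f x * h x) \<le> norm (B * h x)"
      by (auto simp: abs_mult intro!: mult_right_mono)
  qed
qed

text \<open>
  A functional represented in this way is integration against a signed measure of total variation
  at most \<open>c\<close>. The density \<open>h\<close> may change sign, so that sums and images of such functionals need no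
  Jordan decomposition; it is read off from \<open>h\<close> at the end.
\<close>

definition represented_by_density ::
    "(('a::topological_space \<Rightarrow> real) \<Rightarrow> real) \<Rightarrow> real \<Rightarrow> bool" where
  "represented_by_density L c \<longleftrightarrow>
     (\<exists>M h. finite_measure M \<and> sets M = sets borel \<and> h \<in> borel_measurable borel \<and>
        integrable M h \<and> (LINT x|M. \<bar>h x\<bar>) \<le> c \<and>
        (\<forall>f\<in>borel_measurable borel. bounded (range f) \<longrightarrow> L f = (LINT x|M. f x * h x)))"

lemma absolutely_continuous_variation_measure:
  assumes eq: "sets P = sets N"
  shows "absolutely_continuous (variation_measure (P, N)) P"
    and "absolutely_continuous (variation_measure (P, N)) N"
proof -
  have "emeasure P A = 0 \<and> emeasure N A = 0" "A \<in> sets P"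
    if "A \<in> null_sets (variation_measure (P, N))" for A
    using that emeasure_variation_measure[OF eq, of A] sets_variation_measure[OF eq]
    by (auto simp: null_sets_def)
  then show "absolutely_continuous (variation_measure (P, N)) P"
    and "absolutely_continuous (variation_measure (P, N)) N"
    using eq by (auto simp: absolutely_continuous_def null_sets_def)
qed

text \<open>The Radon-Nikodym derivative of a finite measure is finite almost everywhere, so a
  change on a null set makes it real-valued and nonnegative everywhere, as the rules for integrals
  against real densities want it.\<close>

lemma finite_measure_density:
  assumes "finite_measure M" "finite_measure N" "absolutely_continuous M N" "sets N = sets M"
  obtains D :: "_ \<Rightarrow> real" where "D \<in> borel_measurable M" "\<And>x. 0 \<le> D x"
    and "N = density M (\<lambda>x. ennreal (D x))"
proof -
  interpret M: finite_measure M by fact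
  interpret N: finite_measure N by fact
  obtain D where "D \<in> borel_measurable M" "AE x in M. RN_deriv M N x = ennreal (D x)" "\<And>x. 0 \<le> D x"
    using M.real_RN_deriv[OF assms(2-4)] by metis
  moreover have "N = density M (\<lambda>x. ennreal (D x))"
    using calculation M.density_RN_deriv[OF assms(3,4)]
      density_cong[of "RN_deriv M N" M "\<lambda>x. ennreal (D x)"] by simp
  ultimately show ?thesis using that by blast
qed

text \<open>The two functionals live over different measures \<open>P\<close> and \<open>N\<close>;
  both measures have densities with respect to their sum. \<open>variation_measure (P, N)\<close>
  only serves as a name for that sum here, without any claim that \<open>P\<close> and
  \<open>N\<close> are mutually singular.\<close>

lemma represented_by_density_add:
  assumes "represented_by_density L\<^sub>1 c\<^sub>1" "represented_by_density L\<^sub>2 c\<^sub>2"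
  shows "represented_by_density (\<lambda>f. L\<^sub>1 f + L\<^sub>2 f) (c\<^sub>1 + c\<^sub>2)"
proof -
  obtain P h where P: "finite_measure P" "sets P = sets borel" and [measurable]: "h \<in> borel_measurable borel"
    and h: "integrable P h" "(LINT x|P. \<bar>h x\<bar>) \<le> c\<^sub>1"
    and L1: "\<And>f. f\<in>borel_measurable borel \<Longrightarrow> bounded (range f) \<Longrightarrow> L\<^sub>1 f = (LINT x|P. f x * h x)"
    using assms(1) by (auto simp: represented_by_density_def)
  obtain N k where N: "finite_measure N" "sets N = sets borel" and [measurable]: "k \<in> borel_measurable borel"
    and k: "integrable N k" "(LINT x|N. \<bar>k x\<bar>) \<le> c\<^sub>2"
    and L2: "\<And>f. f\<in>borel_measurable borel \<Longrightarrow> bounded (range f) \<Longrightarrow> L\<^sub>2 f = (LINT x|N. f x * k x)"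
    using assms(2) by (auto simp: represented_by_density_def)
  define V where "V = variation_measure (P, N)"
  have eq: "sets P = sets N" using P N by simp
  have sV [measurable_cong]: "sets V = sets borel" using P eq by (simp add: V_def sets_variation_measure)
  have fV: "finite_measure V" unfolding V_def using P N by (intro finite_measure_variation_measure) auto
  note ac = absolutely_continuous_variation_measure[OF eq, folded V_def]
  obtain p :: "'a \<Rightarrow> real" where [measurable]: "p \<in> borel_measurable V" and p: "\<And>x. 0 \<le> p x" "P = density V (\<lambda>x. ennreal (p x))"
    using finite_measure_density[OF fV P(1) ac(1)] P(2) sV by auto
  obtain n :: "'a \<Rightarrow> real" where [measurable]: "n \<in> borel_measurable V" and n: "\<And>x. 0 \<le> n x" "N = density V (\<lambda>x. ennreal (n x))"
    using finite_measure_density[OF fV N(1) ac(2)] N(2) sV by auto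
  define l where "l x = h x * p x + k x * n x" for x
  have ip: "integrable V (\<lambda>x. h x * p x)" "(LINT x|P. \<bar>h x\<bar>) = (LINT x|V. \<bar>h x * p x\<bar>)"
    using h p by (simp_all add: integrable_real_density integral_real_density abs_mult mult.commute)
  have iq: "integrable V (\<lambda>x. k x * n x)" "(LINT x|N. \<bar>k x\<bar>) = (LINT x|V. \<bar>k x * n x\<bar>)"
    using k n by (simp_all add: integrable_real_density integral_real_density abs_mult mult.commute)
  show ?thesis
    unfolding represented_by_density_def
  proof (intro exI[of _ V] exI[of _ l] conjI ballI impI)
    show "finite_measure V" "sets V = sets borel" by fact+
    have "l \<in> borel_measurable V" by (simp add: l_def[abs_def])
    then show "l \<in> borel_measurable borel" by (simp cong: measurable_cong_sets add: sV)
    show "integrable V l" unfolding l_def using ip iq by simp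
    have "(LINT x|V. \<bar>l x\<bar>) \<le> (LINT x|V. \<bar>h x * p x\<bar> + \<bar>k x * n x\<bar>)"
      unfolding l_def using ip iq by (intro integral_mono) auto
    also have "\<dots> \<le> c\<^sub>1 + c\<^sub>2" using ip iq h k by simp
    finally show "(LINT x|V. \<bar>l x\<bar>) \<le> c\<^sub>1 + c\<^sub>2" .
    fix f :: "'a \<Rightarrow> real" assume f[measurable]: "f \<in> borel_measurable borel" and b: "bounded (range f)"
    have "(LINT x|P. f x * h x) = (LINT x|V. f x * (h x * p x))"
      "(LINT x|N. f x * k x) = (LINT x|V. f x * (k x * n x))"
      using p n by (simp_all add: integral_real_density ac_simps)
    moreover have "integrable V (\<lambda>x. f x * (h x * p x))" "integrable V (\<lambda>x. f x * (k x * n x))"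
      using finite_measure.integrable_bounded_mult[OF fV ip(1) _ b]
        finite_measure.integrable_bounded_mult[OF fV iq(1) _ b] by auto
    ultimately show "L\<^sub>1 f + L\<^sub>2 f = (LINT x|V. f x * l x)"
      using f b by (simp add: L1 L2 l_def distrib_left)
  qed
qed

lemma represented_by_density_cong:
  assumes "represented_by_density L c"
    and eq: "\<And>f. f \<in> borel_measurable borel \<Longrightarrow> bounded (range f) \<Longrightarrow> L f = L' f"
  shows "represented_by_density L' c"
proof -
  have "(\<forall>f\<in>borel_measurable borel. bounded (range f) \<longrightarrow> L f = F f) \<longleftrightarrow>
      (\<forall>f\<in>borel_measurable borel. bounded (range f) \<longrightarrow> L' f = F f)" for F
    using eq by auto
  with assms(1) show ?thesis by (simp add: represented_by_density_def)
qed

lemma represented_by_density_zero: "represented_by_density (\<lambda>f. 0) 0"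
  unfolding represented_by_density_def
  by (intro exI[of _ "null_measure borel"] exI[of _ "\<lambda>_. 0"])
    (auto intro!: finite_measureI)

lemma represented_by_density_sum:
  assumes "finite I" "\<And>i. i \<in> I \<Longrightarrow> represented_by_density (L i) (c i)"
  shows "represented_by_density (\<lambda>f. \<Sum>i\<in>I. L i f) (\<Sum>i\<in>I. c i)"
  using assms
  by (induction I rule: finite_induct)
    (simp_all add: represented_by_density_zero represented_by_density_add)

lemma represented_by_density_uminus:
  assumes "represented_by_density L c"
  shows "represented_by_density (\<lambda>f. - L f) c"
proof -
  obtain M h where "finite_measure M" "sets M = sets borel" "h \<in> borel_measurable borel"
    "integrable M h" "(LINT x|M. \<bar>h x\<bar>) \<le> c"
    "\<And>f. f\<in>borel_measurable borel \<Longrightarrow> bounded (range f) \<Longrightarrow> L f = (LINT x|M. f x * h x)"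
    using assms by (auto simp: represented_by_density_def)
  then show ?thesis
    unfolding represented_by_density_def
    by (intro exI[of _ M] exI[of _ "\<lambda>x. - h x"]) auto
qed

lemma represented_by_density_distr_nonneg:
  assumes "finite_measure M" and [measurable_cong]: "sets M = sets borel"
    and [measurable]: "T \<in> borel_measurable borel" "k \<in> borel_measurable borel"
    and k: "integrable M k" "\<And>x. 0 \<le> k x"
  shows "represented_by_density (\<lambda>f. LINT x|M. f (T x) * k x) (LINT x|M. k x)"
proof -
  let ?D = "distr (density M (\<lambda>x. ennreal (k x))) borel T"
  have "emeasure ?D (space ?D) = ennreal (LINT x|M. k x)"
    using k by (simp add: emeasure_distr emeasure_density nn_integral_eq_integral)
  moreover from this have "measure ?D (space ?D) = (LINT x|M. k x)"
    using k by (simp add: measure_def)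
  ultimately show ?thesis
    unfolding represented_by_density_def
    using k
    by (intro exI[of _ ?D] exI[of _ "\<lambda>_. 1"] conjI ballI impI finite_measureI)
      (auto simp: integral_distr integral_real_density finite_measure.integrable_const finite_measureI mult.commute)
qed

text \<open>Splitting \<open>k\<close> into positive and negative part reduces the image to a
  difference of two positive measures. Mass of opposite sign on one fibre of \<open>T\<close> may
  cancel, which is why only an upper bound for the variation is recorded.\<close>

lemma represented_by_density_distr:
  assumes "finite_measure M" and [measurable_cong]: "sets M = sets borel"
    and [measurable]: "T \<in> borel_measurable borel" "k \<in> borel_measurable borel"
    and k: "integrable M k"
  shows "represented_by_density (\<lambda>f. LINT x|M. f (T x) * k x) (LINT x|M. \<bar>k x\<bar>)"
proof -
  have i: "integrable M (\<lambda>x. max 0 (k x))" "integrable M (\<lambda>x. max 0 (- k x))"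
    using k by auto
  have rep: "represented_by_density
      (\<lambda>f. (LINT x|M. f (T x) * max 0 (k x)) + - (LINT x|M. f (T x) * max 0 (- k x)))
      ((LINT x|M. max 0 (k x)) + (LINT x|M. max 0 (- k x)))"
    using i assms(1,2)
    by (intro represented_by_density_add represented_by_density_uminus
        represented_by_density_distr_nonneg) auto
  have eq: "(LINT x|M. max 0 (k x)) + (LINT x|M. max 0 (- k x)) = (LINT x|M. \<bar>k x\<bar>)"
    using i by (auto simp flip: Bochner_Integration.integral_add
        intro!: Bochner_Integration.integral_cong)
  have func: "(LINT x|M. f (T x) * max 0 (k x)) + - (LINT x|M. f (T x) * max 0 (- k x)) =
      (LINT x|M. f (T x) * k x)" if [measurable]: "f \<in> borel_measurable borel" and "bounded (range f)" for f
  proof -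
    have "bounded (range (\<lambda>x. f (T x)))"
      using that(2) by (rule bounded_subset) auto
    then have "integrable M (\<lambda>x. f (T x) * max 0 (k x))" "integrable M (\<lambda>x. f (T x) * max 0 (- k x))"
      using finite_measure.integrable_bounded_mult[OF assms(1)] i by auto
    then have "(LINT x|M. f (T x) * max 0 (k x)) - (LINT x|M. f (T x) * max 0 (- k x)) =
      (LINT x|M. f (T x) * max 0 (k x) - f (T x) * max 0 (- k x))" by simp
    also have "\<dots> = (LINT x|M. f (T x) * k x)"
      by (intro Bochner_Integration.integral_cong) (auto simp: max_def)
    finally show ?thesis by simp
  qed
  show ?thesis
    by (rule represented_by_density_cong[OF rep[unfolded eq] func])
qed

subsection \<open>Uniqueness of signed Radon measures\<close>

text \<open>Uniqueness of the Jordan decomposition. Equality of differences is phrased as equality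
  of sums because the values may be infinite. Two Hahn sets \<open>X\<close> and \<open>Y\<close>
  cut the space into pieces on each of which two of the four measures vanish, so nothing ever has to
  be cancelled.\<close>

lemma mutually_singular_unique:
  assumes s: "sets N = sets P" "sets P' = sets P" "sets N' = sets P"
    and "mutually_singular P N" "mutually_singular P' N'"
    and sum: "\<And>A. A \<in> sets P \<Longrightarrow> emeasure P A + emeasure N' A = emeasure P' A + emeasure N A"
  shows "P = P'" "N = N'"
proof -
  have *: "P = P'" if s: "sets N = sets P" "sets P' = sets P" "sets N' = sets P"
    and ms: "mutually_singular P N" "mutually_singular P' N'"
    and sum: "\<And>A. A \<in> sets P \<Longrightarrow> emeasure P A + emeasure N' A = emeasure P' A + emeasure N A"
    for P N P' N' :: "'a measure"
  proof (rule measure_eqI)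
    have sp: "space P' = space P" using s by (metis sets_eq_imp_space_eq)
    obtain X where X [measurable]: "X \<in> sets P" and X0: "emeasure P (space P - X) = 0" "emeasure N X = 0"
      using ms by (auto simp: mutually_singular_def)
    obtain Y where Y [measurable]: "Y \<in> sets P" and Y0: "emeasure P' (space P - Y) = 0" "emeasure N' Y = 0"
      using ms s sp by (auto simp: mutually_singular_def)
    show "sets P = sets P'" using s by simp
    have null: "emeasure M C = 0" if "emeasure M B = 0" "C \<subseteq> B" "B \<in> sets P" "sets M = sets P" for M B C
      using that by (metis emeasure_mono le_zero_eq)
    fix A assume A [measurable]: "A \<in> sets P"
    have AP: "A \<subseteq> space P" using sets.sets_into_space[OF A] .
    \<comment> \<open>Both terms on the right of \<open>sum\<close> vanish on this piece, hence so
      do those on the left.\<close>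
    have "emeasure P (A \<inter> X - Y) = 0"
    proof -
      have "emeasure P' (A \<inter> X - Y) = 0" by (rule null[OF Y0(1)]) (use AP s in auto)
      moreover have "emeasure N (A \<inter> X - Y) = 0" by (rule null[OF X0(2)]) (use s in auto)
      ultimately show ?thesis using sum[of "A \<inter> X - Y"] by auto
    qed
    moreover have "emeasure P (A - X) = 0" using null[OF X0(1), of "A - X"] AP by auto
    ultimately have "emeasure P ((A \<inter> X \<inter> Y) \<union> ((A \<inter> X - Y) \<union> (A - X))) = emeasure P (A \<inter> X \<inter> Y)"
      by (intro emeasure_Un_null_set null_sets.Un) auto
    also have "(A \<inter> X \<inter> Y) \<union> ((A \<inter> X - Y) \<union> (A - X)) = A" by auto
    finally have 1: "emeasure P A = emeasure P (A \<inter> X \<inter> Y)" .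
    have "emeasure P' (A \<inter> Y - X) = 0"
    proof -
      have "emeasure P (A \<inter> Y - X) = 0" by (rule null[OF X0(1)]) (use AP s in auto)
      moreover have "emeasure N' (A \<inter> Y - X) = 0" by (rule null[OF Y0(2)]) (use s in auto)
      ultimately show ?thesis using sum[of "A \<inter> Y - X"] by auto
    qed
    moreover have "emeasure P' (A - Y) = 0" using null[OF Y0(1), of "A - Y"] AP s by auto
    ultimately have "emeasure P' ((A \<inter> X \<inter> Y) \<union> ((A \<inter> Y - X) \<union> (A - Y))) = emeasure P' (A \<inter> X \<inter> Y)"
      using s by (intro emeasure_Un_null_set null_sets.Un) auto
    also have "(A \<inter> X \<inter> Y) \<union> ((A \<inter> Y - X) \<union> (A - Y)) = A" by auto
    finally have 2: "emeasure P' A = emeasure P' (A \<inter> X \<inter> Y)" .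
    have "emeasure P (A \<inter> X \<inter> Y) = emeasure P' (A \<inter> X \<inter> Y)"
    proof -
      have "emeasure N (A \<inter> X \<inter> Y) = 0" by (rule null[OF X0(2)]) (use s in auto)
      moreover have "emeasure N' (A \<inter> X \<inter> Y) = 0" by (rule null[OF Y0(2)]) (use s in auto)
      ultimately show ?thesis using sum[of "A \<inter> X \<inter> Y"] by auto
    qed
    with 1 2 show "emeasure P A = emeasure P' A" by simp
  qed
  have sym: "mutually_singular N P" if PN: "mutually_singular P N" "sets N = sets P" for P N :: "'a measure"
  proof -
    obtain A where A: "A \<in> sets P" "emeasure P (space P - A) = 0" "emeasure N A = 0"
      using PN(1) by (auto simp: mutually_singular_def)
    have sp: "space N = space P" using PN(2) by (rule sets_eq_imp_space_eq)
    moreover have "space P - (space P - A) = A" using sets.sets_into_space[OF A(1)] by auto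
    ultimately show ?thesis
      unfolding mutually_singular_def using A PN(2)
      by (intro bexI[of _ "space P - A"]) auto
  qed
  show "P = P'" by (rule *[OF s assms(4,5) sum])
  show "N = N'"
  proof (rule *[where N = P and N' = P'])
    show "mutually_singular N P" "mutually_singular N' P'" using sym assms by metis+
    show "emeasure N A + emeasure P' A = emeasure N' A + emeasure P A" if "A \<in> sets N" for A
      using sum[of A] that s by (simp add: add.commute)
  qed (use s in simp_all)
qed

section \<open>Continuously differentiable functions, bumps on boxes, and the uniqueness
  test\<close>

text \<open>Continuity is asked for in every fixed direction, not only along \<open>Basis\<close>:
  the radial derivative of a test function, in a direction that varies with the point, is needed
  later.\<close>

definition C1_fun :: "('a::euclidean_space \<Rightarrow> real) \<Rightarrow> bool" where
  "C1_fun f \<longleftrightarrow> (\<exists>f'. (\<forall>x. (f has_derivative f' x) (at x)) \<and> (\<forall>v. continuous_on UNIV (\<lambda>x. f' x v)))"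

lemma C1_funI:
  assumes "\<And>x. (f has_derivative f' x) (at x)" "\<And>v. continuous_on UNIV (\<lambda>x. f' x v)"
  shows "C1_fun f"
  using assms unfolding C1_fun_def by blast

lemma C1_fun_continuous: "C1_fun f \<Longrightarrow> continuous_on A f"
  unfolding C1_fun_def
  by (metis continuous_at_imp_continuous_on has_derivative_continuous)

lemma C1_fun_partial_deriv:
  assumes "C1_fun f"
  shows "(f has_derivative (\<lambda>v. partial_deriv v f x)) (at x)" "continuous_on A (partial_deriv v f)"
proof -
  obtain f' where f': "\<And>x. (f has_derivative f' x) (at x)" "\<And>v. continuous_on UNIV (\<lambda>x. f' x v)"
    using assms unfolding C1_fun_def by blast
  have eq: "partial_deriv v f x = f' x v" for v x
    using frechet_derivative_at[OF f'(1)[of x]] by (simp add: partial_deriv_def)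
  show "(f has_derivative (\<lambda>v. partial_deriv v f x)) (at x)"
    using f'(1)[of x] by (simp add: eq)
  have "partial_deriv v f = (\<lambda>x. f' x v)" by (simp add: eq fun_eq_iff)
  then show "continuous_on A (partial_deriv v f)"
    using f'(2)[of v] continuous_on_subset by (metis subset_UNIV)
qed

lemma C1_fun_mult:
  assumes "C1_fun f" "C1_fun g" shows "C1_fun (\<lambda>x. f x * g x)"
  using C1_fun_partial_deriv[OF assms(1)] C1_fun_partial_deriv[OF assms(2)]
    C1_fun_continuous[OF assms(1)] C1_fun_continuous[OF assms(2)]
  by (intro C1_funI[where f' = "\<lambda>x v. f x * partial_deriv v g x + partial_deriv v f x * g x"])
    (auto intro!: has_derivative_mult continuous_intros)

lemma C1_fun_const: "C1_fun (\<lambda>x. c)"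
  by (intro C1_funI[where f' = "\<lambda>x v. 0"]) auto

lemma C1_fun_prod:
  assumes "finite I" "\<And>i. i \<in> I \<Longrightarrow> C1_fun (f i)" shows "C1_fun (\<lambda>x. \<Prod>i\<in>I. f i x)"
  using assms by (induction I rule: finite_induct) (auto simp: C1_fun_const C1_fun_mult)

lemma C1_fun_comp_real:
  assumes h: "\<And>t. (h has_real_derivative h' t) (at t)" "continuous_on UNIV h'" and f: "C1_fun f"
  shows "C1_fun (\<lambda>x. h (f x))"
proof (rule C1_funI[where f' = "\<lambda>x v. h' (f x) * partial_deriv v f x"])
  show "((\<lambda>x. h (f x)) has_derivative (\<lambda>v. h' (f x) * partial_deriv v f x)) (at x)" for x
    using has_derivative_compose[OF C1_fun_partial_deriv(1)[OF f] h(1)[unfolded has_field_derivative_def]]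
    by (simp add: mult.commute)
  show "continuous_on UNIV (\<lambda>x. h' (f x) * partial_deriv v f x)" for v
    using C1_fun_partial_deriv(2)[OF f] continuous_on_compose2[OF h(2) C1_fun_continuous[OF f]]
    by (intro continuous_intros) auto
qed

lemma C1_fun_inner: "C1_fun (\<lambda>x. x \<bullet> i)"
  by (intro C1_funI[where f' = "\<lambda>x v. v \<bullet> i"]) (auto intro!: derivative_eq_intros continuous_intros)

text \<open>Squaring removes the corner of the positive part at 0; this is the one-dimensional
  building block of the bumps.\<close>

lemma has_real_derivative_max_0_square:
  "((\<lambda>t. (max 0 t)\<^sup>2) has_real_derivative 2 * max 0 t) (at t)"
proof (cases "t = 0")
  case True
  have "((\<lambda>h::real. (max 0 h)\<^sup>2 / h) \<longlongrightarrow> 0) (at 0)"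
  proof (rule tendsto_rabs_zero_cancel, rule tendsto_sandwich)
    show "\<forall>\<^sub>F h::real in at 0. 0 \<le> \<bar>(max 0 h)\<^sup>2 / h\<bar>"
      by (intro always_eventually) simp
    show "\<forall>\<^sub>F h::real in at 0. \<bar>(max 0 h)\<^sup>2 / h\<bar> \<le> \<bar>h\<bar>"
      by (intro always_eventually) (auto simp: max_def power2_eq_square)
    show "((\<lambda>h::real. \<bar>h\<bar>) \<longlongrightarrow> 0) (at 0)" by (auto intro!: tendsto_eq_intros)
  qed simp
  then show ?thesis using True by (simp add: DERIV_def)
next
  case False
  then consider "t < 0" | "t > 0" by linarith
  then show ?thesis
  proof cases
    case 1
    have "((\<lambda>t::real. 0) has_real_derivative 2 * max 0 t) (at t)"
      using 1 by (auto intro!: derivative_eq_intros)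
    then show ?thesis
      by (rule has_field_derivative_transform_within_open[of _ _ _ "{..<0}"]) (use 1 in auto)
  next
    case 2
    have "((\<lambda>t::real. t\<^sup>2) has_real_derivative 2 * max 0 t) (at t)"
      using 2 by (auto intro!: derivative_eq_intros)
    then show ?thesis
      by (rule has_field_derivative_transform_within_open[of _ _ _ "{0<..}"]) (use 2 in auto)
  qed
qed

lemma C1_compact_supportI:
  assumes f: "C1_fun f" and S: "compact S" "\<And>x. f x \<noteq> 0 \<Longrightarrow> x \<in> S"
  shows "f \<in> C1_compact_support"
proof -
  have "closure {x. f x \<noteq> 0} \<subseteq> S"
    using S by (intro closure_minimal) (auto simp: compact_imp_closed)
  then have "compact (closure {x. f x \<noteq> 0})"
    using S(1) by (metis closed_closure compact_Int_closed inf.absorb_iff2)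
  then show ?thesis
    using C1_fun_partial_deriv[OF f] unfolding C1_compact_support_def differentiable_def by blast
qed

text \<open>The test class controls the partial derivatives along \<open>Basis\<close> only;
  expanding \<open>v\<close> in that basis and using linearity of the derivative reaches every
  direction.\<close>

lemma C1_fun_C1_compact_support:
  assumes "f \<in> C1_compact_support" shows "C1_fun f"
proof (rule C1_funI[where f' = "\<lambda>x. frechet_derivative f (at x)"])
  have d: "f differentiable (at x)" for x using assms by (simp add: C1_compact_support_def)
  then show der: "(f has_derivative frechet_derivative f (at x)) (at x)" for x
    by (simp add: frechet_derivative_works)
  fix v :: 'a
  have "frechet_derivative f (at x) v = (\<Sum>i\<in>Basis. (v \<bullet> i) * partial_deriv i f x)" for x
  proof -
    have l: "linear (frechet_derivative f (at x))"
      using der has_derivative_linear by blast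
    have "frechet_derivative f (at x) v = frechet_derivative f (at x) (\<Sum>i\<in>Basis. (v \<bullet> i) *\<^sub>R i)"
      by (simp add: euclidean_representation)
    also have "\<dots> = (\<Sum>i\<in>Basis. (v \<bullet> i) * partial_deriv i f x)"
      by (simp add: linear_sum[OF l] linear_scale[OF l] partial_deriv_def)
    finally show ?thesis .
  qed
  then show "continuous_on UNIV (\<lambda>x. frechet_derivative f (at x) v)"
    using assms by (auto simp: C1_compact_support_def intro!: continuous_intros)
qed

text \<open>\<open>C\<^sup>1\<close> functions that increase to the indicator of the box as \<open>n\<close> grows.\<close>

definition box_bump :: "'a::euclidean_space \<Rightarrow> 'a \<Rightarrow> nat \<Rightarrow> 'a \<Rightarrow> real" where
  "box_bump a b n x =
     1 - exp (- (real n * (\<Prod>i\<in>Basis. (max 0 (x \<bullet> i - a \<bullet> i))\<^sup>2 * (max 0 (b \<bullet> i - x \<bullet> i))\<^sup>2)))"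

lemma box_bump_range: "0 \<le> box_bump a b n x" "box_bump a b n x \<le> 1"
  by (auto simp: box_bump_def intro!: mult_nonneg_nonneg prod_nonneg)

lemma box_bump_eq_0:
  assumes "x \<notin> box a b" shows "box_bump a b n x = 0"
proof -
  obtain i where "i \<in> Basis" "x \<bullet> i \<le> a \<bullet> i \<or> b \<bullet> i \<le> x \<bullet> i"
    using assms by (auto simp: mem_box not_less)
  then have "(\<Prod>i\<in>Basis. (max 0 (x \<bullet> i - a \<bullet> i))\<^sup>2 * (max 0 (b \<bullet> i - x \<bullet> i))\<^sup>2) = 0"
    by (intro prod_zero bexI[of _ i]) auto
  then show ?thesis by (simp add: box_bump_def)
qed

text \<open>The product in the exponent is positive inside the box and 0 outside, so the exponential
  tends to 0 inside and is constantly 1 outside.\<close>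

lemma box_bump_tendsto: "(\<lambda>n. box_bump a b n x) \<longlonglongrightarrow> indicator (box a b) x"
proof (cases "x \<in> box a b")
  case True
  define p where "p = (\<Prod>i\<in>Basis. (max 0 (x \<bullet> i - a \<bullet> i))\<^sup>2 * (max 0 (b \<bullet> i - x \<bullet> i))\<^sup>2)"
  have "p > 0" unfolding p_def using True by (intro prod_pos) (auto simp: mem_box)
  then have "filterlim (\<lambda>n. real n * p) at_top sequentially"
    by (intro filterlim_at_top_mult_tendsto_pos[OF tendsto_const] filterlim_real_sequentially)
      (auto simp: mult.commute)
  then have "(\<lambda>n. exp (- (real n * p))) \<longlonglongrightarrow> 0"
    by (intro filterlim_compose[OF exp_at_bot] filterlim_compose[OF filterlim_uminus_at_bot_at_top])
  from tendsto_diff[OF tendsto_const this, of 1] show ?thesis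
    using True by (simp add: box_bump_def p_def)
qed (simp add: box_bump_eq_0)

lemma C1_fun_box_bump: "C1_fun (box_bump a b n)"
proof -
  have d1: "((\<lambda>t. (max 0 (t - c))\<^sup>2) has_real_derivative 2 * max 0 (t - c)) (at t)" for c t :: real
  proof -
    have "((\<lambda>t. t - c) has_real_derivative 1) (at t)" by (auto intro!: derivative_eq_intros)
    from DERIV_chain2[where f="\<lambda>t. (max 0 t)\<^sup>2", OF has_real_derivative_max_0_square this]
    show ?thesis by simp
  qed
  have d2: "((\<lambda>t. (max 0 (c - t))\<^sup>2) has_real_derivative - 2 * max 0 (c - t)) (at t)" for c t :: real
  proof -
    have "((\<lambda>t. c - t) has_real_derivative -1) (at t)" by (auto intro!: derivative_eq_intros)
    from DERIV_chain2[where f="\<lambda>t. (max 0 t)\<^sup>2", OF has_real_derivative_max_0_square this]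
    show ?thesis by simp
  qed
  have "C1_fun (\<lambda>x. (max 0 (x \<bullet> i - c))\<^sup>2)" "C1_fun (\<lambda>x. (max 0 (c - x \<bullet> i))\<^sup>2)" for i :: 'a and c
    by (rule C1_fun_comp_real[OF d1 _ C1_fun_inner] C1_fun_comp_real[OF d2 _ C1_fun_inner],
        intro continuous_intros)+
  then have "C1_fun (\<lambda>x. \<Prod>i\<in>Basis. (max 0 (x \<bullet> i - a \<bullet> i))\<^sup>2 * (max 0 (b \<bullet> i - x \<bullet> i))\<^sup>2)"
    by (intro C1_fun_prod C1_fun_mult) auto
  then show ?thesis
    unfolding box_bump_def
    by (rule C1_fun_comp_real[rotated 2, of _ "\<lambda>t. 1 - exp (- (real n * t))" "\<lambda>t. real n * exp (- (real n * t))"])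
      (auto intro!: derivative_eq_intros continuous_intros)
qed

lemma box_bump_C1_compact_support: "box_bump a b n \<in> C1_compact_support"
  by (rule C1_compact_supportI[OF C1_fun_box_bump compact_cbox[of a b]])
    (use box_bump_eq_0 box_subset_cbox in blast)

text \<open>Boxes whose closed box lies in \<open>U\<close> are the right generator: Radon measures
  are finite on them and their bumps are supported in \<open>U\<close>. By the Lindelof property
  every open subset of \<open>U\<close> is a countable union of such boxes.\<close>

lemma sigma_sets_boxes:
  fixes U :: "'a::euclidean_space set"
  assumes "open U"
  shows "sets (restrict_space borel U) = sigma_sets U {box a b |a b. cbox a b \<subseteq> U}" (is "_ = sigma_sets U ?E")
    and "\<exists>A\<subseteq>{box a b |a b. cbox a b \<subseteq> U}. countable A \<and> \<Union>A = U"
proof -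
  have ex: "\<exists>A\<subseteq>{box a b |a b. cbox a b \<subseteq> S}. countable A \<and> \<Union>A = S" if "open S" for S :: "'a set"
  proof -
    have "\<Union>{box a b |a b. cbox a b \<subseteq> S} = S"
    proof (intro equalityI subsetI)
      fix x assume "x \<in> S"
      then obtain a b where "cbox a b \<subseteq> S" "x \<in> box a b"
        using open_contains_cbox[OF \<open>open S\<close>] by metis
      then show "x \<in> \<Union>{box a b |a b. cbox a b \<subseteq> S}" by auto
    qed (use box_subset_cbox in blast)
    moreover obtain A where "A \<subseteq> {box a b |a b. cbox a b \<subseteq> S}" "countable A"
      "\<Union>A = \<Union>{box a b |a b. cbox a b \<subseteq> S}"
      by (rule Lindelof[of "{box a b |a b. cbox a b \<subseteq> S}"]) auto
    ultimately show ?thesis by auto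
  qed
  then show "\<exists>A\<subseteq>?E. countable A \<and> \<Union>A = U" using assms .
  have "sets (restrict_space borel U) = (\<inter>) U ` sigma_sets UNIV (range (\<lambda>(a, b). box a b))"
    by (simp add: sets_restrict_space borel_eq_box)
  also have "\<dots> = sigma_sets U ((\<inter>) U ` range (\<lambda>(a, b). box a b))"
  proof (rule sigma_sets_Int)
    have "U \<in> sets borel" using assms by simp
    then show "U \<in> sigma_sets UNIV (range (\<lambda>(a, b). box a b))"
      by (simp add: borel_eq_box)
  qed simp
  also have "\<dots> = sigma_sets U ?E"
  proof (rule sigma_sets_eqI)
    fix A assume "A \<in> (\<inter>) U ` range (\<lambda>(a, b). box a b)"
    then have "open A" "A \<subseteq> U" using assms by auto
    then obtain C where C: "C \<subseteq> {box a b |a b. cbox a b \<subseteq> A}" "countable C" "\<Union>C = A"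
      using ex[OF \<open>open A\<close>] by auto
    have "C \<subseteq> ?E" using C(1) \<open>A \<subseteq> U\<close> by fast
    then have "C \<subseteq> sigma_sets U ?E" by (auto intro: sigma_sets.Basic)
    then show "A \<in> sigma_sets U ?E" using C sigma_sets_UNION[of C U ?E] by auto
  next
    fix A assume "A \<in> ?E"
    then obtain a b where "A = box a b" "cbox a b \<subseteq> U" by auto
    then have "A = U \<inter> box a b" using box_subset_cbox by blast
    then show "A \<in> sigma_sets U ((\<inter>) U ` range (\<lambda>(a, b). box a b))" by auto
  qed
  finally show "sets (restrict_space borel U) = sigma_sets U ?E" .
qed

text \<open>Dominated convergence. The majorant is the indicator of the closed box, integrable
  because a Radon measure is finite on compact sets.\<close>

lemma box_bump_integral_tendsto:
  assumes "open U" "radon_measure_on U M" "cbox a b \<subseteq> U"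
  shows "(\<lambda>n. integral\<^sup>L M (box_bump a b n)) \<longlonglongrightarrow> measure M (box a b)"
    and "emeasure M (box a b) < \<infinity>"
proof -
  have s [measurable_cong]: "sets M = sets (restrict_space borel U)" and "emeasure M (cbox a b) < \<infinity>"
    using assms by (auto simp: radon_measure_on_def)
  have m: "box a b \<in> sets M" "cbox a b \<in> sets M"
    using assms box_subset_cbox[of a b] by (auto simp: s sets_restrict_space_iff)
  show "emeasure M (box a b) < \<infinity>"
    using emeasure_mono[OF box_subset_cbox m(2)] \<open>emeasure M (cbox a b) < \<infinity>\<close> by (rule le_less_trans)
  have "box_bump a b n \<in> borel_measurable borel" for n
    by (intro borel_measurable_continuous_onI C1_fun_continuous C1_fun_box_bump)
  then have meas: "box_bump a b n \<in> borel_measurable M" for n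
    by (simp add: measurable_cong_sets[OF s refl] measurable_restrict_space1)
  have "(\<lambda>n. integral\<^sup>L M (box_bump a b n)) \<longlonglongrightarrow> integral\<^sup>L M (indicator (box a b))"
  proof (rule integral_dominated_convergence[where w = "indicator (cbox a b)"])
    show "integrable M (indicator (cbox a b) :: 'a \<Rightarrow> real)"
      using m \<open>emeasure M (cbox a b) < \<infinity>\<close> by simp
    show "AE x in M. norm (box_bump a b n x) \<le> indicator (cbox a b) x" for n
      using box_bump_range[of a b n] box_bump_eq_0[of _ a b n] box_subset_cbox[of a b]
      by (intro AE_I2) (force simp: indicator_def)
  qed (use m meas in \<open>auto intro: box_bump_tendsto\<close>)
  then show "(\<lambda>n. integral\<^sup>L M (box_bump a b n)) \<longlonglongrightarrow> measure M (box a b)" using m by simp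
qed

text \<open>On boxes all masses are finite, so the equality of integrals of bumps can be rearranged,
  in the limit, to an equality of sums. Sums of measures extend from the generating boxes to all
  Borel sets of \<open>U\<close>, and uniqueness of the Jordan decomposition finishes. Only test
  functions supported in \<open>U\<close> may be used, since on the half-line the measures need not
  be finite near 0.\<close>

lemma signed_radon_measure_unique:
  fixes U :: "'a::euclidean_space set"
  assumes U: "open U" and \<mu>: "signed_radon_measure_on U \<mu>" and \<nu>: "signed_radon_measure_on U \<nu>"
    and eq: "\<And>\<phi>. \<phi> \<in> C1_compact_support \<Longrightarrow> closure {x. \<phi> x \<noteq> 0} \<subseteq> U \<Longrightarrow> signed_integral \<mu> \<phi> = signed_integral \<nu> \<phi>"
  shows "\<mu> = \<nu>"
proof -
  obtain P N P' N' where [simp]: "\<mu> = (P, N)" "\<nu> = (P', N')" by (cases \<mu>, cases \<nu>)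
  let ?E = "{box a b |a b. cbox a b \<subseteq> U}"
  have r: "radon_measure_on U P" "radon_measure_on U N" "radon_measure_on U P'" "radon_measure_on U N'"
    using \<mu> \<nu> by (auto simp: signed_radon_measure_on_def)
  then have s: "sets P = sets (restrict_space borel U)" "sets N = sets (restrict_space borel U)"
    "sets P' = sets (restrict_space borel U)" "sets N' = sets (restrict_space borel U)"
    by (auto simp: radon_measure_on_def)
  have fin: "emeasure M X = ennreal (measure M X)" if "radon_measure_on U M" "X \<in> ?E" for M X
    using that box_bump_integral_tendsto(2)[OF U, of M] by (force intro!: emeasure_eq_ennreal_measure)
  \<comment> \<open>These crossed pairs need not be Jordan decompositions;
    \<open>variation_measure\<close> again just forms the sum of two measures.\<close>
  have "variation_measure (P, N') = variation_measure (P', N)"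
  proof -
    obtain A where A: "A \<subseteq> ?E" "countable A" "\<Union>A = U" using sigma_sets_boxes(2)[OF U] by blast
    have ms: "X \<in> sets (restrict_space borel U)" if "X \<in> ?E" for X
      using that by (auto simp: sigma_sets_boxes(1)[OF U])
    have sum: "emeasure P X + emeasure N' X = emeasure P' X + emeasure N X"
      and fin': "emeasure P X + emeasure N' X \<noteq> \<infinity>" if X: "X \<in> ?E" for X
    proof -
      obtain a b where ab: "X = box a b" "cbox a b \<subseteq> U" using X by auto
      have "closure {x. box_bump a b n x \<noteq> 0} \<subseteq> cbox a b" for n
        by (rule closure_minimal) (use box_bump_eq_0 box_subset_cbox in blast)+
      then have "signed_integral \<mu> (box_bump a b n) = signed_integral \<nu> (box_bump a b n)" for n
        using ab by (intro eq box_bump_C1_compact_support) blast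
      moreover have "(\<lambda>n. signed_integral \<mu> (box_bump a b n)) \<longlonglongrightarrow> measure P X - measure N X"
        "(\<lambda>n. signed_integral \<nu> (box_bump a b n)) \<longlonglongrightarrow> measure P' X - measure N' X"
        using ab r unfolding signed_integral_def
        by (auto intro!: tendsto_diff box_bump_integral_tendsto(1)[OF U])
      ultimately have "measure P X - measure N X = measure P' X - measure N' X"
        using LIMSEQ_unique by simp
      then have "measure P X + measure N' X = measure P' X + measure N X" by simp
      then have "ennreal (measure P X) + ennreal (measure N' X) = ennreal (measure P' X) + ennreal (measure N X)"
        by (simp flip: ennreal_plus)
      with fin[OF _ X] r show "emeasure P X + emeasure N' X = emeasure P' X + emeasure N X" by simp
      show "emeasure P X + emeasure N' X \<noteq> \<infinity>" using fin[OF _ X] r by simp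
    qed
    show ?thesis
    proof (rule measure_eqI_generator_eq_countable[of ?E U])
      show "Int_stable ?E"
      proof (rule Int_stableI)
        fix X Y assume "X \<in> ?E" "Y \<in> ?E"
        then obtain a b c d where *: "X = box a b" "Y = box c d" "cbox a b \<subseteq> U" "cbox c d \<subseteq> U" by auto
        have "cbox (\<Sum>i\<in>Basis. max (a\<bullet>i) (c\<bullet>i) *\<^sub>R i) (\<Sum>i\<in>Basis. min (b\<bullet>i) (d\<bullet>i) *\<^sub>R i) \<subseteq> U"
          using * by (subst Int_interval[symmetric]) auto
        then show "X \<inter> Y \<in> ?E" unfolding * box_Int_box by blast
      qed
      show "?E \<subseteq> Pow U" using box_subset_cbox by blast
      show "emeasure (variation_measure (P, N')) X = emeasure (variation_measure (P', N)) X" if "X \<in> ?E" for X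
        using sum[OF that] ms[OF that] s by (simp add: emeasure_variation_measure)
      show "sets (variation_measure (P, N')) = sigma_sets U ?E" "sets (variation_measure (P', N)) = sigma_sets U ?E"
        using s by (simp_all add: sets_variation_measure sigma_sets_boxes(1)[OF U])
      show "emeasure (variation_measure (P, N')) X \<noteq> \<infinity>" if "X \<in> A" for X
        using fin'[of X] ms[of X] s subsetD[OF A(1) that] by (simp add: emeasure_variation_measure)
    qed (use A in auto)
  qed
  then have "emeasure P X + emeasure N' X = emeasure P' X + emeasure N X" if "X \<in> sets P" for X
    using that s emeasure_variation_measure[of P N' X] emeasure_variation_measure[of P' N X] by simp
  then have "P = P'" "N = N'"
    using mutually_singular_unique[of N P P' N'] \<mu> \<nu> s by (auto simp: signed_radon_measure_on_def)
  then show ?thesis by simp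
qed

subsection \<open>Polar coordinates\<close>

text \<open>The surface measure as cone measure: \<open>\<sigma>(B) = d \<sqdot> vol {x. 0 < |x| \<le> 1, x/|x| \<in> B}\<close>.\<close>

definition sphere_measure :: "'a::euclidean_space measure" where
  "sphere_measure =
     distr (density lborel (\<lambda>x. of_nat DIM('a) * indicator (cball 0 1 - {0}) x)) borel sgn"

text \<open>The indicator keeps this a measure on the whole line, so that products and Borel
  functions need no restricted spaces.\<close>

definition radius_measure :: "nat \<Rightarrow> real measure" where
  "radius_measure d = density lborel (\<lambda>r. ennreal (r ^ (d - 1)) * indicator {0<..} r)"

lemma sets_sphere_measure [simp, measurable_cong]: "sets sphere_measure = sets borel"
  by (simp add: sphere_measure_def)

lemma sets_radius_measure [simp, measurable_cong]: "sets (radius_measure d) = sets borel"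
  by (simp add: radius_measure_def)

lemma space_sphere_measure [simp]: "space sphere_measure = UNIV"
  by (simp add: sphere_measure_def)

lemma space_radius_measure [simp]: "space (radius_measure d) = UNIV"
  by (simp add: radius_measure_def)

lemma borel_measurable_punctured_ball [measurable]:
  "(\<lambda>x::'a::euclidean_space. of_nat n * indicator (cball 0 1 - {0}) x :: ennreal) \<in> borel_measurable borel"
proof -
  have [measurable]: "cball 0 1 - {0::'a} \<in> sets borel" by (intro sets.Diff) auto
  show ?thesis by measurable
qed

lemma emeasure_sphere_measure:
  fixes B :: "'a::euclidean_space set"
  assumes [measurable]: "B \<in> sets borel"
  shows "emeasure sphere_measure B =
    of_nat DIM('a) * emeasure lborel {x. x \<noteq> 0 \<and> norm x \<le> 1 \<and> sgn x \<in> B}"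
proof -
  have "emeasure sphere_measure B =
      (\<integral>\<^sup>+x. of_nat DIM('a) * indicator (cball 0 1 - {0}) x * indicator (sgn -` B) x \<partial>lborel)"
    unfolding sphere_measure_def
  proof (subst emeasure_distr)
    have "sgn -` B \<in> sets lborel"
      using measurable_sets[OF borel_measurable_sgn assms] by simp
    then show "emeasure (density lborel (\<lambda>x. of_nat DIM('a) * indicator (cball 0 1 - {0}) x))
        (sgn -` B \<inter> space (density lborel (\<lambda>x::'a. of_nat DIM('a) * indicator (cball 0 1 - {0}) x))) =
      (\<integral>\<^sup>+x. of_nat DIM('a) * indicator (cball 0 1 - {0}) x * indicator (sgn -` B) x \<partial>lborel)"
      by (subst emeasure_density) auto
  qed auto
  also have "\<dots> = (\<integral>\<^sup>+x. of_nat DIM('a) * indicator {x. x \<noteq> 0 \<and> norm x \<le> 1 \<and> sgn x \<in> B} x \<partial>lborel)"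
    by (intro nn_integral_cong) (auto simp: indicator_def)
  also have "\<dots> = of_nat DIM('a) * emeasure lborel {x. x \<noteq> 0 \<and> norm x \<le> 1 \<and> sgn x \<in> B}"
    by (subst nn_integral_cmult_indicator) auto
  finally show ?thesis .
qed

lemma finite_measure_sphere_measure: "finite_measure (sphere_measure :: 'a::euclidean_space measure)"
proof (rule finite_measureI)
  have "emeasure lborel {x::'a. x \<noteq> 0 \<and> norm x \<le> 1} \<le> emeasure lborel (cball 0 1 :: 'a set)"
    by (intro emeasure_mono) auto
  also have "\<dots> < \<infinity>" using emeasure_lborel_cball_finite[of "0::'a" 1] by simp
  finally have "emeasure lborel {x::'a. x \<noteq> 0 \<and> norm x \<le> 1} < \<infinity>" .
  then show "emeasure sphere_measure (space sphere_measure :: 'a set) \<noteq> \<infinity>"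
    by (simp add: emeasure_sphere_measure ennreal_mult_eq_top_iff)
qed

interpretation sphere_measure: finite_measure sphere_measure
  by (rule finite_measure_sphere_measure)

lemma measure_sphere_measure_pos: "0 < measure sphere_measure (UNIV :: 'a::euclidean_space set)"
proof -
  have "emeasure lborel (cball 0 1 :: 'a set) \<le> emeasure lborel ({0} \<union> {x::'a. x \<noteq> 0 \<and> norm x \<le> 1})"
    by (intro emeasure_mono) auto
  also have "\<dots> \<le> emeasure lborel {0::'a} + emeasure lborel {x::'a. x \<noteq> 0 \<and> norm x \<le> 1}"
    by (intro emeasure_subadditive) auto
  finally have "emeasure lborel (cball 0 1 :: 'a set) \<le> emeasure lborel {x::'a. x \<noteq> 0 \<and> norm x \<le> 1}"
    by simp
  moreover have "0 < emeasure lborel (cball 0 1 :: 'a set)"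
    using content_cball_gt_0_iff[of "0::'a" 1]
    by (metis enn2real_0 less_irrefl measure_def not_gr_zero zero_less_one)
  ultimately have "emeasure lborel {x::'a. x \<noteq> 0 \<and> norm x \<le> 1} \<noteq> 0"
    by auto
  then have "emeasure sphere_measure (UNIV :: 'a set) \<noteq> 0"
    by (simp add: emeasure_sphere_measure)
  then show ?thesis
    using sphere_measure.emeasure_eq_measure[of "UNIV :: 'a set"] zero_less_measure_iff by fastforce
qed

lemma AE_sphere_measure: "AE x in sphere_measure. norm x = 1"
  unfolding sphere_measure_def
  by (subst AE_distr_iff) (auto simp: norm_sgn intro!: AE_density[THEN iffD2])

lemma emeasure_radius_measure_atMost:
  assumes "0 < a" "1 \<le> d"
  shows "emeasure (radius_measure d) {..a} = ennreal (a ^ d / d)"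
proof -
  have "emeasure (radius_measure d) {..a} =
      (\<integral>\<^sup>+r. ennreal (r ^ (d - 1)) * indicator {0<..} r * indicator {..a} r \<partial>lborel)"
    unfolding radius_measure_def by (subst emeasure_density) auto
  also have "\<dots> = (\<integral>\<^sup>+r. ennreal (r ^ (d - 1)) * indicator {0..a} r \<partial>lborel)"
    using AE_lborel_singleton[of "0::real"]
    by (intro nn_integral_cong_AE) (auto simp: indicator_def elim!: eventually_mono)
  also have "\<dots> = ennreal (a ^ d / d - 0 ^ d / d)"
  proof (rule nn_integral_FTC_Icc)
    show "((\<lambda>r. r ^ d / d) has_real_derivative r ^ (d - 1)) (at r)" for r
      using assms by (auto intro!: derivative_eq_intros)
  qed (use assms in auto)
  finally show ?thesis using assms by (simp add: power_0_left)
qed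

lemma sigma_finite_radius_measure:
  "sigma_finite_measure (radius_measure d)"
  unfolding radius_measure_def
  by (subst sigma_finite_measure.sigma_finite_iff_density_finite[OF sigma_finite_lborel])
    (auto simp: indicator_def ennreal_mult_eq_top_iff)

text \<open>Dilations preserve \<open>sgn\<close>, so the sector of radius \<open>a\<close> is the
  dilated unit sector and only the Jacobian of the dilation appears.\<close>

lemma emeasure_cone_scale:
  fixes B :: "'a::euclidean_space set"
  assumes [measurable]: "B \<in> sets borel" and a: "0 < a"
  shows "emeasure lborel {x. x \<noteq> 0 \<and> norm x \<le> a \<and> sgn x \<in> B} =
    ennreal (a ^ DIM('a)) * emeasure lborel {x. x \<noteq> 0 \<and> norm x \<le> 1 \<and> sgn x \<in> B}"
proof -
  have "emeasure lborel {x::'a. x \<noteq> 0 \<and> norm x \<le> a \<and> sgn x \<in> B} =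
      emeasure (density (distr lborel borel (\<lambda>x. 0 + a *\<^sub>R x)) (\<lambda>_. \<bar>a\<bar> ^ DIM('a)))
        {x::'a. x \<noteq> 0 \<and> norm x \<le> a \<and> sgn x \<in> B}"
    using a by (subst lborel_affine[of a 0]) auto
  also have "\<dots> = ennreal (a ^ DIM('a)) *
      emeasure lborel ((\<lambda>x. 0 + a *\<^sub>R x) -` {x::'a. x \<noteq> 0 \<and> norm x \<le> a \<and> sgn x \<in> B})"
    using a by (subst emeasure_density_const) (auto simp: emeasure_distr ennreal_power)
  also have "(\<lambda>x. 0 + a *\<^sub>R x) -` {x::'a. x \<noteq> 0 \<and> norm x \<le> a \<and> sgn x \<in> B} =
      {x. x \<noteq> 0 \<and> norm x \<le> 1 \<and> sgn x \<in> B}"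
    using a by (auto simp: sgn_scaleR)
  finally show ?thesis .
qed

text \<open>For fixed \<open>B\<close> both sides are measures in \<open>A\<close>. They need
  comparing only on the half-lines \<open>{..a}\<close>, a generator stable under intersection, and
  there the volume of a sector scales like the d-th power of \<open>a\<close>.\<close>

lemma emeasure_polar_rectangle:
  fixes B :: "'a::euclidean_space set"
  assumes [measurable]: "A \<in> sets borel" "B \<in> sets borel"
  shows "emeasure (radius_measure DIM('a)) A * emeasure sphere_measure B =
    emeasure lborel {x. x \<noteq> 0 \<and> norm x \<in> A \<and> sgn x \<in> B}"
proof -
  define M where "M = density (radius_measure DIM('a)) (\<lambda>_. emeasure sphere_measure B)"
  define N where "N = distr (density lborel (indicator {x::'a. x \<noteq> 0 \<and> sgn x \<in> B})) borel norm"
  have N: "emeasure N C = emeasure lborel {x::'a. x \<noteq> 0 \<and> norm x \<in> C \<and> sgn x \<in> B}"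
    if [measurable]: "C \<in> sets borel" for C
  proof -
    have "emeasure N C = emeasure (density lborel (indicator {x::'a. x \<noteq> 0 \<and> sgn x \<in> B})) {x. norm x \<in> C}"
      by (simp add: N_def emeasure_distr vimage_def)
    also have "\<dots> = (\<integral>\<^sup>+x. indicator {x::'a. x \<noteq> 0 \<and> sgn x \<in> B} x * indicator {x. norm x \<in> C} x \<partial>lborel)"
      by (rule emeasure_density) auto
    also have "\<dots> = (\<integral>\<^sup>+x. indicator {x::'a. x \<noteq> 0 \<and> norm x \<in> C \<and> sgn x \<in> B} x \<partial>lborel)"
      by (rule nn_integral_cong) (auto simp: indicator_def)
    also have "\<dots> = emeasure lborel {x::'a. x \<noteq> 0 \<and> norm x \<in> C \<and> sgn x \<in> B}"
      by (rule nn_integral_indicator) simp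
    finally show ?thesis .
  qed
  have M: "emeasure M C = emeasure (radius_measure DIM('a)) C * emeasure sphere_measure B"
    if "C \<in> sets borel" for C
    using that by (simp add: M_def emeasure_density_const mult.commute)
  have eq: "emeasure M {..a} = emeasure N {..a}" for a
  proof (cases "a > 0")
    case True
    have "emeasure M {..a} = ennreal (a ^ DIM('a) / DIM('a)) *
      (of_nat DIM('a) * emeasure lborel {x::'a. x \<noteq> 0 \<and> norm x \<le> 1 \<and> sgn x \<in> B})"
      using True by (simp add: M emeasure_radius_measure_atMost emeasure_sphere_measure Suc_leI)
    \<comment> \<open>The factor \<open>DIM('a)\<close> in the cone measure is chosen to cancel the
      1/d from integrating the radial weight.\<close>
    also have "\<dots> = ennreal (a ^ DIM('a) / DIM('a) * DIM('a)) *
        emeasure lborel {x::'a. x \<noteq> 0 \<and> norm x \<le> 1 \<and> sgn x \<in> B}"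
      using True by (subst ennreal_mult) (auto simp: mult.assoc ennreal_of_nat_eq_real_of_nat)
    also have "\<dots> = emeasure N {..a}"
    proof -
      have "{x::'a. x \<noteq> 0 \<and> norm x \<in> {..a} \<and> sgn x \<in> B} = {x. x \<noteq> 0 \<and> norm x \<le> a \<and> sgn x \<in> B}"
        by auto
      then show ?thesis
        using emeasure_cone_scale[OF assms(2) True] by (simp add: N)
    qed
    finally show ?thesis .
  next
    case False
    have empty: "{x::'a. x \<noteq> 0 \<and> norm x \<in> {..a} \<and> sgn x \<in> B} = {}"
    proof (intro equals0I)
      fix x assume "x \<in> {x::'a. x \<noteq> 0 \<and> norm x \<in> {..a} \<and> sgn x \<in> B}"
      then have "0 < norm x" "norm x \<le> a" by auto
      then show False using False by linarith
    qed
    have "emeasure N {..a} = 0" by (subst N) (simp, simp only: empty emeasure_empty)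
    moreover have "emeasure (radius_measure DIM('a)) {..a} = 0"
      using False unfolding radius_measure_def
      by (subst emeasure_density) (auto simp: indicator_def intro!: nn_integral_0_iff_AE[THEN iffD2] AE_I2)
    ultimately show ?thesis by (simp add: M)
  qed
  have "M = N"
  proof (rule measure_eqI_generator_eq[where E = "range atMost" and \<Omega> = UNIV and A = "\<lambda>n. {..real n}"])
    show "Int_stable (range (atMost :: real \<Rightarrow> _))"
      by (auto intro!: Int_stableI simp: min_def)
    show "emeasure M X = emeasure N X" if "X \<in> range atMost" for X
      using that eq by auto
    have "sets (borel :: real measure) = sigma_sets UNIV (range atMost)"
      by (subst borel_eq_atMost) simp
    then show "sets M = sigma_sets UNIV (range atMost)" "sets N = sigma_sets UNIV (range atMost)"
      by (simp_all add: M_def N_def)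
    show "(\<Union>i. {..real i}) = UNIV" using real_arch_simple by auto
    fix i :: nat
    have "emeasure N {..real i} \<le> emeasure lborel (cball (0::'a) i)"
      by (subst N) (auto intro!: emeasure_mono)
    also have "\<dots> < \<infinity>" using emeasure_lborel_cball_finite[of "0::'a" "real i"] by simp
    finally show "emeasure M {..real i} \<noteq> \<infinity>" by (simp add: eq)
  qed auto
  then show ?thesis using M[of A] N[of A] by simp
qed

lemma norm_scaleR_sgn: "norm x *\<^sub>R sgn x = (x :: 'a::real_normed_vector)"
  by (cases "x = 0") (simp_all add: sgn_div_norm)

text \<open>Product measures are determined by rectangles, so the identity is first proved for the
  image of Lebesgue measure under x -> (|x|, x/|x|), where rectangles pull back to sectors.
  Multiplying radius and direction recovers x, also at the origin.\<close>

theorem lborel_eq_distr_polar: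
  "lborel = distr (radius_measure DIM('a) \<Otimes>\<^sub>M sphere_measure) borel (\<lambda>(r, \<theta>). r *\<^sub>R \<theta> :: 'a::euclidean_space)"
proof -
  have T [measurable]: "(\<lambda>x::'a. (norm x, sgn x)) \<in> borel \<rightarrow>\<^sub>M borel \<Otimes>\<^sub>M borel"
    by measurable
  have "radius_measure DIM('a) \<Otimes>\<^sub>M sphere_measure =
      distr lborel (borel \<Otimes>\<^sub>M borel) (\<lambda>x::'a. (norm x, sgn x))"
  proof (rule pair_measure_eqI)
    show "sigma_finite_measure (radius_measure DIM('a))"
      by (rule sigma_finite_radius_measure)
    show "sigma_finite_measure sphere_measure" by unfold_locales
    show "sets (radius_measure DIM('a) \<Otimes>\<^sub>M (sphere_measure :: 'a measure)) =
      sets (distr lborel (borel \<Otimes>\<^sub>M borel) (\<lambda>x::'a. (norm x, sgn x)))"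
      by (simp cong: sets_pair_measure_cong)
    fix A B assume "A \<in> sets (radius_measure DIM('a))" "B \<in> sets (sphere_measure :: 'a measure)"
    then have [measurable]: "A \<in> sets borel" "B \<in> sets borel" by simp_all
    have "emeasure (distr lborel (borel \<Otimes>\<^sub>M borel) (\<lambda>x::'a. (norm x, sgn x))) (A \<times> B) =
        emeasure lborel {x::'a. norm x \<in> A \<and> sgn x \<in> B}"
      by (subst emeasure_distr) (auto simp: vimage_def)
    \<comment> \<open>Since \<open>sgn 0 = 0\<close>, the origin may belong to the left set; it is a
      null set.\<close>
    also have "\<dots> = emeasure lborel {x::'a. x \<noteq> 0 \<and> norm x \<in> A \<and> sgn x \<in> B}"
      using AE_lborel_singleton[of "0::'a"] by (intro emeasure_eq_AE) (auto elim!: eventually_mono)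
    finally show "emeasure (radius_measure DIM('a)) A * emeasure sphere_measure B =
        emeasure (distr lborel (borel \<Otimes>\<^sub>M borel) (\<lambda>x::'a. (norm x, sgn x))) (A \<times> B)"
      by (simp add: emeasure_polar_rectangle)
  qed
  moreover have "distr (distr lborel (borel \<Otimes>\<^sub>M borel) (\<lambda>x::'a. (norm x, sgn x))) borel (\<lambda>(r, \<theta>). r *\<^sub>R \<theta>) =
      distr lborel borel (\<lambda>x. x)"
    by (subst distr_distr) (auto simp: comp_def norm_scaleR_sgn intro!: distr_cong)
  ultimately show ?thesis
    using distr_id2[of borel "lborel :: 'a measure"] by simp
qed

subsection \<open>Integrals of directional derivatives\<close>

lemma
  fixes f :: "'a::euclidean_space \<Rightarrow> real"
  assumes [measurable]: "f \<in> borel_measurable borel"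
  shows integral_lborel_translate: "(LINT x|lborel. f (c + x)) = (LINT x|lborel. f x)"
    and integrable_lborel_translate: "integrable lborel (\<lambda>x. f (c + x)) \<longleftrightarrow> integrable lborel f"
proof -
  show "(LINT x|lborel. f (c + x)) = (LINT x|lborel. f x)"
    using integral_distr[of "(+) c" lborel borel f] by (simp add: lborel_distr_plus)
  show "integrable lborel (\<lambda>x. f (c + x)) \<longleftrightarrow> integrable lborel f"
    using integrable_distr_eq[of "(+) c" lborel borel f] by (simp add: lborel_distr_plus)
qed

text \<open>The increment f(x + v) - f(x) is the integral of \<open>f'\<close> along the segment.
  Integrated over x it vanishes by translation invariance, while Fubini and translation invariance
  turn the other side into the integral of \<open>f'\<close>.\<close>

lemma integral_directional_derivative_eq_0:
  fixes f f' :: "'a::euclidean_space \<Rightarrow> real"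
  assumes der: "\<And>x. ((\<lambda>t. f (x + t *\<^sub>R v)) has_real_derivative f' x) (at 0)"
    and cont: "continuous_on UNIV f'" and f: "integrable lborel f" and f': "integrable lborel f'"
  shows "(LINT x|lborel. f' x) = 0"
proof -
  have [measurable]: "f' \<in> borel_measurable borel" "f \<in> borel_measurable borel"
    using f f' by simp_all
  have P: "pair_sigma_finite (lborel :: real measure) (lborel :: 'a measure)"
    by (intro pair_sigma_finite.intro sigma_finite_lborel)
  have der': "((\<lambda>t. f (x + t *\<^sub>R v)) has_real_derivative f' (x + s *\<^sub>R v)) (at s)" for x s
  proof -
    have "((\<lambda>t. f (x + s *\<^sub>R v + (t - s) *\<^sub>R v)) has_real_derivative f' (x + s *\<^sub>R v)) (at s)"
      using der[of "x + s *\<^sub>R v"]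
        DERIV_shift[of "\<lambda>t. f (x + s *\<^sub>R v + t *\<^sub>R v)" "f' (x + s *\<^sub>R v)" s "- s"] by simp
    then show ?thesis by (simp add: algebra_simps)
  qed
  have FTC: "(LINT s|lborel. indicator {0..1} s *\<^sub>R f' (x + s *\<^sub>R v)) = f (x + v) - f x" for x
  proof -
    have "(LINT s|lborel. indicator {0..1} s *\<^sub>R f' (x + s *\<^sub>R v)) = f (x + 1 *\<^sub>R v) - f (x + 0 *\<^sub>R v)"
    proof (rule integral_FTC_atLeastAtMost[where F = "\<lambda>s. f (x + s *\<^sub>R v)"])
      show "continuous_on {0..1} (\<lambda>s. f' (x + s *\<^sub>R v))"
        by (intro continuous_on_compose2[OF cont] continuous_intros) auto
      show "((\<lambda>s. f (x + s *\<^sub>R v)) has_vector_derivative f' (x + s *\<^sub>R v)) (at s within {0..1})" for s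
        using has_field_derivative_at_within[OF der'[of x s]]
        by (simp add: has_real_derivative_iff_has_vector_derivative)
    qed simp
    then show ?thesis by simp
  qed
  have int: "integrable (lborel \<Otimes>\<^sub>M lborel) (\<lambda>(s, x). indicator {0..1::real} s *\<^sub>R f' (x + s *\<^sub>R v))"
  proof (rule pair_sigma_finite.Fubini_integrable[OF P])
    show "(\<lambda>(s, x). indicator {0..1::real} s *\<^sub>R f' (x + s *\<^sub>R v)) \<in> borel_measurable (lborel \<Otimes>\<^sub>M lborel)"
      by measurable
    have "(LINT x|lborel. norm (indicator {0..1::real} s *\<^sub>R f' (x + s *\<^sub>R v))) =
        indicator {0..1} s * (LINT x|lborel. \<bar>f' x\<bar>)" for s
      using integral_lborel_translate[of "\<lambda>x. \<bar>f' x\<bar>" "s *\<^sub>R v"] by (simp add: abs_mult add.commute)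
    then show "integrable lborel (\<lambda>s. LINT x|lborel. norm (case (s, x) of (s, x) \<Rightarrow>
        indicator {0..1::real} s *\<^sub>R f' (x + s *\<^sub>R v)))"
      by simp
    have "integrable lborel (\<lambda>x. f' (x + s *\<^sub>R v))" for s
      using integrable_lborel_translate[of f' "s *\<^sub>R v"] f' by (simp add: add.commute)
    then show "AE s in lborel. integrable lborel (\<lambda>x. case (s, x) of (s, x) \<Rightarrow>
        indicator {0..1::real} s *\<^sub>R f' (x + s *\<^sub>R v))"
      by simp
  qed
  have "0 = (LINT x|lborel. f (x + v) - f x)"
    using integral_lborel_translate[of f v] integrable_lborel_translate[of f v] f
    by (simp add: add.commute)
  also have "\<dots> = (LINT x|lborel. LINT s|lborel. indicator {0..1} s *\<^sub>R f' (x + s *\<^sub>R v))"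
    by (simp only: FTC)
  also have "\<dots> = (LINT s|lborel. LINT x|lborel. indicator {0..1::real} s *\<^sub>R f' (x + s *\<^sub>R v))"
    using pair_sigma_finite.Fubini_integral[OF P int] by simp
  also have "\<dots> = (LINT s|lborel. indicator {0..1::real} s * (LINT x|lborel. f' x))"
  proof -
    have "(LINT x|lborel. f' (x + s *\<^sub>R v)) = (LINT x|lborel. f' x)" for s
      using integral_lborel_translate[of f' "s *\<^sub>R v"] by (simp add: add.commute)
    then show ?thesis by simp
  qed
  finally show ?thesis by simp
qed

lemma C1_fun_directional_derivative:
  assumes "C1_fun f"
  shows "((\<lambda>t. f (x + t *\<^sub>R v)) has_real_derivative partial_deriv v f (x + s *\<^sub>R v)) (at s)"
proof -
  have "((\<lambda>t. x + t *\<^sub>R v) has_derivative (\<lambda>t. t *\<^sub>R v)) (at s)"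
    by (auto intro!: derivative_eq_intros)
  from has_derivative_compose[OF this C1_fun_partial_deriv(1)[OF assms]]
  have "((\<lambda>t. f (x + t *\<^sub>R v)) has_derivative (\<lambda>t. partial_deriv (t *\<^sub>R v) f (x + s *\<^sub>R v))) (at s)" .
  moreover have "partial_deriv (t *\<^sub>R v) f y = partial_deriv v f y * t" for t y
    using linear_scale[OF has_derivative_linear[OF C1_fun_partial_deriv(1)[OF assms, of y]], of t v]
    by (simp add: mult.commute)
  ultimately show ?thesis by (simp add: has_field_derivative_def)
qed

lemma partial_deriv_eqI: "(f has_derivative f') (at x) \<Longrightarrow> partial_deriv v f x = f' v"
  unfolding partial_deriv_def using frechet_derivative_at by metis

lemma partial_deriv_sum_Basis:
  assumes "C1_fun f"
  shows "partial_deriv v f x = (\<Sum>i\<in>Basis. (v \<bullet> i) * partial_deriv i f x)"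
proof -
  note l = has_derivative_linear[OF C1_fun_partial_deriv(1)[OF assms, of x]]
  have "partial_deriv v f x = partial_deriv (\<Sum>i\<in>Basis. (v \<bullet> i) *\<^sub>R i) f x"
    by (simp add: euclidean_representation)
  also have "\<dots> = (\<Sum>i\<in>Basis. (v \<bullet> i) * partial_deriv i f x)"
    by (subst linear_sum[OF l]) (simp add: linear_scale[OF l])
  finally show ?thesis .
qed

lemma C1_compact_support_bounded:
  assumes "f \<in> C1_compact_support"
  obtains R where "0 < R" "\<And>x. R \<le> norm x \<Longrightarrow> f x = 0"
    "\<And>x v. R \<le> norm x \<Longrightarrow> partial_deriv v f x = 0"
proof -
  have "bounded (closure {x. f x \<noteq> 0})"
    using assms by (auto simp: C1_compact_support_def compact_imp_bounded)
  then obtain B where B: "\<And>x. f x \<noteq> 0 \<Longrightarrow> norm x \<le> B"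
    using closure_subset by (force simp: bounded_iff)
  \<comment> \<open>The margin 1 makes \<open>f\<close> vanish on an open set containing all points
    of norm at least \<open>R\<close>, so its derivative vanishes at these points too.\<close>
  define R where "R = max B 0 + 1"
  have z: "f x = 0" if "norm x > R - 1" for x using B[of x] that by (force simp: R_def)
  show ?thesis
  proof (rule that[of R])
    show "0 < R" by (simp add: R_def)
    show "f x = 0" if "R \<le> norm x" for x using z[of x] that by simp
    show "partial_deriv v f x = 0" if "R \<le> norm x" for x v
    proof -
      have "((\<lambda>x. 0) has_derivative (\<lambda>v. 0)) (at x)" by simp
      then have "(f has_derivative (\<lambda>v. 0)) (at x)"
        by (rule has_derivative_transform_within_open[where s = "{x. R - 1 < norm x}"])
          (use that z in \<open>auto intro!: open_Collect_less continuous_intros\<close>)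
      then show ?thesis by (rule partial_deriv_eqI)
    qed
  qed
qed

lemma integrable_continuous_bounded_support:
  fixes f :: "'a::euclidean_space \<Rightarrow> real"
  assumes "continuous_on UNIV f" "\<And>x. R \<le> norm x \<Longrightarrow> f x = 0"
  shows "integrable lborel f"
proof -
  have "integrable lborel (\<lambda>x. indicator (cball 0 R) x *\<^sub>R f x)"
    using assms by (intro borel_integrable_compact continuous_on_subset[OF assms(1)]) auto
  moreover have "(\<lambda>x. indicator (cball 0 R) x *\<^sub>R f x) = f"
    using assms(2) by (force simp: indicator_def)
  ultimately show ?thesis by simp
qed

subsection \<open>Integrals over the sphere\<close>

text \<open>Uniform continuity on a compact product. Uniformity in \<theta> is what allows limits
  and derivatives in the radius to pass under the integral over the sphere.\<close>

lemma continuous_uniform_on_ball: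
  fixes F :: "real \<Rightarrow> 'a::euclidean_space \<Rightarrow> real"
  assumes "continuous_on UNIV (\<lambda>(r, \<theta>). F r \<theta>)" and "0 < e"
  obtains \<delta> where "0 < \<delta>" "\<And>s \<theta>. \<bar>s - r\<bar> < \<delta> \<Longrightarrow> norm \<theta> \<le> 1 \<Longrightarrow> \<bar>F s \<theta> - F r \<theta>\<bar> < e"
proof -
  have "uniformly_continuous_on (cball r 1 \<times> cball 0 1) (\<lambda>(r, \<theta>). F r \<theta>)"
    by (intro compact_uniformly_continuous continuous_on_subset[OF assms(1)] compact_Times) auto
  then obtain d where d: "0 < d" "\<And>p q. p \<in> cball r 1 \<times> cball 0 1 \<Longrightarrow> q \<in> cball r 1 \<times> cball 0 1 \<Longrightarrow>
      dist q p < d \<Longrightarrow> dist (case q of (r, \<theta>) \<Rightarrow> F r \<theta>) (case p of (r, \<theta>) \<Rightarrow> F r \<theta>) < e"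
    using \<open>0 < e\<close> unfolding uniformly_continuous_on_def by metis
  show ?thesis
  proof (rule that[of "min d 1"])
    fix s and \<theta> :: 'a assume "\<bar>s - r\<bar> < min d 1" "norm \<theta> \<le> 1"
    then show "\<bar>F s \<theta> - F r \<theta>\<bar> < e"
      using d(2)[of "(r, \<theta>)" "(s, \<theta>)"] by (simp add: dist_Pair_Pair dist_real_def abs_minus_commute)
  qed (use d in simp)
qed

lemma continuous_on_Pair_section:
  "continuous_on UNIV (\<lambda>(r, \<theta>). F r \<theta>) \<Longrightarrow> continuous_on UNIV (F r)"
  by (rule continuous_on_compose2[where f = "\<lambda>\<theta>. (r, \<theta>)" and g = "\<lambda>(r, \<theta>). F r \<theta>", simplified])
    (auto intro!: continuous_intros)

lemma integrable_sphere_measure: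
  fixes f :: "'a::euclidean_space \<Rightarrow> real"
  assumes "continuous_on UNIV f"
  shows "integrable sphere_measure f"
proof -
  have "bounded (f ` cball 0 1)"
    by (intro compact_imp_bounded compact_continuous_image continuous_on_subset[OF assms]) auto
  then obtain B where "\<forall>x\<in>cball 0 1. norm (f x) \<le> B" by (auto simp: bounded_iff)
  then have "\<And>x. norm x \<le> 1 \<Longrightarrow> norm (f x) \<le> B" by simp
  moreover have "f \<in> borel_measurable borel" using assms by (rule borel_measurable_continuous_onI)
  ultimately show ?thesis
    using AE_sphere_measure
    by (intro sphere_measure.integrable_const_bound[of _ B]) (auto elim!: eventually_mono)
qed

lemma abs_integral_sphere_measure_le:
  fixes f :: "'a::euclidean_space \<Rightarrow> real"
  assumes "continuous_on UNIV f" and "\<And>\<theta>. norm \<theta> \<le> 1 \<Longrightarrow> \<bar>f \<theta>\<bar> \<le> B"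
  shows "\<bar>LINT \<theta>|sphere_measure. f \<theta>\<bar> \<le> B * measure sphere_measure (UNIV :: 'a set)"
proof -
  have "\<bar>LINT \<theta>|sphere_measure. f \<theta>\<bar> \<le> (LINT \<theta>|sphere_measure. \<bar>f \<theta>\<bar>)"
    by (rule integral_abs_bound)
  also have "\<dots> \<le> (LINT \<theta>|(sphere_measure :: 'a measure). B)"
    using assms AE_sphere_measure
    by (intro integral_mono_AE integrable_abs integrable_sphere_measure)
      (auto elim!: eventually_mono)
  finally show ?thesis by (simp add: mult.commute)
qed

lemma continuous_on_sphere_integral:
  fixes F :: "real \<Rightarrow> 'a::euclidean_space \<Rightarrow> real"
  assumes F: "continuous_on UNIV (\<lambda>(r, \<theta>). F r \<theta>)"
  shows "continuous_on UNIV (\<lambda>r. LINT \<theta>|sphere_measure. F r \<theta>)"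
proof (rule continuous_at_imp_continuous_on, intro ballI)
  fix r
  let ?\<omega> = "measure sphere_measure (UNIV :: 'a set)"
  note c = continuous_on_Pair_section[OF F]
  show "isCont (\<lambda>r. LINT \<theta>|sphere_measure. F r \<theta>) r"
    unfolding continuous_at_eps_delta
  proof (intro allI impI)
    fix e :: real assume "0 < e"
    then have "0 < e / (2 * ?\<omega>)" using measure_sphere_measure_pos[where 'a='a] by simp
    from continuous_uniform_on_ball[OF F this, of r] obtain \<delta> where \<delta>: "0 < \<delta>"
      "\<And>s \<theta>. \<bar>s - r\<bar> < \<delta> \<Longrightarrow> norm \<theta> \<le> 1 \<Longrightarrow> \<bar>F s \<theta> - F r \<theta>\<bar> < e / (2 * ?\<omega>)" by metis
    have "dist (LINT \<theta>|sphere_measure. F s \<theta>) (LINT \<theta>|sphere_measure. F r \<theta>) < e" if "dist s r < \<delta>" for s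
    proof -
      have "dist (LINT \<theta>|sphere_measure. F s \<theta>) (LINT \<theta>|sphere_measure. F r \<theta>) =
          \<bar>LINT \<theta>|sphere_measure. F s \<theta> - F r \<theta>\<bar>"
        using integrable_sphere_measure[OF c] by (simp add: dist_real_def)
      also have "\<dots> \<le> e / (2 * ?\<omega>) * ?\<omega>"
        using that \<delta> by (intro abs_integral_sphere_measure_le continuous_intros c)
          (auto simp: dist_real_def less_imp_le)
      also have "\<dots> < e" using \<open>0 < e\<close> measure_sphere_measure_pos[where 'a='a] by simp
      finally show ?thesis .
    qed
    with \<delta>(1) show "\<exists>d>0. \<forall>s. dist s r < d \<longrightarrow>
        dist (LINT \<theta>|sphere_measure. F s \<theta>) (LINT \<theta>|sphere_measure. F r \<theta>) < e" by blast
  qed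
qed

text \<open>The mean value inequality, applied in s to
  \<open>F s \<theta> - F' r \<theta> * s\<close>, bounds the first-order remainder uniformly in
  \<theta>. The tolerance is e / \<omega> because integration over the sphere multiplies it by the
  total mass \<omega>.\<close>

lemma has_real_derivative_sphere_integral:
  fixes F F' :: "real \<Rightarrow> 'a::euclidean_space \<Rightarrow> real"
  assumes F: "continuous_on UNIV (\<lambda>(r, \<theta>). F r \<theta>)" and F': "continuous_on UNIV (\<lambda>(r, \<theta>). F' r \<theta>)"
    and der: "\<And>r \<theta>. ((\<lambda>r. F r \<theta>) has_real_derivative F' r \<theta>) (at r)"
  shows "((\<lambda>r. LINT \<theta>|sphere_measure. F r \<theta>) has_real_derivative
    (LINT \<theta>|sphere_measure. F' r \<theta>)) (at r)"
proof -
  let ?\<omega> = "measure sphere_measure (UNIV :: 'a set)"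
  note c = continuous_on_Pair_section[OF F] and c' = continuous_on_Pair_section[OF F']
  note int = integrable_sphere_measure[OF c] and int' = integrable_sphere_measure[OF c']
  show ?thesis
    unfolding has_field_derivative_def has_derivative_at_alt
  proof (intro conjI allI impI)
    show "bounded_linear ((*) (LINT \<theta>|sphere_measure. F' r \<theta>))" by (rule bounded_linear_mult_right)
    fix e :: real assume "0 < e"
    then have "0 < e / ?\<omega>" using measure_sphere_measure_pos[where 'a='a] by simp
    from continuous_uniform_on_ball[OF F' this, of r] obtain \<delta> where \<delta>: "0 < \<delta>"
      "\<And>s \<theta>. \<bar>s - r\<bar> < \<delta> \<Longrightarrow> norm \<theta> \<le> 1 \<Longrightarrow> \<bar>F' s \<theta> - F' r \<theta>\<bar> < e / ?\<omega>" by metis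
    have "norm ((LINT \<theta>|sphere_measure. F s \<theta>) - (LINT \<theta>|sphere_measure. F r \<theta>) -
        (LINT \<theta>|sphere_measure. F' r \<theta>) * (s - r)) \<le> e * norm (s - r)" if s: "norm (s - r) < \<delta>" for s
    proof -
      have "\<bar>F s \<theta> - F r \<theta> - F' r \<theta> * (s - r)\<bar> \<le> e / ?\<omega> * \<bar>s - r\<bar>" if "norm \<theta> \<le> 1" for \<theta>
      proof -
        have "norm ((F s \<theta> - F' r \<theta> * s) - (F r \<theta> - F' r \<theta> * r)) \<le> e / ?\<omega> * norm (s - r)"
        proof (rule field_differentiable_bound[where S = "ball r \<delta>" and f' = "\<lambda>s. F' s \<theta> - F' r \<theta>"
              and f = "\<lambda>s. F s \<theta> - F' r \<theta> * s"])
          show "((\<lambda>s. F s \<theta> - F' r \<theta> * s) has_field_derivative F' z \<theta> - F' r \<theta>) (at z within ball r \<delta>)" for z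
            using der by (auto intro!: derivative_eq_intros has_field_derivative_at_within[OF der])
          show "norm (F' z \<theta> - F' r \<theta>) \<le> e / ?\<omega>" if "z \<in> ball r \<delta>" for z
            using \<delta>(2)[of z \<theta>] that \<open>norm \<theta> \<le> 1\<close> by (simp add: dist_real_def abs_minus_commute)
        qed (use s \<delta>(1) in \<open>auto simp: dist_real_def abs_minus_commute\<close>)
        then show ?thesis by (simp add: algebra_simps)
      qed
      then have "\<bar>LINT \<theta>|sphere_measure. F s \<theta> - F r \<theta> - F' r \<theta> * (s - r)\<bar> \<le> e / ?\<omega> * \<bar>s - r\<bar> * ?\<omega>"
        by (intro abs_integral_sphere_measure_le continuous_intros c c')
      also have "\<dots> = e * \<bar>s - r\<bar>" using measure_sphere_measure_pos[where 'a='a] by simp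
      finally show ?thesis using int int' by simp
    qed
    with \<delta>(1) show "\<exists>d>0. \<forall>s. norm (s - r) < d \<longrightarrow>
        norm ((LINT \<theta>|sphere_measure. F s \<theta>) - (LINT \<theta>|sphere_measure. F r \<theta>) -
        (LINT \<theta>|sphere_measure. F' r \<theta>) * (s - r)) \<le> e * norm (s - r)" by blast
  qed
qed

text \<open>The reflection x -> -x preserves Lebesgue measure and the punctured ball, whereas the
  integrand is odd. This is what makes the flux vanish at radius 0.\<close>

lemma integral_sphere_inner_eq_0: "(LINT \<theta>|sphere_measure. \<theta> \<bullet> i) = (0::real)"
proof -
  define k where "k x = DIM('a) * indicat_real (cball 0 1 - {0}) x" for x :: 'a
  define f where "f x = k x *\<^sub>R (sgn x \<bullet> i)" for x :: 'a
  have [measurable]: "k \<in> borel_measurable borel"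
    unfolding k_def
    by (intro borel_measurable_times borel_measurable_const borel_measurable_indicator sets.Diff) auto
  have sgn [measurable]: "(\<lambda>x::'a. sgn x \<bullet> i) \<in> borel_measurable borel"
    by (intro borel_measurable_inner borel_measurable_sgn borel_measurable_const)
  have [measurable]: "f \<in> borel_measurable borel" unfolding f_def by simp
  have "sphere_measure = distr (density lborel (\<lambda>x::'a. ennreal (k x))) borel sgn"
    unfolding sphere_measure_def k_def
    by (simp add: ennreal_mult ennreal_indicator ennreal_of_nat_eq_real_of_nat)
  then have "(LINT \<theta>|sphere_measure. \<theta> \<bullet> i) =
      (LINT \<theta>|distr (density lborel (\<lambda>x::'a. ennreal (k x))) borel sgn. \<theta> \<bullet> i)"
    by simp
  also have "\<dots> = (LINT x|density lborel (\<lambda>x::'a. ennreal (k x)). sgn x \<bullet> i)"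
    by (rule integral_distr) auto
  also have "\<dots> = (LINT x|lborel. f x)"
    unfolding f_def using sgn by (intro integral_density AE_I2) (simp_all, simp add: k_def)
  finally have "(LINT \<theta>|sphere_measure. \<theta> \<bullet> i) = (LINT x|lborel. f x)" .
  moreover have "(LINT x|lborel. f x) = - (LINT x|lborel. f x)"
  proof -
    have "(LINT x|lborel. f x) = (LINT x|density (distr lborel borel (\<lambda>x. 0 + (-1) *\<^sub>R x)) (\<lambda>_. ennreal (\<bar>-1\<bar> ^ DIM('a))). f x)"
      by (subst lborel_affine[of "-1" "0::'a"]) simp_all
    also have "\<dots> = (LINT x|lborel. f (- x))"
      by (simp add: density_1 integral_distr flip: one_ennreal_def)
    also have "\<dots> = - (LINT x|lborel. f x)"
      by (simp add: f_def k_def indicator_def sgn_minus flip: integral_minus)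
    finally show ?thesis .
  qed
  ultimately show ?thesis by simp
qed

lemma distr_norm_lborel:
  "distr (lborel :: 'a::euclidean_space measure) borel norm =
    density (radius_measure DIM('a)) (\<lambda>_. ennreal (measure sphere_measure (UNIV :: 'a set)))"
proof (rule measure_eqI)
  fix A assume "A \<in> sets (distr (lborel :: 'a measure) borel norm)"
  then have [measurable]: "A \<in> sets borel" by simp
  have "emeasure (distr (lborel :: 'a measure) borel norm) A = emeasure lborel {x::'a. norm x \<in> A}"
    by (simp add: emeasure_distr vimage_def)
  also have "\<dots> = emeasure lborel {x::'a. x \<noteq> 0 \<and> norm x \<in> A \<and> sgn x \<in> UNIV}"
    using AE_lborel_singleton[of "0::'a"] by (intro emeasure_eq_AE) (auto elim!: eventually_mono)
  also have "\<dots> = emeasure (radius_measure DIM('a)) A * emeasure sphere_measure (UNIV :: 'a set)"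
    by (rule emeasure_polar_rectangle[symmetric]) auto
  also have "\<dots> = emeasure (density (radius_measure DIM('a))
      (\<lambda>_. ennreal (measure sphere_measure (UNIV :: 'a set)))) A"
    by (simp add: emeasure_density_const sphere_measure.emeasure_eq_measure mult.commute)
  finally show "emeasure (distr (lborel :: 'a measure) borel norm) A = \<dots>" .
qed simp

lemma
  assumes [measurable]: "g \<in> borel_measurable borel"
  shows integral_radial: "(LINT x|(lborel :: 'a::euclidean_space measure). g (norm x)) =
      measure sphere_measure (UNIV :: 'a set) * (LINT r|radius_measure DIM('a). g r)" (is ?int)
    and integrable_radial: "integrable (lborel :: 'a measure) (\<lambda>x. g (norm x)) \<longleftrightarrow>
      integrable (radius_measure DIM('a)) (g :: real \<Rightarrow> real)" (is ?intble)
proof -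
  let ?D = "density (radius_measure DIM('a)) (\<lambda>_. ennreal (measure sphere_measure (UNIV :: 'a set)))"
  have g [measurable]: "g \<in> borel_measurable (radius_measure DIM('a))" by measurable
  have "(LINT x|(lborel :: 'a measure). g (norm x)) = integral\<^sup>L ?D g"
    by (subst distr_norm_lborel[symmetric]) (simp add: integral_distr)
  also have "\<dots> = (LINT r|radius_measure DIM('a). measure sphere_measure (UNIV :: 'a set) *\<^sub>R g r)"
    by (rule integral_density) auto
  finally show ?int by simp
  have "integrable (lborel :: 'a measure) (\<lambda>x. g (norm x)) \<longleftrightarrow> integrable ?D g"
    by (subst distr_norm_lborel[symmetric]) (simp add: integrable_distr_eq)
  also have "\<dots> \<longleftrightarrow> integrable (radius_measure DIM('a)) (\<lambda>r. measure sphere_measure (UNIV :: 'a set) *\<^sub>R g r)"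
    by (rule integrable_density) auto
  also have "\<dots> \<longleftrightarrow> integrable (radius_measure DIM('a)) g"
    using measure_sphere_measure_pos[where 'a='a] by simp
  finally show ?intble .
qed

text \<open>Translation between the Borel measure used for polar coordinates and the completed,
  restricted Lebesgue measure used in the definitions.\<close>

lemma
  assumes [measurable]: "h \<in> borel_measurable borel"
  shows integral_radius_measure:
      "(LINT r|radius_measure d. h r) = (LINT t|lebesgue_on {0<..}. h t * t ^ (d - 1))" (is ?int)
    and integral_radius_measure_lborel:
      "(LINT r|radius_measure d. h r) = (LINT t|lborel. indicator {0<..} t * (h t * t ^ (d - 1)))" (is ?lborel)
    and integrable_radius_measure:
      "integrable (radius_measure d) (h :: real \<Rightarrow> real) \<longleftrightarrow>
        integrable (lebesgue_on {0<..}) (\<lambda>t. h t * t ^ (d - 1))" (is ?intble)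
proof -
  let ?w = "\<lambda>r::real. indicator {0<..} r * r ^ (d - 1)"
  have eq: "radius_measure d = density lborel (\<lambda>r. ennreal (?w r))"
    unfolding radius_measure_def by (intro density_cong) (auto simp: indicator_def)
  have w: "AE r in lborel. 0 \<le> ?w r" by (auto simp: indicator_def)
  have "(LINT r|radius_measure d. h r) = (LINT r|lborel. ?w r *\<^sub>R h r)"
    unfolding eq using w by (intro integral_density) auto
  then show ?lborel by (simp add: ac_simps)
  also have "\<dots> = (LINT t|lebesgue. indicator {0<..} t *\<^sub>R (h t * t ^ (d - 1)))"
    by (subst integral_completion) auto
  also have "\<dots> = (LINT t|lebesgue_on {0<..}. h t * t ^ (d - 1))"
    by (subst integral_restrict_space) auto
  finally show ?int .
  have "integrable (radius_measure d) h \<longleftrightarrow> integrable lborel (\<lambda>r. ?w r *\<^sub>R h r)"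
    unfolding eq using w by (intro integrable_density) auto
  also have "\<dots> \<longleftrightarrow> integrable lebesgue (\<lambda>t. indicator {0<..} t *\<^sub>R (h t * t ^ (d - 1)))"
    by (subst integrable_completion) (auto simp: ac_simps)
  also have "\<dots> \<longleftrightarrow> integrable (lebesgue_on {0<..}) (\<lambda>t. h t * t ^ (d - 1))"
    by (subst integrable_restrict_space) auto
  finally show ?intble .
qed

lemma integral_polar:
  fixes f :: "'a::euclidean_space \<Rightarrow> real"
  assumes f: "integrable lborel f"
  shows "(LINT x|lborel. f x) =
    (LINT r|radius_measure DIM('a). LINT \<theta>|sphere_measure. f (r *\<^sub>R \<theta>))"
proof -
  have P: "pair_sigma_finite (radius_measure DIM('a)) (sphere_measure :: 'a measure)"
    by (intro pair_sigma_finite.intro sigma_finite_radius_measure sphere_measure.sigma_finite_measure_axioms)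
  let ?P = "radius_measure DIM('a) \<Otimes>\<^sub>M (sphere_measure :: 'a measure)"
  let ?m = "\<lambda>(r, \<theta>). r *\<^sub>R \<theta> :: 'a"
  have m [measurable]: "?m \<in> ?P \<rightarrow>\<^sub>M borel" by measurable
  have fm: "f \<in> borel_measurable borel" using f by simp
  have "integrable (distr ?P borel ?m) f" using f by (subst lborel_eq_distr_polar[symmetric])
  then have "integrable ?P (\<lambda>p. f (?m p))"
    using integrable_distr_eq[OF m fm] by simp
  from pair_sigma_finite.integral_fst'[OF P this]
  have "(LINT r|radius_measure DIM('a). LINT \<theta>|sphere_measure. f (r *\<^sub>R \<theta>)) = (LINT p|?P. f (?m p))"
    by simp
  also have "\<dots> = integral\<^sup>L (distr ?P borel ?m) f" by (rule integral_distr[OF m fm, symmetric])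
  also have "\<dots> = (LINT x|lborel. f x)" by (subst lborel_eq_distr_polar[symmetric]) simp
  finally show ?thesis ..
qed

lemma AE_radius_measure: "AE r in radius_measure d. 0 < r"
  unfolding radius_measure_def by (subst AE_density) (auto simp: indicator_def)

text \<open>The cone measure is carried by vectors of norm 1, so for r > 0 the radial factor is the
  constant \<open>g r\<close> in the inner integral.\<close>

lemma integral_polar_mult:
  fixes f :: "'a::euclidean_space \<Rightarrow> real"
  assumes "integrable lborel (\<lambda>x. g (norm x) * f x)"
    and [measurable]: "g \<in> borel_measurable borel" "f \<in> borel_measurable borel"
  shows "(LINT x|lborel. g (norm x) * f x) =
    (LINT r|radius_measure DIM('a). g r * (LINT \<theta>|sphere_measure. f (r *\<^sub>R \<theta>)))"
proof -
  have "(LINT x|lborel. g (norm x) * f x) =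
      (LINT r|radius_measure DIM('a). LINT \<theta>|sphere_measure. g (norm (r *\<^sub>R \<theta>)) * f (r *\<^sub>R \<theta>))"
    by (rule integral_polar[OF assms(1)])
  also have "\<dots> = (LINT r|radius_measure DIM('a). g r * (LINT \<theta>|sphere_measure. f (r *\<^sub>R \<theta>)))"
  proof (rule integral_cong_AE)
    show "AE r in radius_measure DIM('a).
        (LINT \<theta>|sphere_measure. g (norm (r *\<^sub>R \<theta>)) * f (r *\<^sub>R \<theta>)) =
        g r * (LINT \<theta>|sphere_measure. f (r *\<^sub>R \<theta>))"
      using AE_radius_measure
    proof eventually_elim
      fix r :: real assume "0 < r"
      have "(LINT \<theta>|sphere_measure. g (norm (r *\<^sub>R \<theta>)) * f (r *\<^sub>R \<theta>)) =
          (LINT \<theta>|sphere_measure. g r * f (r *\<^sub>R \<theta>))"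
        using AE_sphere_measure \<open>0 < r\<close>
        by (intro integral_cong_AE) (auto elim!: eventually_mono)
      then show "(LINT \<theta>|sphere_measure. g (norm (r *\<^sub>R \<theta>)) * f (r *\<^sub>R \<theta>)) =
        g r * (LINT \<theta>|sphere_measure. f (r *\<^sub>R \<theta>))" by simp
    qed
  qed measurable
  finally show ?thesis .
qed

text \<open>The fundamental lemma of the calculus of variations, for test functions of r^2. If
  \<open>h r\<close> were nonzero, \<open>h\<close> would keep its sign on some [a, b] around r; the
  bump on (a^2, b^2) makes the integrand continuous, nonnegative and positive at r, although its
  integral is 0.\<close>

lemma continuous_eq_0_if_bump_integrals_eq_0:
  fixes h :: "real \<Rightarrow> real"
  assumes h: "continuous_on UNIV h"
    and eq: "\<And>\<alpha> \<beta>. 0 < \<alpha> \<Longrightarrow> \<alpha> < \<beta> \<Longrightarrow> \<beta> < R\<^sup>2 \<Longrightarrow> integral {0..R} (\<lambda>r. box_bump \<alpha> \<beta> 1 (r\<^sup>2) * h r) = 0"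
    and r: "0 < r" "r < R"
  shows "h r = 0"
proof (rule ccontr)
  assume "h r \<noteq> 0"
  define k where "k t = sgn (h r) * h t" for t
  have k: "continuous_on UNIV k" unfolding k_def by (intro continuous_intros h)
  have "k r > 0" using \<open>h r \<noteq> 0\<close> by (simp add: k_def sgn_if)
  have "open (k -` {0<..} \<inter> {0<..<R})" using k by (intro open_Int open_vimage) auto
  then obtain e where e: "0 < e" "cball r e \<subseteq> k -` {0<..} \<inter> {0<..<R}"
    using r \<open>k r > 0\<close> open_contains_cball by (metis IntI greaterThanLessThan_iff greaterThan_iff vimage_eq)
  define a b where "a = r - e" and "b = r + e"
  have ab: "0 < a" "a < r" "r < b" "b < R"
    using e(1) subsetD[OF e(2), of "r - e"] subsetD[OF e(2), of "r + e"] by (auto simp: a_def b_def dist_real_def)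
  have kpos: "0 < k t" if "a \<le> t" "t \<le> b" for t
    using that subsetD[OF e(2), of t] by (auto simp: a_def b_def dist_real_def)
  let ?f = "\<lambda>t. box_bump (a\<^sup>2) (b\<^sup>2) 1 (t\<^sup>2) * k t"
  have cont: "continuous_on {0..R} ?f"
    by (intro continuous_intros continuous_on_subset[OF k] continuous_on_compose2[OF C1_fun_continuous[OF C1_fun_box_bump, of UNIV]]) auto
  have nonneg: "0 \<le> ?f t" if "t \<in> {0..R}" for t
  proof (cases "t\<^sup>2 \<in> box (a\<^sup>2) (b\<^sup>2)")
    case True
    then have "a \<le> t" "t \<le> b"
      using that ab power2_less_imp_less[of a t] power2_less_imp_less[of t b] by auto
    then show ?thesis using kpos[of t] box_bump_range(1)[of "a\<^sup>2" "b\<^sup>2" 1 "t\<^sup>2"] by simp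
  qed (simp add: box_bump_eq_0)
  have "integral {0..R} ?f = sgn (h r) * integral {0..R} (\<lambda>t. box_bump (a\<^sup>2) (b\<^sup>2) 1 (t\<^sup>2) * h t)"
    by (subst integral_mult_right[symmetric]) (simp add: k_def ac_simps)
  also have "\<dots> = 0" using ab by (subst eq) (auto intro!: power_strict_mono)
  finally have "(?f has_integral 0) (cbox 0 R)"
    using integrable_integral[OF integrable_continuous_real[OF cont]] by simp
  then have "?f r = 0"
    using cont nonneg ab r by (intro has_integral_0_cbox_imp_0[of 0 R ?f]) auto
  moreover have "box_bump (a\<^sup>2) (b\<^sup>2) 1 (r\<^sup>2) > 0"
    using ab by (auto simp: box_bump_def intro!: mult_pos_pos power_strict_mono)
  ultimately show False using \<open>k r > 0\<close> by simp
qed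

lemma integral_radius_measure_Icc:
  fixes k :: "real \<Rightarrow> real"
  assumes k: "continuous_on UNIV k" "\<And>r. R < r \<Longrightarrow> k r = 0"
  shows "(LINT r|radius_measure d. k r) = integral {0..R} (\<lambda>r. k r * r ^ (d - 1))"
proof -
  have [measurable]: "k \<in> borel_measurable borel" using k(1) by (rule borel_measurable_continuous_onI)
  have "(LINT r|radius_measure d. k r) = (LINT t|lborel. indicator {0<..} t * (k t * t ^ (d - 1)))"
    by (rule integral_radius_measure_lborel) simp
  also have "\<dots> = (LINT t|lborel. indicator {0..R} t *\<^sub>R (k t * t ^ (d - 1)))"
    using AE_lborel_singleton[of "0::real"] k(2)
    by (intro integral_cong_AE) (auto elim!: eventually_mono simp: indicator_def)
  also have "\<dots> = integral {0..R} (\<lambda>r. k r * r ^ (d - 1))"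
    unfolding set_lebesgue_integral_def[symmetric]
    by (intro set_borel_integral_eq_integral borel_integrable_atLeastAtMost' continuous_intros
        continuous_on_subset[OF k(1)]) auto
  finally show ?thesis .
qed

section \<open>Flux through spheres and its derivative\<close>

definition sphere_flux :: "'a::euclidean_space \<Rightarrow> ('a \<Rightarrow> real) \<Rightarrow> real \<Rightarrow> real" where
  "sphere_flux i \<phi> r = (LINT \<theta>|sphere_measure. \<phi> (r *\<^sub>R \<theta>) * (\<theta> \<bullet> i))"

definition sphere_flux_deriv :: "'a::euclidean_space \<Rightarrow> ('a \<Rightarrow> real) \<Rightarrow> real \<Rightarrow> real" where
  "sphere_flux_deriv i \<phi> r = (LINT \<theta>|sphere_measure. partial_deriv \<theta> \<phi> (r *\<^sub>R \<theta>) * (\<theta> \<bullet> i))"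

lemma continuous_on_polar:
  assumes "continuous_on UNIV (f :: 'a::euclidean_space \<Rightarrow> real)"
  shows "continuous_on UNIV (\<lambda>(r, \<theta>). f (r *\<^sub>R \<theta>))"
  unfolding case_prod_unfold
  by (rule continuous_on_compose2[OF assms]) (auto intro!: continuous_intros)

lemma
  fixes \<phi> :: "'a::euclidean_space \<Rightarrow> real"
  assumes \<phi>: "C1_fun \<phi>"
  shows DERIV_sphere_flux: "(sphere_flux i \<phi> has_real_derivative sphere_flux_deriv i \<phi> r) (at r)"
    and continuous_on_DERIV_sphere_flux: "continuous_on UNIV (sphere_flux_deriv i \<phi>)"
proof -
  have *: "continuous_on UNIV (\<lambda>p. partial_deriv v \<phi> (fst p *\<^sub>R snd p))" for v
    using continuous_on_polar[OF C1_fun_partial_deriv(2)[OF \<phi>]] by (simp add: case_prod_unfold)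
  have c': "continuous_on UNIV (\<lambda>(r, \<theta>). partial_deriv \<theta> \<phi> (r *\<^sub>R \<theta>) * (\<theta> \<bullet> i))"
    by (subst partial_deriv_sum_Basis[OF \<phi>]) (auto simp: case_prod_unfold intro!: continuous_intros *)
  have c: "continuous_on UNIV (\<lambda>(r, \<theta>). \<phi> (r *\<^sub>R \<theta>) * (\<theta> \<bullet> i))"
    using continuous_on_polar[OF C1_fun_continuous[OF \<phi>]]
    by (auto simp: case_prod_unfold intro!: continuous_intros)
  show "continuous_on UNIV (sphere_flux_deriv i \<phi>)" unfolding sphere_flux_deriv_def[abs_def] by (rule continuous_on_sphere_integral[OF c'])
  have "((\<lambda>r. \<phi> (r *\<^sub>R \<theta>) * (\<theta> \<bullet> i)) has_real_derivative partial_deriv \<theta> \<phi> (r *\<^sub>R \<theta>) * (\<theta> \<bullet> i)) (at r)" for r \<theta>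
    using C1_fun_directional_derivative[OF \<phi>, of 0 \<theta> r] by (auto intro!: DERIV_cmult_right)
  then show "(sphere_flux i \<phi> has_real_derivative sphere_flux_deriv i \<phi> r) (at r)"
    unfolding sphere_flux_deriv_def sphere_flux_def[abs_def] by (rule has_real_derivative_sphere_integral[OF c c'])
qed

lemma sphere_flux_eq_0:
  fixes \<phi> :: "'a::euclidean_space \<Rightarrow> real"
  assumes "\<And>x. R \<le> norm x \<Longrightarrow> \<phi> x = 0" "R \<le> \<bar>r\<bar>" and [measurable]: "\<phi> \<in> borel_measurable borel"
  shows "sphere_flux i \<phi> r = 0"
proof -
  have "sphere_flux i \<phi> r = (LINT \<theta>|(sphere_measure :: 'a measure). 0)"
    unfolding sphere_flux_def using assms(1,2) AE_sphere_measure
    by (intro integral_cong_AE) (auto elim!: eventually_mono)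
  then show ?thesis by simp
qed

text \<open>Differentiating the flux under the integral yields the radial derivative of \<phi>; that
  this amounts to averaging the i-th partial derivative is the differential form of the divergence
  theorem. It is proved weakly, and since both sides are continuous in r the weak identity is a
  pointwise one.\<close>

lemma DERIV_weighted_sphere_flux:
  fixes \<phi> :: "'a::euclidean_space \<Rightarrow> real"
  assumes \<phi>: "\<phi> \<in> C1_compact_support" and r: "0 < r"
  shows "((\<lambda>s. sphere_flux i \<phi> s * s ^ (DIM('a) - 1)) has_real_derivative
    (LINT \<theta>|sphere_measure. partial_deriv i \<phi> (r *\<^sub>R \<theta>)) * r ^ (DIM('a) - 1)) (at r)"
proof -
  let ?d = "DIM('a)"
  note C1 = C1_fun_C1_compact_support[OF \<phi>]
  note c\<phi> = C1_fun_continuous[OF C1] and cd = C1_fun_partial_deriv(2)[OF C1]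
  define \<Phi> where "\<Phi> = sphere_flux i \<phi>"
  define D where "D = sphere_flux_deriv i \<phi>"
  define b where "b r = (LINT \<theta>|sphere_measure. partial_deriv i \<phi> (r *\<^sub>R \<theta>))" for r
  define A where "A r = D r * r ^ (?d - 1) + \<Phi> r * (real (?d - 1) * r ^ (?d - 1 - 1))" for r
  have \<Phi>': "(\<Phi> has_real_derivative D r) (at r)" for r
    unfolding \<Phi>_def D_def by (rule DERIV_sphere_flux[OF C1])
  then have c\<Phi>: "continuous_on S \<Phi>" for S
    by (meson DERIV_isCont continuous_at_imp_continuous_on)
  have cD: "continuous_on UNIV D" unfolding D_def by (rule continuous_on_DERIV_sphere_flux[OF C1])
  have cb: "continuous_on UNIV b"
    unfolding b_def by (intro continuous_on_sphere_integral continuous_on_polar cd)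
  have A: "((\<lambda>s. \<Phi> s * s ^ (?d - 1)) has_real_derivative A s) (at s)" for s
    unfolding A_def using \<Phi>' by (auto intro!: derivative_eq_intros)
  obtain R\<^sub>0 where R0: "0 < R\<^sub>0" "\<And>x. R\<^sub>0 \<le> norm x \<Longrightarrow> \<phi> x = 0"
    "\<And>x v. R\<^sub>0 \<le> norm x \<Longrightarrow> partial_deriv v \<phi> x = 0"
    using C1_compact_support_bounded[OF \<phi>] by blast
  \<comment> \<open>Beyond \<open>R\<close> everything vanishes, and the given r lies strictly
    inside (0, R), where the weak identity can be localized.\<close>
  define R where "R = max R\<^sub>0 r + 1"
  have R: "r < R" "0 < R" "\<And>x. R \<le> norm x \<Longrightarrow> \<phi> x = 0"
    "\<And>x v. R \<le> norm x \<Longrightarrow> partial_deriv v \<phi> x = 0"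
    using R0 r by (auto simp: R_def)
  have "A r - b r * r ^ (?d - 1) = 0"
  proof (rule continuous_eq_0_if_bump_integrals_eq_0[of "\<lambda>r. A r - b r * r ^ (?d - 1)" R])
    show "continuous_on UNIV (\<lambda>r. A r - b r * r ^ (?d - 1))"
      unfolding A_def by (intro continuous_intros cD cb c\<Phi>)
    fix \<alpha> \<beta> :: real assume \<alpha>\<beta>: "0 < \<alpha>" "\<alpha> < \<beta>" "\<beta> < R\<^sup>2"
    \<comment> \<open>Testing with \<open>e(|x|\<^sup>2)\<close> rather than with a function of \<open>|x|\<close> avoids the singularity at the origin.
        The two integrations by parts, in the whole space and on \<open>[0, R]\<close>, are then compared.\<close>
    define e where "e = box_bump \<alpha> \<beta> 1"
    define e' where "e' = partial_deriv 1 e"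
    have e: "C1_fun e" unfolding e_def by (rule C1_fun_box_bump)
    have e': "(e has_real_derivative e' t) (at t)" for t
      using C1_fun_directional_derivative[OF e, of 0 1 t] by (simp add: e'_def)
    have ce': "continuous_on UNIV e'" unfolding e'_def by (rule C1_fun_partial_deriv(2)[OF e])
    \<comment> \<open>Neither 0 nor R^2 lies in (\<alpha>, \<beta>), so the integration by parts on
      [0, R] has no boundary terms.\<close>
    have e0: "e 0 = 0" "e (R\<^sup>2) = 0" using \<alpha>\<beta> by (auto simp: e_def box_bump_eq_0)
    have sq: "C1_fun (\<lambda>x::'a. x \<bullet> x)"
      by (intro C1_funI[where f' = "\<lambda>x v. 2 * (x \<bullet> v)"])
        (auto intro!: derivative_eq_intros continuous_intros simp: inner_commute)
    have ceq: "continuous_on UNIV (\<lambda>x::'a. e (x \<bullet> x))" "continuous_on UNIV (\<lambda>x::'a. e' (x \<bullet> x))"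
      by (auto intro!: continuous_intros continuous_on_compose2[OF C1_fun_continuous[OF e, of UNIV]]
          continuous_on_compose2[OF ce'])
    define T\<^sub>1 where "T\<^sub>1 x = 2 * e' (x \<bullet> x) * ((x \<bullet> i) * \<phi> x)" for x
    define T\<^sub>2 where "T\<^sub>2 x = e (x \<bullet> x) * partial_deriv i \<phi> x" for x
    have cT: "continuous_on UNIV T\<^sub>1" "continuous_on UNIV T\<^sub>2"
      unfolding T\<^sub>1_def T\<^sub>2_def by (intro continuous_intros ceq c\<phi> cd)+
    have iT: "integrable lborel T\<^sub>1" "integrable lborel T\<^sub>2"
      using R by (auto intro!: integrable_continuous_bounded_support[of _ R] cT simp: T\<^sub>1_def T\<^sub>2_def)
    have "(LINT x|lborel. T\<^sub>1 x + T\<^sub>2 x) = 0"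
    proof (rule integral_directional_derivative_eq_0[where f = "\<lambda>x. e (x \<bullet> x) * \<phi> x" and v = i])
      fix x
      have "((\<lambda>t. (x + t *\<^sub>R i) \<bullet> (x + t *\<^sub>R i)) has_real_derivative 2 * (x \<bullet> i)) (at 0)"
        by (auto intro!: derivative_eq_intros simp: inner_simps inner_commute power2_eq_square)
      from DERIV_chain2[where f = e, OF e' this]
      have "((\<lambda>t. e ((x + t *\<^sub>R i) \<bullet> (x + t *\<^sub>R i))) has_real_derivative e' (x \<bullet> x) * (2 * (x \<bullet> i))) (at 0)"
        by simp
      from DERIV_mult[OF this C1_fun_directional_derivative[OF C1, of x i 0]]
      show "((\<lambda>t. e ((x + t *\<^sub>R i) \<bullet> (x + t *\<^sub>R i)) * \<phi> (x + t *\<^sub>R i)) has_real_derivative T\<^sub>1 x + T\<^sub>2 x) (at 0)"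
        by (simp add: T\<^sub>1_def T\<^sub>2_def ac_simps)
    next
      show "continuous_on UNIV (\<lambda>x. T\<^sub>1 x + T\<^sub>2 x)" by (intro continuous_intros cT)
      show "integrable lborel (\<lambda>x. e (x \<bullet> x) * \<phi> x)"
        using R by (intro integrable_continuous_bounded_support[of _ R] continuous_intros ceq c\<phi>) auto
      show "integrable lborel (\<lambda>x. T\<^sub>1 x + T\<^sub>2 x)" using iT by simp
    qed
    then have sum0: "(LINT x|lborel. T\<^sub>1 x) + (LINT x|lborel. T\<^sub>2 x) = 0" using iT by simp
    have ce2: "continuous_on UNIV (\<lambda>r. e (r\<^sup>2))" "continuous_on UNIV (\<lambda>r. e' (r\<^sup>2))"
      by (auto intro!: continuous_intros continuous_on_compose2[OF C1_fun_continuous[OF e, of UNIV]]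
          continuous_on_compose2[OF ce'])
    have \<Phi>R: "\<Phi> s = 0" if "R < s" for s
      unfolding \<Phi>_def using that R
      by (intro sphere_flux_eq_0[of R] borel_measurable_continuous_onI c\<phi>) auto
    have bR: "b s = 0" if "R < s" for s
    proof -
      have "b s = (LINT \<theta>|(sphere_measure :: 'a measure). 0)"
        unfolding b_def using that R AE_sphere_measure
        using borel_measurable_continuous_onI[OF cd[of UNIV i]]
        by (intro integral_cong_AE) (auto elim!: eventually_mono)
      then show ?thesis by simp
    qed
    have "(LINT x|lborel. T\<^sub>1 x) = (LINT x|lborel. (\<lambda>r. 2 * e' (r\<^sup>2)) (norm x) * ((x \<bullet> i) * \<phi> x))"
      by (simp add: T\<^sub>1_def dot_square_norm)
    also have "\<dots> = (LINT r|radius_measure ?d. 2 * e' (r\<^sup>2) *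
        (LINT \<theta>|sphere_measure. ((r *\<^sub>R \<theta>) \<bullet> i) * \<phi> (r *\<^sub>R \<theta>)))"
      using iT(1)
      by (intro integral_polar_mult borel_measurable_continuous_onI continuous_intros ce2 c\<phi>)
        (simp_all add: T\<^sub>1_def[abs_def] dot_square_norm)
    \<comment> \<open>The radius comes out of the inner product with \<open>i\<close>, which leaves
      exactly the flux as inner integral.\<close>
    also have "\<dots> = (LINT r|radius_measure ?d. 2 * e' (r\<^sup>2) * (r * \<Phi> r))"
      unfolding \<Phi>_def sphere_flux_def by (simp add: ac_simps flip: integral_mult_right_zero)
    also have "\<dots> = integral {0..R} (\<lambda>r. 2 * e' (r\<^sup>2) * (r * \<Phi> r) * r ^ (?d - 1))"
      by (intro integral_radius_measure_Icc continuous_intros ce2 c\<Phi>) (simp add: \<Phi>R)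
    finally have T1: "(LINT x|lborel. T\<^sub>1 x) = \<dots>" .
    have "(LINT x|lborel. T\<^sub>2 x) = (LINT x|lborel. (\<lambda>r. e (r\<^sup>2)) (norm x) * partial_deriv i \<phi> x)"
      by (simp add: T\<^sub>2_def dot_square_norm)
    also have "\<dots> = (LINT r|radius_measure ?d. e (r\<^sup>2) * b r)"
      unfolding b_def using iT(2)
      by (intro integral_polar_mult borel_measurable_continuous_onI continuous_intros ce2 cd)
        (simp_all add: T\<^sub>2_def[abs_def] dot_square_norm)
    also have "\<dots> = integral {0..R} (\<lambda>r. e (r\<^sup>2) * b r * r ^ (?d - 1))"
      by (intro integral_radius_measure_Icc continuous_intros ce2 cb) (simp add: bR)
    finally have T2: "(LINT x|lborel. T\<^sub>2 x) = \<dots>" .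
    have "((\<lambda>r. 2 * e' (r\<^sup>2) * (r * \<Phi> r) * r ^ (?d - 1) + e (r\<^sup>2) * A r) has_integral
        e (R\<^sup>2) * (\<Phi> R * R ^ (?d - 1)) - e (0\<^sup>2) * (\<Phi> 0 * 0 ^ (?d - 1))) {0..R}"
    proof (rule fundamental_theorem_of_calculus)
      fix s
      have "((\<lambda>r. r\<^sup>2) has_real_derivative 2 * s) (at s)"
        by (auto intro!: derivative_eq_intros)
      from DERIV_mult[OF DERIV_chain2[where f = e, OF e' this] A]
      have "((\<lambda>r. e (r\<^sup>2) * (\<Phi> r * r ^ (?d - 1))) has_real_derivative
          2 * e' (s\<^sup>2) * (s * \<Phi> s) * s ^ (?d - 1) + e (s\<^sup>2) * A s) (at s)"
        by (simp add: ac_simps)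
      from has_field_derivative_at_within[OF this]
      show "((\<lambda>r. e (r\<^sup>2) * (\<Phi> r * r ^ (?d - 1))) has_vector_derivative
          2 * e' (s\<^sup>2) * (s * \<Phi> s) * s ^ (?d - 1) + e (s\<^sup>2) * A s) (at s within {0..R})"
        by (simp add: has_real_derivative_iff_has_vector_derivative)
    qed (use R in simp)
    then have "integral {0..R} (\<lambda>r. 2 * e' (r\<^sup>2) * (r * \<Phi> r) * r ^ (?d - 1) + e (r\<^sup>2) * A r) = 0"
      using e0 by (auto dest: integral_unique)
    moreover have i: "(\<lambda>r. 2 * e' (r\<^sup>2) * (r * \<Phi> r) * r ^ (?d - 1)) integrable_on {0..R}"
      "(\<lambda>r. e (r\<^sup>2) * A r) integrable_on {0..R}" "(\<lambda>r. e (r\<^sup>2) * b r * r ^ (?d - 1)) integrable_on {0..R}"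
      unfolding A_def
      by (intro integrable_continuous_real continuous_intros c\<Phi> continuous_on_subset[OF ce2(1)]
          continuous_on_subset[OF ce2(2)] continuous_on_subset[OF cD] continuous_on_subset[OF cb] subset_UNIV)+
    \<comment> \<open>Both integrations by parts contain the same term with \<open>e'\<close>;
      subtracting them removes it.\<close>
    ultimately have "integral {0..R} (\<lambda>r. e (r\<^sup>2) * A r) - integral {0..R} (\<lambda>r. e (r\<^sup>2) * b r * r ^ (?d - 1)) = 0"
      using sum0 T1 T2 by (simp add: Henstock_Kurzweil_Integration.integral_add)
    then have "integral {0..R} (\<lambda>r. e (r\<^sup>2) * A r - e (r\<^sup>2) * b r * r ^ (?d - 1)) = 0"
      using i by (simp add: Henstock_Kurzweil_Integration.integral_diff)
    then show "integral {0..R} (\<lambda>r. box_bump \<alpha> \<beta> 1 (r\<^sup>2) * (A r - b r * r ^ (?d - 1))) = 0"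
      by (simp add: e_def right_diff_distrib mult.assoc)
  qed (use r R in auto)
  with A[of r] show ?thesis by (simp add: \<Phi>_def b_def)
qed

text \<open>The flux is differentiable with continuous derivative on the whole line, negative radii
  included, and is 0 at 0. Hence both limits demanded at 0 exist and equal its derivative
  there.\<close>

lemma sphere_flux_C1_compact_support_halfline:
  fixes \<phi> :: "'a::euclidean_space \<Rightarrow> real"
  assumes \<phi>: "\<phi> \<in> C1_compact_support"
  shows "sphere_flux i \<phi> \<in> C1_compact_support_halfline"
proof -
  note C1 = C1_fun_C1_compact_support[OF \<phi>]
  define D where "D = sphere_flux_deriv i \<phi>"
  have D: "(sphere_flux i \<phi> has_real_derivative D r) (at r)" for r
    unfolding D_def by (rule DERIV_sphere_flux[OF C1])
  have cD: "continuous_on UNIV D" unfolding D_def by (rule continuous_on_DERIV_sphere_flux[OF C1])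
  have deriv: "deriv (sphere_flux i \<phi>) = D" using D DERIV_imp_deriv by blast
  obtain R where R: "0 < R" "\<And>x. R \<le> norm x \<Longrightarrow> \<phi> x = 0"
    "\<And>x v. R \<le> norm x \<Longrightarrow> partial_deriv v \<phi> x = 0"
    using C1_compact_support_bounded[OF \<phi>] by blast
  have "sphere_flux i \<phi> 0 = 0"
    using integral_sphere_inner_eq_0[of i] by (simp add: sphere_flux_def)
  moreover have "((\<lambda>t. sphere_flux i \<phi> t / t) \<longlongrightarrow> D 0) (at_right 0)"
  proof -
    have "((\<lambda>t. sphere_flux i \<phi> t / t) \<longlongrightarrow> D 0) (at 0)"
      using D[of 0] \<open>sphere_flux i \<phi> 0 = 0\<close> by (simp add: DERIV_def)
    then show ?thesis by (rule tendsto_within_subset) simp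
  qed
  moreover have "(D \<longlongrightarrow> D 0) (at_right 0)"
  proof -
    have "(D \<longlongrightarrow> D 0) (at 0)" using cD by (simp add: continuous_on_def)
    then show ?thesis by (rule tendsto_within_subset) simp
  qed
  moreover have "compact (closure {t. 0 \<le> t \<and> sphere_flux i \<phi> t \<noteq> 0})"
  proof -
    have "{t. 0 \<le> t \<and> sphere_flux i \<phi> t \<noteq> 0} \<subseteq> {0..R}"
      using sphere_flux_eq_0[of R \<phi> _ i, OF R(2) _ borel_measurable_continuous_onI[OF C1_fun_continuous[OF C1]]]
      by force
    then show ?thesis by (meson bounded_closed_interval bounded_subset compact_closure)
  qed
  moreover have "continuous_on {0..} (sphere_flux i \<phi>)"
    using D by (meson DERIV_isCont continuous_at_imp_continuous_on)
  moreover have "continuous_on {0<..} D" by (rule continuous_on_subset[OF cD]) simp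
  moreover have "sphere_flux i \<phi> differentiable (at t)" for t
    using D[of t] real_differentiable_def by blast
  ultimately show ?thesis
    unfolding C1_compact_support_halfline_def by (auto simp: deriv)
qed

subsection \<open>Radial vector fields\<close>

lemma filterlim_norm_at_right_0: "filterlim norm (at_right 0) (at (0 :: 'a::real_normed_vector))"
  unfolding filterlim_at by (auto simp: eventually_at_filter intro!: tendsto_norm_zero)

text \<open>Component \<open>i\<close> of the radial vector field with profile \<phi>;
  \<open>sgn 0 = 0\<close> supplies the value 0 at the origin.\<close>

definition radial_field :: "(real \<Rightarrow> real) \<Rightarrow> 'a::euclidean_space \<Rightarrow> 'a \<Rightarrow> real" where
  "radial_field \<phi> i x = \<phi> (norm x) * (sgn x \<bullet> i)"

lemma C1_compact_support_halflineD:
  assumes "\<phi> \<in> C1_compact_support_halfline"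
  shows "0 < t \<Longrightarrow> (\<phi> has_real_derivative deriv \<phi> t) (at t)"
    and "continuous_on {0..} \<phi>" "continuous_on {0<..} (deriv \<phi>)" "\<phi> 0 = 0"
    and "\<exists>L. ((\<lambda>t. \<phi> t / t) \<longlongrightarrow> L) (at_right 0) \<and> (deriv \<phi> \<longlongrightarrow> L) (at_right 0)"
  using assms by (simp_all add: C1_compact_support_halfline_def DERIV_deriv_iff_real_differentiable)

lemma C1_compact_support_halfline_bounded:
  assumes "\<phi> \<in> C1_compact_support_halfline"
  obtains R where "0 < R" "\<forall>t\<ge>R. \<phi> t = 0"
proof -
  have "bounded (closure {t. 0 \<le> t \<and> \<phi> t \<noteq> 0})"
    using assms by (auto simp: C1_compact_support_halfline_def compact_imp_bounded)
  then have "bounded {t. 0 \<le> t \<and> \<phi> t \<noteq> 0}"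
    using closure_subset by (rule bounded_subset)
  then obtain B where B: "\<And>t. 0 \<le> t \<Longrightarrow> \<phi> t \<noteq> 0 \<Longrightarrow> norm t \<le> B"
    by (auto simp: bounded_iff)
  define R where "R = max B 0 + 1"
  have "\<phi> t = 0" if "R \<le> t" for t
    using B[of t] that by (force simp: R_def)
  then show ?thesis using that[of R] by (simp add: R_def)
qed

text \<open>Component \<open>i\<close> of the Jacobian of the field applied to \<open>v\<close>: the
  derivative of \<phi> multiplies the radial projection of \<open>v\<close>, and the quotient
  \<phi>(r)/r its tangential part.\<close>

definition radial_field_deriv :: "(real \<Rightarrow> real) \<Rightarrow> 'a::euclidean_space \<Rightarrow> 'a \<Rightarrow> 'a \<Rightarrow> real" where
  "radial_field_deriv \<phi> i x v = deriv \<phi> (norm x) * ((sgn x \<bullet> v) * (sgn x \<bullet> i)) +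
     \<phi> (norm x) / norm x * (v \<bullet> i - (sgn x \<bullet> v) * (sgn x \<bullet> i))"

lemma abs_sgn_inner_le: "\<bar>sgn x \<bullet> v\<bar> \<le> norm v"
  using Cauchy_Schwarz_ineq2[of "sgn x" v] mult_left_le_one_le[of "norm v" "norm (sgn x)"]
  by (auto simp: norm_sgn split: if_splits)

lemma has_derivative_radial_field:
  assumes "(\<phi> has_real_derivative deriv \<phi> (norm x)) (at (norm x))" and "x \<noteq> 0"
  shows "(radial_field \<phi> i has_derivative radial_field_deriv \<phi> i x) (at x)"
proof -
  have eq: "radial_field \<phi> i = (\<lambda>x. \<phi> (norm x) * ((x \<bullet> i) / norm x))"
    by (auto simp: radial_field_def sgn_div_norm divide_inverse)
  have 1: "((\<lambda>x. \<phi> (norm x)) has_derivative (\<lambda>v. deriv \<phi> (norm x) * (v \<bullet> sgn x))) (at x)"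
    using has_derivative_compose[OF has_derivative_norm[OF \<open>x \<noteq> 0\<close>] assms(1)[unfolded has_field_derivative_def]]
    by (simp add: mult.commute)
  have 2: "((\<lambda>x. (x \<bullet> i) / norm x) has_derivative
      (\<lambda>v. ((v \<bullet> i) * norm x - (x \<bullet> i) * (v \<bullet> sgn x)) / (norm x * norm x))) (at x)"
    using \<open>x \<noteq> 0\<close>
    by (intro has_derivative_divide' has_derivative_norm) (auto intro!: derivative_eq_intros)
  show ?thesis
    unfolding eq
  proof (rule has_derivative_eq_rhs[OF has_derivative_mult[OF 1 2]], rule ext)
    fix v
    show "\<phi> (norm x) * (((v \<bullet> i) * norm x - (x \<bullet> i) * (v \<bullet> sgn x)) / (norm x * norm x)) +
        deriv \<phi> (norm x) * (v \<bullet> sgn x) * ((x \<bullet> i) / norm x) = radial_field_deriv \<phi> i x v"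
      using \<open>x \<noteq> 0\<close>
      by (simp add: radial_field_deriv_def sgn_div_norm inner_commute field_simps)
  qed
qed

text \<open>Only the origin is critical. There the radial coefficient and the tangential coefficient
  of the Jacobian have the same limit \<open>L\<close>, so the Jacobian tends to \<open>L\<close>
  times the identity. This is the purpose of the condition at 0 in
  \<open>C1_compact_support_halfline\<close>.\<close>

lemma
  assumes \<phi>: "\<phi> \<in> C1_compact_support_halfline"
  shows radial_field_C1_compact_support: "(radial_field \<phi> i :: 'a::euclidean_space \<Rightarrow> real) \<in> C1_compact_support"
    and partial_deriv_radial_field: "x \<noteq> 0 \<Longrightarrow> partial_deriv v (radial_field \<phi> i) (x :: 'a) = radial_field_deriv \<phi> i x v"
proof -
  note d = C1_compact_support_halflineD(1)[OF \<phi>] and c = C1_compact_support_halflineD(2,3)[OF \<phi>]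
  obtain L where L: "((\<lambda>t. \<phi> t / t) \<longlongrightarrow> L) (at_right 0)" "(deriv \<phi> \<longlongrightarrow> L) (at_right 0)"
    using C1_compact_support_halflineD(5)[OF \<phi>] by auto
  obtain R where R: "0 < R" "\<forall>t\<ge>R. \<phi> t = 0"
    using C1_compact_support_halfline_bounded[OF \<phi>] by metis
  have lim: "((\<lambda>x::'a. \<bar>\<phi> (norm x) / norm x - L\<bar>) \<longlongrightarrow> 0) (at 0)"
    "((\<lambda>x::'a. \<bar>deriv \<phi> (norm x) - L\<bar>) \<longlongrightarrow> 0) (at 0)"
    using filterlim_compose[OF L(1) filterlim_norm_at_right_0[where 'a='a]]
      filterlim_compose[OF L(2) filterlim_norm_at_right_0[where 'a='a]]
    by (auto intro: tendsto_rabs_zero simp: LIM_zero_iff)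
  have 1: "(radial_field \<phi> i has_derivative radial_field_deriv \<phi> i x) (at x)" if "x \<noteq> 0" for x :: 'a
    using that d[of "norm x"] by (intro has_derivative_radial_field) auto
  then show "x \<noteq> 0 \<Longrightarrow> partial_deriv v (radial_field \<phi> i) (x :: 'a) = radial_field_deriv \<phi> i x v"
    using partial_deriv_eqI by blast
  define D where "D x v = (if x = 0 then L * (v \<bullet> i) else radial_field_deriv \<phi> i x v)" for x v :: 'a
  have "C1_fun (radial_field \<phi> i :: 'a \<Rightarrow> real)"
  proof (rule C1_funI[where f' = D])
    fix x v :: 'a
    show "(radial_field \<phi> i has_derivative D x) (at x)"
    proof (cases "x = 0")
      case True
      have "(radial_field \<phi> i has_derivative (\<lambda>v. L * (v \<bullet> i))) (at 0)"
        unfolding has_derivative_at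
      proof
        show "bounded_linear (\<lambda>v. L * (v \<bullet> i))"
          by (intro bounded_linear_mult_right[THEN bounded_linear_compose] bounded_linear_inner_left)
        show "(\<lambda>h. norm (radial_field \<phi> i (0 + h) - radial_field \<phi> i 0 - L * (h \<bullet> i)) / norm h) \<midarrow>0\<rightarrow> 0"
        proof (rule tendsto_sandwich[where f = "\<lambda>_. 0"])
          show "((\<lambda>h::'a. \<bar>\<phi> (norm h) / norm h - L\<bar> * norm i) \<longlongrightarrow> 0) (at 0)"
            using lim(1) by (rule tendsto_mult_left_zero)
          have "norm (radial_field \<phi> i (0 + h) - radial_field \<phi> i 0 - L * (h \<bullet> i)) / norm h \<le>
              \<bar>\<phi> (norm h) / norm h - L\<bar> * norm i" if "h \<noteq> 0" for h :: 'a
          proof -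
            have "(radial_field \<phi> i (0 + h) - radial_field \<phi> i 0 - L * (h \<bullet> i)) / norm h =
                (\<phi> (norm h) / norm h - L) * (sgn h \<bullet> i)"
              using that by (simp add: radial_field_def sgn_div_norm field_simps)
            then have "norm (radial_field \<phi> i (0 + h) - radial_field \<phi> i 0 - L * (h \<bullet> i)) / norm h =
                \<bar>\<phi> (norm h) / norm h - L\<bar> * \<bar>sgn h \<bullet> i\<bar>"
              by (metis abs_mult abs_norm_cancel abs_divide real_norm_def)
            also have "\<dots> \<le> \<bar>\<phi> (norm h) / norm h - L\<bar> * norm i"
              by (intro mult_left_mono abs_sgn_inner_le) simp
            finally show ?thesis .
          qed
          then show "\<forall>\<^sub>F h in at 0. norm (radial_field \<phi> i (0 + h) - radial_field \<phi> i 0 - L * (h \<bullet> i)) / norm h \<le>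
              \<bar>\<phi> (norm h) / norm h - L\<bar> * norm i"
            by (auto simp: eventually_at_filter)
        qed auto
      qed
      then show ?thesis by (simp add: True D_def[abs_def])
    next
      case False
      then show ?thesis using 1[of x] by (simp add: D_def[abs_def])
    qed
    have "isCont (\<lambda>x. D x v) x" for x
    proof (cases "x = 0")
      case True
      have "((\<lambda>y. D y v - L * (v \<bullet> i)) \<longlongrightarrow> 0) (at 0)"
      proof (rule tendsto_rabs_zero_cancel, rule tendsto_sandwich[where f = "\<lambda>_. 0"])
        let ?b = "\<lambda>y. \<bar>deriv \<phi> (norm y) - L\<bar> * (norm v * norm i) +
          \<bar>\<phi> (norm y) / norm y - L\<bar> * (norm v * norm i + norm v * norm i)"
        show "((\<lambda>y::'a. ?b y) \<longlongrightarrow> 0) (at 0)"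
          using tendsto_add[OF tendsto_mult_left_zero[OF lim(2)] tendsto_mult_left_zero[OF lim(1)]] by simp
        have "\<bar>D y v - L * (v \<bullet> i)\<bar> \<le> ?b y" if "y \<noteq> 0" for y
        proof -
          have s: "\<bar>(sgn y \<bullet> v) * (sgn y \<bullet> i)\<bar> \<le> norm v * norm i"
            unfolding abs_mult by (intro mult_mono abs_sgn_inner_le) auto
          have t: "\<bar>v \<bullet> i - (sgn y \<bullet> v) * (sgn y \<bullet> i)\<bar> \<le> norm v * norm i + norm v * norm i"
            using s Cauchy_Schwarz_ineq2[of v i] by linarith
          \<comment> \<open>\<open>L * (v \<bullet> i)\<close> is split into radial and tangential
            part as well, so that each coefficient is compared with \<open>L\<close>
            separately.\<close>
          have "D y v - L * (v \<bullet> i) = (deriv \<phi> (norm y) - L) * ((sgn y \<bullet> v) * (sgn y \<bullet> i)) +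
              (\<phi> (norm y) / norm y - L) * (v \<bullet> i - (sgn y \<bullet> v) * (sgn y \<bullet> i))"
            using that by (simp add: D_def radial_field_deriv_def algebra_simps)
          also have "\<bar>\<dots>\<bar> \<le> ?b y"
            by (intro order_trans[OF abs_triangle_ineq] add_mono; simp only: abs_mult;
                intro mult_left_mono abs_ge_zero s[unfolded abs_mult] t)
          finally show ?thesis .
        qed
        then show "\<forall>\<^sub>F y in at 0. \<bar>D y v - L * (v \<bullet> i)\<bar> \<le> ?b y"
          by (auto simp: eventually_at_filter)
      qed auto
      then have "((\<lambda>y. D y v) \<longlongrightarrow> L * (v \<bullet> i)) (at 0)" by (simp add: LIM_zero_iff)
      then show ?thesis using True by (simp add: isCont_def D_def)
    next
      case False
      have "continuous_on (- {0}) (\<lambda>x. radial_field_deriv \<phi> i x v)"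
        unfolding radial_field_deriv_def
        by (intro continuous_intros continuous_on_sgn continuous_on_compose2[OF c(1)] continuous_on_compose2[OF c(2)]) auto
      then have "continuous_on (- {0}) (\<lambda>x. D x v)"
        by (rule continuous_on_eq) (simp add: D_def)
      then show ?thesis
        using False continuous_on_eq_continuous_at[of "- {0}" "\<lambda>x. D x v"] by auto
    qed
    then show "continuous_on UNIV (\<lambda>x. D x v)" by (simp add: continuous_at_imp_continuous_on)
  qed
  then show "(radial_field \<phi> i :: 'a \<Rightarrow> real) \<in> C1_compact_support"
  proof (rule C1_compact_supportI[OF _ compact_cball])
    show "x \<in> cball 0 R" if "radial_field \<phi> i x \<noteq> 0" for x :: 'a
    proof (rule ccontr)
      assume "x \<notin> cball 0 R"
      then have "\<phi> (norm x) = 0" using R(2) by simp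
      then show False using that by (simp add: radial_field_def)
    qed
  qed
qed

text \<open>The divergence is the trace of the Jacobian: the radial projection has trace 1 and the
  tangential one d - 1.\<close>

lemma sum_radial_field_deriv:
  fixes x :: "'a::euclidean_space"
  assumes "x \<noteq> 0"
  shows "(\<Sum>i\<in>Basis. radial_field_deriv \<phi> i x i) = deriv \<phi> (norm x) + real (DIM('a) - 1) * (\<phi> (norm x) / norm x)"
proof -
  have "(\<Sum>i\<in>Basis. (sgn x \<bullet> i) * (sgn x \<bullet> i)) = sgn x \<bullet> sgn x"
    by (rule euclidean_inner[symmetric])
  also have "\<dots> = 1" using assms by (simp add: dot_square_norm norm_sgn)
  finally have 1: "(\<Sum>i\<in>Basis. (sgn x \<bullet> i) * (sgn x \<bullet> i)) = 1" .
  have "(\<Sum>i\<in>Basis. radial_field_deriv \<phi> i x i) = deriv \<phi> (norm x) * (\<Sum>i\<in>Basis. (sgn x \<bullet> i) * (sgn x \<bullet> i)) +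
      \<phi> (norm x) / norm x * (\<Sum>i\<in>(Basis::'a set). 1 - (sgn x \<bullet> i) * (sgn x \<bullet> i))"
    unfolding radial_field_deriv_def by (simp add: sum.distrib sum_distrib_left)
  also have "\<dots> = deriv \<phi> (norm x) + \<phi> (norm x) / norm x * (real DIM('a) - 1)"
    by (simp add: 1 sum_subtractf)
  finally show ?thesis by (simp add: Suc_leI mult.commute)
qed

text \<open>For n = d - 1 the bracket is the divergence in \<open>sum_radial_field_deriv\<close> at
  radius t.\<close>

lemma deriv_mult_power:
  assumes "(\<phi> has_real_derivative deriv \<phi> t) (at t)" "0 < t"
  shows "deriv (\<lambda>s. \<phi> s * s ^ n) t = (deriv \<phi> t + real n * (\<phi> t / t)) * t ^ n"
proof (rule DERIV_imp_deriv)
  have "((\<lambda>s. \<phi> s * s ^ n) has_real_derivative deriv \<phi> t * t ^ n + \<phi> t * (real n * t ^ (n - 1))) (at t)"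
    by (auto intro!: derivative_eq_intros assms)
  moreover have "deriv \<phi> t * t ^ n + \<phi> t * (real n * t ^ (n - 1)) = (deriv \<phi> t + real n * (\<phi> t / t)) * t ^ n"
    using assms(2) by (cases n) (auto simp: field_simps)
  ultimately show "((\<lambda>s. \<phi> s * s ^ n) has_real_derivative (deriv \<phi> t + real n * (\<phi> t / t)) * t ^ n) (at t)"
    by simp
qed

subsection \<open>Measures on the half-line\<close>

text \<open>Polar decomposition for finite variation: \<open>M\<close> is the variation measure and
  \<open>s\<close> takes the values 1 and -1. Total variation thereby becomes the mass of a positive
  finite measure.\<close>

lemma finite_signed_measure_density:
  fixes \<mu> :: "'a::euclidean_space signed_measure"
  assumes \<mu>: "signed_radon_measure_on UNIV \<mu>" "finite_variation \<mu>"
  obtains M s where "finite_measure M" "sets M = sets borel" "s \<in> borel_measurable borel"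
    "\<And>x. \<bar>s x\<bar> \<le> 1" "measure M UNIV = total_variation \<mu>"
    "\<And>f. f \<in> borel_measurable borel \<Longrightarrow> bounded (range f) \<Longrightarrow> signed_integral \<mu> f = (LINT x|M. f x * s x)"
proof -
  obtain P N where PN: "\<mu> = (P, N)" by (cases \<mu>)
  have s: "sets P = sets borel" "sets N = sets borel" and ms: "mutually_singular P N"
    using \<mu> by (auto simp: signed_radon_measure_on_def radon_measure_on_def PN)
  have eq: "sets P = sets N" using s by simp
  have sp: "space P = UNIV" using sets_eq_imp_space_eq[OF s(1)] by simp
  define M where "M = variation_measure \<mu>"
  have sM [measurable_cong]: "sets M = sets borel" and spM: "space M = UNIV"
    using sets_variation_measure[OF eq] space_variation_measure[OF eq] s sp by (simp_all add: M_def PN)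
  have fin: "finite_measure M"
    using \<mu>(2) by (intro finite_measureI) (auto simp: finite_variation_def M_def)
  obtain A where A: "A \<in> sets P" "\<And>f. integrable (variation_measure (P, N)) f \<Longrightarrow>
      signed_integral (P, N) f =
        (LINT x|variation_measure (P, N). f x * (indicator A x - indicator (space P - A) x))"
    using signed_integral_sign_density[OF eq ms] by metis
  show ?thesis
  proof (rule that[OF fin sM])
    show "(\<lambda>x. indicat_real A x - indicat_real (space P - A) x) \<in> borel_measurable borel"
      using A(1) s(1) sp by (intro borel_measurable_diff borel_measurable_indicator) auto
    show "\<bar>indicat_real A x - indicat_real (space P - A) x\<bar> \<le> 1" for x by (auto simp: indicator_def)
    show "measure M UNIV = total_variation \<mu>" by (simp add: total_variation_def M_def flip: spM)
    fix f :: "'a \<Rightarrow> real" assume "f \<in> borel_measurable borel" "bounded (range f)"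
    then have "integrable M f"
      using finite_measure.integrable_bounded_mult[OF fin, of "\<lambda>_. 1" f] fin
      by (simp add: finite_measure.integrable_const cong: measurable_cong_sets add: sM)
    then show "signed_integral \<mu> f = (LINT x|M. f x * (indicat_real A x - indicat_real (space P - A) x))"
      using A(2) by (simp add: M_def PN)
  qed
qed

lemma emeasure_density_le:
  assumes "integrable M h" "A \<in> sets M"
  shows "emeasure (density M (\<lambda>x. ennreal (h x))) A \<le> ennreal (LINT x|M. \<bar>h x\<bar>)"
proof -
  have "emeasure (density M (\<lambda>x. ennreal (h x))) A = (\<integral>\<^sup>+x. ennreal (h x) * indicator A x \<partial>M)"
    using assms by (intro emeasure_density) auto
  also have "\<dots> \<le> (\<integral>\<^sup>+x. ennreal \<bar>h x\<bar> \<partial>M)"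
    by (intro nn_integral_mono) (auto simp: indicator_def intro!: ennreal_leI)
  also have "\<dots> = ennreal (LINT x|M. \<bar>h x\<bar>)"
    using assms by (intro nn_integral_eq_integral) auto
  finally show ?thesis .
qed

lemma signed_density_finite:
  fixes h :: "'a::euclidean_space \<Rightarrow> real"
  assumes M: "finite_measure M" and s [measurable_cong]: "sets M = sets borel"
    and [measurable]: "h \<in> borel_measurable borel" and h: "integrable M h"
  shows "signed_radon_measure_on UNIV (signed_density M h)"
    and "finite_variation (signed_density M h)"
    and "total_variation (signed_density M h) = (LINT x|M. \<bar>h x\<bar>)"
    and "f \<in> borel_measurable borel \<Longrightarrow> bounded (range f) \<Longrightarrow>
      signed_integral (signed_density M h) f = (LINT x|M. f x * h x)"
proof -
  have hM: "h \<in> borel_measurable M" by measurable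
  have h': "integrable M (\<lambda>x. - h x)" using h by simp
  have lt: "emeasure (density M (\<lambda>x. ennreal (h x))) K < \<infinity>" "emeasure (density M (\<lambda>x. ennreal (- h x))) K < \<infinity>"
    if "K \<in> sets M" for K
    using emeasure_density_le[OF h that] emeasure_density_le[OF h' that]
    by (auto intro: le_less_trans)
  show "signed_radon_measure_on UNIV (signed_density M h)"
    using mutually_singular_signed_density[OF hM] lt
    by (auto simp: signed_radon_measure_on_def radon_measure_on_def signed_density_def s compact_imp_closed)
  have v: "variation_measure (signed_density M h) = density M (\<lambda>x. ennreal \<bar>h x\<bar>)"
    by (rule variation_measure_signed_density[OF hM])
  have e: "emeasure (variation_measure (signed_density M h)) (space (variation_measure (signed_density M h))) =
      ennreal (LINT x|M. \<bar>h x\<bar>)"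
  proof -
    have "emeasure (density M (\<lambda>x. ennreal \<bar>h x\<bar>)) (space M) = (\<integral>\<^sup>+x. ennreal \<bar>h x\<bar> * indicator (space M) x \<partial>M)"
      by (intro emeasure_density) auto
    also have "\<dots> = (\<integral>\<^sup>+x. ennreal \<bar>h x\<bar> \<partial>M)"
      by (intro nn_integral_cong) simp
    also have "\<dots> = ennreal (LINT x|M. \<bar>h x\<bar>)"
      using h by (intro nn_integral_eq_integral) auto
    finally show ?thesis by (simp add: v)
  qed
  show "finite_variation (signed_density M h)" by (simp add: finite_variation_def e)
  show "total_variation (signed_density M h) = (LINT x|M. \<bar>h x\<bar>)"
    unfolding total_variation_def measure_def e by simp
  show "signed_integral (signed_density M h) f = (LINT x|M. f x * h x)"
    if f: "f \<in> borel_measurable borel" "bounded (range f)"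
    using f finite_measure.integrable_bounded_mult[OF M h _ f(2)] hM
    by (intro signed_integral_signed_density) auto
qed

text \<open>\<nu> may have infinite variation near 0, but the variation weighted by r^n is finite.
  That weighted measure, moved to the whole line by the inclusion, is \<open>M\<close>; the sign of
  \<nu> survives as the density \<open>s\<close>.\<close>

lemma halfline_signed_measure_density:
  fixes \<nu> :: "real signed_measure"
  assumes \<nu>: "signed_radon_measure_on {0<..} \<nu>"
    and fin: "(\<integral>\<^sup>+r. ennreal (r ^ n) \<partial>variation_measure \<nu>) < \<infinity>"
  obtains M s where "finite_measure M" "sets M = sets borel" "s \<in> borel_measurable borel"
    "\<And>x. \<bar>s x\<bar> \<le> 1" "measure M UNIV = (LINT r|variation_measure \<nu>. r ^ n)" "AE r in M. 0 < r"
    "\<And>f. f \<in> borel_measurable borel \<Longrightarrow> bounded (range f) \<Longrightarrow>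
      signed_integral \<nu> (\<lambda>t. f t * t ^ n) = (LINT x|M. f x * s x)"
proof -
  obtain P N where PN: "\<nu> = (P, N)" by (cases \<nu>)
  have s: "sets P = sets (restrict_space borel {0<..})" "sets N = sets (restrict_space borel {0<..})"
    and ms: "mutually_singular P N"
    using \<nu> by (auto simp: signed_radon_measure_on_def radon_measure_on_def PN)
  have eq: "sets P = sets N" using s by simp
  have sp: "space P = {0<..}" using sets_eq_imp_space_eq[OF s(1)] by (simp add: space_restrict_space)
  define V where "V = variation_measure \<nu>"
  have sV: "sets V = sets (restrict_space borel {0<..})" and spV: "space V = {0<..}"
    using sets_variation_measure[OF eq] space_variation_measure[OF eq] s sp by (simp_all add: V_def PN)
  have meas: "f \<in> borel_measurable V" if "f \<in> borel_measurable borel" for f :: "real \<Rightarrow> real"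
    using that by (simp add: measurable_cong_sets[OF sV refl] measurable_restrict_space1)
  have id: "(\<lambda>x. x) \<in> V \<rightarrow>\<^sub>M borel" by (rule meas) simp
  obtain A where A: "A \<in> sets P" "\<And>f. integrable (variation_measure (P, N)) f \<Longrightarrow>
      signed_integral (P, N) f =
        (LINT x|variation_measure (P, N). f x * (indicator A x - indicator (space P - A) x))"
    using signed_integral_sign_density[OF eq ms] by metis
  have Ab: "A \<in> sets borel" using A(1) by (simp add: s sets_restrict_space_iff)
  define D where "D = density V (\<lambda>r. ennreal (r ^ n))"
  define M where "M = distr D borel (\<lambda>x. x)"
  have idD: "(\<lambda>x. x) \<in> D \<rightarrow>\<^sub>M borel" using id by (simp add: D_def)
  have pos: "AE r in V. 0 \<le> r ^ n" by (rule AE_I2) (simp add: spV)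
  have pm: "(\<lambda>r. r ^ n) \<in> borel_measurable V" by (rule meas) simp
  have nn: "emeasure M (space M) = (\<integral>\<^sup>+r. ennreal (r ^ n) \<partial>V)"
  proof -
    have "emeasure M (space M) = emeasure D (space D)" by (simp add: M_def emeasure_distr[OF idD])
    also have "\<dots> = (\<integral>\<^sup>+r. ennreal (r ^ n) * indicator (space V) r \<partial>V)"
      unfolding D_def space_density using pm by (intro emeasure_density) auto
    also have "\<dots> = (\<integral>\<^sup>+r. ennreal (r ^ n) \<partial>V)" by (intro nn_integral_cong) simp
    finally show ?thesis .
  qed
  have finM: "finite_measure M" using fin by (intro finite_measureI) (simp add: nn V_def)
  have intp: "integrable V (\<lambda>r. r ^ n)"
    using fin pm pos by (intro integrableI_nonneg) (auto simp: V_def)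
  have sM: "sets M = sets borel" by (simp add: M_def)
  \<comment> \<open>The complement is taken in the whole line, so \<open>?s\<close> is -1 at
    nonpositive points; \<open>M\<close> does not charge them.\<close>
  let ?s = "\<lambda>x. indicat_real A x - indicat_real (- A) x"
  show ?thesis
  proof (rule that[OF finM sM])
    show "?s \<in> borel_measurable borel" using Ab by auto
    show "\<bar>?s x\<bar> \<le> 1" for x by (auto simp: indicator_def)
    have "emeasure M UNIV = ennreal (LINT r|V. r ^ n)"
      using nn intp pos by (simp add: M_def nn_integral_eq_integral)
    moreover have "0 \<le> (LINT r|V. r ^ n)" using pos by (rule integral_nonneg_AE)
    ultimately show "measure M UNIV = (LINT r|variation_measure \<nu>. r ^ n)"
      by (simp add: measure_def V_def)
    show "AE r in M. 0 < r"
      unfolding M_def by (subst AE_distr_iff[OF idD]) (auto simp: D_def spV intro!: AE_I2)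
    fix f :: "real \<Rightarrow> real" assume f: "f \<in> borel_measurable borel" "bounded (range f)"
    have fs: "(\<lambda>x. f x * ?s x) \<in> borel_measurable borel" using f Ab by auto
    obtain B where B: "\<And>x. \<bar>f x\<bar> \<le> B" using f(2) by (auto simp: bounded_iff)
    have "integrable V (\<lambda>t. f t * t ^ n)"
    proof (rule Bochner_Integration.integrable_bound[of V "\<lambda>r. B * r ^ n"])
      show "integrable V (\<lambda>r. B * r ^ n)" using intp by simp
      show "(\<lambda>t. f t * t ^ n) \<in> borel_measurable V" using f by (intro meas) simp
      have "\<bar>f t\<bar> * \<bar>t ^ n\<bar> \<le> \<bar>B\<bar> * \<bar>t ^ n\<bar>" for t
        using B[of t] by (intro mult_right_mono) auto
      then show "AE t in V. norm (f t * t ^ n) \<le> norm (B * t ^ n)" by (simp add: abs_mult)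
    qed
    then have "signed_integral \<nu> (\<lambda>t. f t * t ^ n) =
        (LINT t|V. f t * t ^ n * (indicator A t - indicator (space P - A) t))"
      using A(2) by (simp add: V_def PN)
    also have "\<dots> = (LINT t|V. t ^ n *\<^sub>R (f t * ?s t))"
      by (intro Bochner_Integration.integral_cong) (auto simp: spV sp indicator_def)
    also have "\<dots> = (LINT t|D. f t * ?s t)"
      unfolding D_def using pm pos fs by (intro integral_density[symmetric] meas) auto
    also have "\<dots> = (LINT t|M. f t * ?s t)"
      unfolding M_def using fs by (intro integral_distr[OF idD, symmetric])
    finally show "signed_integral \<nu> (\<lambda>t. f t * t ^ n) = (LINT x|M. f x * ?s x)" .
  qed
qed

text \<open>The reverse passage: the weight c r^n is divided out of a finite signed measure. The
  quotient may have infinite mass near 0, but a compact set in the open half-line has a least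
  element a > 0, and there the density is at most |h| / (c a^n). Mass of \<open>M\<close> outside
  the half-line is dropped, which is why \<open>f\<close> has to vanish there.\<close>

lemma halfline_signed_density:
  fixes h :: "real \<Rightarrow> real" and n :: nat
  assumes M: "finite_measure M" and s [measurable_cong]: "sets M = sets borel"
    and [measurable]: "h \<in> borel_measurable borel" and h: "integrable M h" and c: "0 < c"
  defines "\<nu> \<equiv> signed_density (restrict_space M {0<..}) (\<lambda>r. h r / (c * r ^ n))"
  shows "signed_radon_measure_on {0<..} \<nu>"
    and "(\<integral>\<^sup>+r. ennreal (r ^ n) \<partial>variation_measure \<nu>) < \<infinity>"
    and "(LINT r|variation_measure \<nu>. r ^ n) \<le> (LINT r|M. \<bar>h r\<bar>) / c"
    and "f \<in> borel_measurable borel \<Longrightarrow> bounded (range f) \<Longrightarrow> (\<And>t. t \<le> 0 \<Longrightarrow> f t = 0) \<Longrightarrow>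
      signed_integral \<nu> (\<lambda>t. f t * t ^ n) = (LINT t|M. f t * h t) / c"
proof -
  define S where "S = restrict_space M {0<..}"
  define k where "k r = h r / (c * r ^ n)" for r
  have sp: "{0<..} \<inter> space M \<in> sets M" "space M = UNIV"
    using sets_eq_imp_space_eq[OF s] by (simp_all add: s)
  have sS: "sets S = sets (restrict_space borel {0<..})" and spS: "space S = {0<..}"
    using sp by (simp_all add: S_def space_restrict_space cong: sets_restrict_space_cong[OF s])
  have meas: "f \<in> borel_measurable S" if "f \<in> borel_measurable borel" for f :: "real \<Rightarrow> real"
    using that by (simp add: measurable_cong_sets[OF sS refl] measurable_restrict_space1)
  have hS: "integrable S h"
    unfolding S_def using integrable_mult_indicator[OF _ h, of "{0<..}"]
    by (subst integrable_restrict_space[OF sp(1)]) (simp add: s)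
  have kS: "k \<in> borel_measurable S" unfolding k_def by (intro meas) measurable
  have \<nu>: "\<nu> = signed_density S k" by (simp add: \<nu>_def S_def k_def[abs_def])
  have v: "variation_measure \<nu> = density S (\<lambda>r. ennreal \<bar>k r\<bar>)"
    unfolding \<nu> by (rule variation_measure_signed_density[OF kS])
  have pm: "(\<lambda>r. r ^ n) \<in> borel_measurable S" by (rule meas) simp
  have abs: "\<bar>k r\<bar> * r ^ n = \<bar>h r\<bar> / c" if "r \<in> space S" for r
    using that c by (simp add: k_def spS abs_mult field_simps)
  have "(\<integral>\<^sup>+r. ennreal (r ^ n) \<partial>variation_measure \<nu>) = (\<integral>\<^sup>+r. ennreal \<bar>k r\<bar> * ennreal (r ^ n) \<partial>S)"
    unfolding v using kS pm by (intro nn_integral_density) auto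
  also have "\<dots> = (\<integral>\<^sup>+r. ennreal (\<bar>h r\<bar> / c) \<partial>S)"
    by (intro nn_integral_cong) (simp add: abs flip: ennreal_mult')
  also have "\<dots> = ennreal (LINT r|S. \<bar>h r\<bar> / c)"
    using hS c by (intro nn_integral_eq_integral) auto
  finally show "(\<integral>\<^sup>+r. ennreal (r ^ n) \<partial>variation_measure \<nu>) < \<infinity>" by simp
  have "(LINT r|variation_measure \<nu>. r ^ n) = (LINT r|S. \<bar>k r\<bar> *\<^sub>R r ^ n)"
    unfolding v using kS pm by (intro integral_density) auto
  also have "\<dots> = (LINT r|S. \<bar>h r\<bar> / c)"
    by (intro Bochner_Integration.integral_cong) (simp_all add: abs)
  also have "\<dots> = (LINT r|S. \<bar>h r\<bar>) / c" by simp
  also have "(LINT r|S. \<bar>h r\<bar>) = (LINT r|M. indicator {0<..} r *\<^sub>R \<bar>h r\<bar>)"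
    unfolding S_def by (rule integral_restrict_space[OF sp(1)])
  also have "(LINT r|M. indicator {0<..} r *\<^sub>R \<bar>h r\<bar>) \<le> (LINT r|M. \<bar>h r\<bar>)"
    using h by (intro integral_mono integrable_mult_indicator) (auto simp: s indicator_def)
  finally show "(LINT r|variation_measure \<nu>. r ^ n) \<le> (LINT r|M. \<bar>h r\<bar>) / c"
    using c by (simp add: divide_right_mono)
  have K: "emeasure (density S (\<lambda>r. ennreal (u r))) K < \<infinity>"
    if u: "u \<in> borel_measurable borel" "\<And>r. \<bar>u r\<bar> = \<bar>k r\<bar>" and K: "compact K" "K \<subseteq> {0<..}" for u K
  proof (cases "K = {}")
    case False
    then obtain a where a: "a \<in> K" "\<And>r. r \<in> K \<Longrightarrow> a \<le> r" using compact_attains_inf[OF K(1)] by metis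
    have "0 < a" using a K by auto
    have KS: "K \<in> sets S" using K by (simp add: sS sets_restrict_space_iff compact_imp_closed)
    have "emeasure (density S (\<lambda>r. ennreal (u r))) K = (\<integral>\<^sup>+r. ennreal (u r) * indicator K r \<partial>S)"
      using u KS by (intro emeasure_density) (auto intro: measurable_compose[OF meas])
    also have "\<dots> \<le> (\<integral>\<^sup>+r. ennreal (\<bar>h r\<bar> / (c * a ^ n)) \<partial>S)"
    proof (intro nn_integral_mono)
      fix r
      have "u r \<le> \<bar>h r\<bar> / (c * a ^ n)" if "r \<in> K"
      proof -
        have "0 < r" "a \<le> r" using that a K by auto
        have "u r \<le> \<bar>k r\<bar>" using u(2)[of r] by linarith
        also have "\<dots> = \<bar>h r\<bar> / (c * r ^ n)" using c \<open>0 < r\<close> by (simp add: k_def abs_mult)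
        also have "\<dots> \<le> \<bar>h r\<bar> / (c * a ^ n)"
          using c \<open>0 < a\<close> \<open>a \<le> r\<close> by (intro divide_left_mono mult_left_mono power_mono mult_pos_pos) auto
        finally show ?thesis .
      qed
      then show "ennreal (u r) * indicator K r \<le> ennreal (\<bar>h r\<bar> / (c * a ^ n))"
        by (auto simp: indicator_def intro!: ennreal_leI)
    qed
    also have "\<dots> = ennreal (LINT r|S. \<bar>h r\<bar> / (c * a ^ n))"
      using hS c \<open>0 < a\<close> by (intro nn_integral_eq_integral) auto
    finally show ?thesis by (rule le_less_trans) simp
  qed simp
  have kb: "k \<in> borel_measurable borel" unfolding k_def by measurable
  show "signed_radon_measure_on {0<..} \<nu>"
    using mutually_singular_signed_density[OF kS] K[of k] K[of "\<lambda>r. - k r"] kb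
    by (auto simp: signed_radon_measure_on_def radon_measure_on_def \<nu> signed_density_def sS)
  show "signed_integral \<nu> (\<lambda>t. f t * t ^ n) = (LINT t|M. f t * h t) / c"
    if f: "f \<in> borel_measurable borel" "bounded (range f)" "\<And>t. t \<le> 0 \<Longrightarrow> f t = 0"
  proof -
    have fk: "f t * t ^ n * k t = f t * h t / c" if "t \<in> space S" for t
      using that c by (simp add: k_def spS field_simps)
    have fh: "integrable M (\<lambda>t. f t * h t)"
      using f by (intro finite_measure.integrable_bounded_mult[OF M h]) auto
    have "integrable S (\<lambda>t. f t * h t)"
      unfolding S_def using integrable_mult_indicator[OF _ fh, of "{0<..}"]
      by (subst integrable_restrict_space[OF sp(1)]) (simp add: s)
    then have "integrable S (\<lambda>t. f t * h t / c)" by simp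
    then have "integrable S (\<lambda>t. f t * t ^ n * k t)"
      by (rule Bochner_Integration.integrable_cong[THEN iffD1, rotated -1]) (simp_all add: fk)
    then have "signed_integral \<nu> (\<lambda>t. f t * t ^ n) = (LINT t|S. f t * t ^ n * k t)"
      unfolding \<nu> using f kS kb by (intro signed_integral_signed_density meas) auto
    also have "\<dots> = (LINT t|S. f t * h t) / c"
      by (simp add: fk cong: Bochner_Integration.integral_cong)
    also have "(LINT t|S. f t * h t) = (LINT t|M. indicator {0<..} t *\<^sub>R (f t * h t))"
      unfolding S_def by (rule integral_restrict_space[OF sp(1)])
    also have "\<dots> = (LINT t|M. f t * h t)"
      using f(3) by (intro Bochner_Integration.integral_cong) (auto simp: indicator_def not_less)
    finally show ?thesis .
  qed
qed

subsection \<open>Weak derivatives of radial functions\<close>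

lemma has_weak_partial_measureD:
  assumes "has_weak_partial_measure i f \<mu>" "\<phi> \<in> C1_compact_support"
  shows "(LINT x|lebesgue. f x * partial_deriv i \<phi> x) = - signed_integral \<mu> \<phi>"
  using assms by (simp add: has_weak_partial_measure_def)

lemma has_weak_partial_measure_unique:
  assumes "has_weak_partial_measure i f \<mu>" "has_weak_partial_measure i f \<nu>"
  shows "\<mu> = \<nu>"
  using assms
  by (intro signed_radon_measure_unique[OF open_UNIV]) (auto simp: has_weak_partial_measure_def)

text \<open>Testing with this quotient turns the weighted pairing with \<nu> into the plain integral
  of \<psi>, which is what uniqueness requires. Since \<psi> vanishes on a neighbourhood of 0, the
  division creates no singularity and the limits at 0 are 0.\<close>

lemma divide_power_C1_compact_support_halfline:
  fixes \<psi> :: "real \<Rightarrow> real"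
  assumes \<psi>: "\<psi> \<in> C1_compact_support" and sub: "closure {t. \<psi> t \<noteq> 0} \<subseteq> {0<..}"
  shows "(\<lambda>t. \<psi> t / t ^ n) \<in> C1_compact_support_halfline"
proof -
  let ?K = "closure {t. \<psi> t \<noteq> 0}" and ?f = "\<lambda>t. \<psi> t / t ^ n"
  have K: "compact ?K" using \<psi> by (simp add: C1_compact_support_def)
  obtain a where a: "0 < a" "\<And>t. t < a \<Longrightarrow> \<psi> t = 0"
  proof (cases "?K = {}")
    case True
    then have "\<psi> t = 0" for t using closure_subset[of "{t. \<psi> t \<noteq> 0}"] by auto
    then show ?thesis using that[of 1] by simp
  next
    case False
    then obtain a where "a \<in> ?K" "\<forall>t\<in>?K. a \<le> t" using compact_attains_inf[OF K] by auto
    moreover have "t \<in> ?K" if "\<psi> t \<noteq> 0" for t using closure_subset that by fast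
    ultimately show ?thesis using that[of a] sub by force
  qed
  note C1 = C1_fun_C1_compact_support[OF \<psi>]
  have der\<psi>: "(\<psi> has_real_derivative partial_deriv 1 \<psi> t) (at t)" for t
    using C1_fun_directional_derivative[OF C1, of 0 1 t] by simp
  let ?d = "\<lambda>t. (partial_deriv 1 \<psi> t * t ^ n - \<psi> t * (real n * t ^ (n - 1))) / (t ^ n * t ^ n)"
  have der: "(?f has_real_derivative ?d t) (at t)" if "0 < t" for t
    using that by (auto intro!: derivative_eq_intros der\<psi>)
  then have deriv: "deriv ?f t = ?d t" if "0 < t" for t using that DERIV_imp_deriv by blast
  have f0: "?f t = 0" if "t < a" for t using a that by simp
  have der0: "deriv ?f t = 0" if "t < a" for t
  proof (rule DERIV_imp_deriv)
    have "((\<lambda>t. 0) has_real_derivative 0) (at t)" by simp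
    then show "(?f has_real_derivative 0) (at t)"
      by (rule has_field_derivative_transform_within_open[where S = "{..<a}"]) (use that f0 in auto)
  qed
  have ev: "\<forall>\<^sub>F t in at_right 0. t < a" using a(1) eventually_at_right_less eventually_at_right[of 0 a] by auto
  have "isCont ?f t" if "0 \<le> t" for t
  proof (cases "0 < t")
    case True
    then show ?thesis using der DERIV_isCont by blast
  next
    case False
    then have "t < a" using a(1) by simp
    have "((\<lambda>t. 0) has_real_derivative 0) (at t)" by simp
    then have "(?f has_real_derivative 0) (at t)"
      by (rule has_field_derivative_transform_within_open[where S = "{..<a}"]) (use \<open>t < a\<close> f0 in auto)
    then show ?thesis by (rule DERIV_isCont)
  qed
  then have "continuous_on {0..} ?f" by (intro continuous_at_imp_continuous_on) auto
  moreover have "continuous_on {0<..} (deriv ?f)"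
  proof -
    have "continuous_on {0<..} ?d"
      by (intro continuous_intros C1_fun_partial_deriv(2)[OF C1] C1_fun_continuous[OF C1]) auto
    then show ?thesis by (rule continuous_on_eq) (simp add: deriv)
  qed
  moreover have "compact (closure {t. 0 \<le> t \<and> ?f t \<noteq> 0})"
  proof -
    have "{t. 0 \<le> t \<and> ?f t \<noteq> 0} \<subseteq> ?K" using closure_subset[of "{t. \<psi> t \<noteq> 0}"] by auto
    then show ?thesis by (metis K bounded_subset compact_closure compact_imp_bounded)
  qed
  moreover have "((\<lambda>t. ?f t / t) \<longlongrightarrow> 0) (at_right 0)" "(deriv ?f \<longlongrightarrow> 0) (at_right 0)"
    by (rule tendsto_eventually, use ev in eventually_elim, simp add: f0 der0)+
  moreover have "?f 0 = 0" by (rule f0[OF a(1)])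
  moreover have "?f differentiable (at t)" if "0 < t" for t
    using der[OF that] real_differentiable_def by blast
  ultimately show ?thesis
    unfolding C1_compact_support_halfline_def by auto
qed

lemma has_weighted_derivative_measureD:
  assumes "has_weighted_derivative_measure d g \<nu>" "\<phi> \<in> C1_compact_support_halfline"
  shows "(LINT t|lebesgue_on {0<..}. g t * deriv (\<lambda>s. \<phi> s * s ^ (d - 1)) t) =
    - signed_integral \<nu> (\<lambda>t. \<phi> t * t ^ (d - 1))"
  using assms by (simp add: has_weighted_derivative_measure_def)

lemma has_weighted_derivative_measure_unique:
  assumes "has_weighted_derivative_measure d g \<mu>" "has_weighted_derivative_measure d g \<nu>"
  shows "\<mu> = \<nu>"
proof (rule signed_radon_measure_unique[of "{0<..}"])
  show "signed_radon_measure_on {0<..} \<mu>" "signed_radon_measure_on {0<..} \<nu>"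
    using assms by (simp_all add: has_weighted_derivative_measure_def)
  fix \<psi> :: "real \<Rightarrow> real" assume "\<psi> \<in> C1_compact_support" "closure {t. \<psi> t \<noteq> 0} \<subseteq> {0<..}"
  then have test: "(\<lambda>t. \<psi> t / t ^ (d - 1)) \<in> C1_compact_support_halfline"
    by (rule divide_power_C1_compact_support_halfline)
  \<comment> \<open>The power may be cancelled because the measures live on the open
    half-line.\<close>
  have eq: "signed_integral \<rho> \<psi> = signed_integral \<rho> (\<lambda>t. \<psi> t / t ^ (d - 1) * t ^ (d - 1))"
    if "signed_radon_measure_on {0<..} \<rho>" for \<rho>
  proof -
    have "space (fst \<rho>) = {0<..}" "space (snd \<rho>) = {0<..}"
      using that sets_eq_imp_space_eq[of _ "restrict_space borel {0<..}"]
      by (auto simp: signed_radon_measure_on_def radon_measure_on_def space_restrict_space)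
    then show ?thesis
      unfolding signed_integral_def
      by (intro arg_cong2[where f = "(-)"] Bochner_Integration.integral_cong) auto
  qed
  have "signed_integral \<mu> (\<lambda>t. \<psi> t / t ^ (d - 1) * t ^ (d - 1)) =
      signed_integral \<nu> (\<lambda>t. \<psi> t / t ^ (d - 1) * t ^ (d - 1))"
  proof -
    have "(LINT t|lebesgue_on {0<..}. g t * deriv (\<lambda>s. \<psi> s / s ^ (d - 1) * s ^ (d - 1)) t) =
        - signed_integral \<rho> (\<lambda>t. \<psi> t / t ^ (d - 1) * t ^ (d - 1))"
      if "has_weighted_derivative_measure d g \<rho>" for \<rho>
      by (rule has_weighted_derivative_measureD[OF that test])
    from this[OF assms(1)] this[OF assms(2)] show ?thesis by linarith
  qed
  then show "signed_integral \<mu> \<psi> = signed_integral \<nu> \<psi>"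
    using assms eq by (simp add: has_weighted_derivative_measure_def)
qed simp

lemma C1_compact_support_test:
  assumes "\<phi> \<in> C1_compact_support"
  shows "\<phi> \<in> borel_measurable borel" "bounded (range \<phi>)"
    "partial_deriv v \<phi> \<in> borel_measurable borel" "bounded (range (partial_deriv v \<phi>))"
proof -
  note C1 = C1_fun_C1_compact_support[OF assms]
  show "\<phi> \<in> borel_measurable borel" "partial_deriv v \<phi> \<in> borel_measurable borel"
    by (intro borel_measurable_continuous_onI C1_fun_continuous C1 C1_fun_partial_deriv(2))+
  obtain R where R: "0 < R" "\<And>x. R \<le> norm x \<Longrightarrow> \<phi> x = 0"
    "\<And>x v. R \<le> norm x \<Longrightarrow> partial_deriv v \<phi> x = 0"
    using C1_compact_support_bounded[OF assms] by blast
  have *: "bounded (range f)" if "continuous_on UNIV f" "\<And>x. R \<le> norm x \<Longrightarrow> f x = 0" for f :: "'a \<Rightarrow> real"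
  proof -
    have "bounded (insert 0 (f ` cball 0 R))"
      unfolding bounded_insert
      by (intro compact_imp_bounded compact_continuous_image continuous_on_subset[OF that(1)]) auto
    moreover have "range f \<subseteq> insert 0 (f ` cball 0 R)"
    proof (intro image_subsetI)
      fix x show "f x \<in> insert 0 (f ` cball 0 R)"
        using that(2)[of x] by (cases "norm x \<le> R") auto
    qed
    ultimately show ?thesis by (rule bounded_subset)
  qed
  show "bounded (range \<phi>)" "bounded (range (partial_deriv v \<phi>))"
    using R by (auto intro!: * C1_fun_continuous[OF C1] C1_fun_partial_deriv(2)[OF C1])
qed

lemma integrable_mult_bounded:
  fixes f p :: "'a \<Rightarrow> real"
  assumes f: "integrable M f" and p: "p \<in> borel_measurable M" "bounded (range p)"
  shows "integrable M (\<lambda>x. f x * p x)"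
proof -
  obtain B where B: "\<And>x. \<bar>p x\<bar> \<le> B" using p(2) by (auto simp: bounded_iff)
  have "integrable M (\<lambda>x. B * f x)" using f by simp
  then show ?thesis
  proof (rule Bochner_Integration.integrable_bound)
    show "(\<lambda>x. f x * p x) \<in> borel_measurable M" using f p by simp
    have *: "\<bar>p x\<bar> \<le> \<bar>B\<bar>" for x using B[of x] by linarith
    then show "AE x in M. norm (f x * p x) \<le> norm (B * f x)"
      using mult_left_mono[OF *, of "\<bar>f _\<bar>"] by (intro AE_I2) (simp add: abs_mult mult.commute)
  qed
qed

lemma AE_radial_ext: "AE x in lborel. radial_ext g x = g (norm x)"
  using AE_lborel_singleton[of 0] by eventually_elim (simp add: radial_ext_def)

lemma borel_measurable_radial_ext [measurable]:
  assumes [measurable]: "g \<in> borel_measurable borel"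
  shows "(radial_ext g :: 'a::euclidean_space \<Rightarrow> real) \<in> borel_measurable borel"
proof -
  have "radial_ext g = (\<lambda>x::'a. indicator (- {0}) x * g (norm x))"
    by (auto simp: radial_ext_def indicator_def)
  also have "\<dots> \<in> borel_measurable borel"
    by (intro borel_measurable_times borel_measurable_indicator) auto
  finally show ?thesis .
qed

lemma integrable_radial_ext:
  assumes [measurable]: "g \<in> borel_measurable borel"
  shows "integrable lborel (radial_ext g :: 'a::euclidean_space \<Rightarrow> real) \<longleftrightarrow>
    integrable (radius_measure DIM('a)) g"
proof -
  have "integrable lborel (radial_ext g :: 'a \<Rightarrow> real) \<longleftrightarrow> integrable lborel (\<lambda>x::'a. g (norm x))"
    by (rule integrable_cong_AE) (auto intro: AE_radial_ext)
  then show ?thesis by (simp add: integrable_radial)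
qed

text \<open>The derivative is written as a positive measure \<open>M\<close>, the image of
  \<open>K\<close> times the cone measure, with a density of modulus at most 1. Its variation is
  thus at most the mass of \<open>M\<close>, a product of two masses; this produces the factor
  \<omega>.\<close>

proposition radial_ext_weak_partial_measure:
  fixes i :: "'a::euclidean_space"
  assumes g [measurable]: "g \<in> borel_measurable borel" and int: "integrable (radius_measure DIM('a)) g"
    and \<nu>: "has_weighted_derivative_measure DIM('a) g \<nu>" and i: "i \<in> Basis"
  obtains \<mu> where "has_weak_partial_measure i (radial_ext g) \<mu>"
    and "total_variation \<mu> \<le> measure sphere_measure (UNIV :: 'a set) *
      (LINT r|variation_measure \<nu>. r ^ (DIM('a) - 1))"
proof -
  let ?n = "DIM('a) - 1" and ?\<omega> = "measure sphere_measure (UNIV :: 'a set)"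
  have \<nu>': "signed_radon_measure_on {0<..} \<nu>" "(\<integral>\<^sup>+r. ennreal (r ^ ?n) \<partial>variation_measure \<nu>) < \<infinity>"
    using \<nu> by (simp_all add: has_weighted_derivative_measure_def)
  obtain K s where K: "finite_measure K" and sK [measurable_cong]: "sets K = sets borel"
    and s [measurable]: "s \<in> borel_measurable borel" and s1: "\<And>x. \<bar>s x\<bar> \<le> 1"
    and Km: "measure K UNIV = (LINT r|variation_measure \<nu>. r ^ ?n)" and Kpos: "AE r in K. 0 < r"
    and Kint: "\<And>f. f \<in> borel_measurable borel \<Longrightarrow> bounded (range f) \<Longrightarrow>
      signed_integral \<nu> (\<lambda>t. f t * t ^ ?n) = (LINT x|K. f x * s x)"
    by (rule halfline_signed_measure_density[OF \<nu>']) (rule that)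
  interpret K: finite_measure K by fact
  interpret KS: pair_sigma_finite K "sphere_measure :: 'a measure" ..
  interpret KS: finite_measure "K \<Otimes>\<^sub>M (sphere_measure :: 'a measure)"
    by (intro finite_measure_pair_measure K sphere_measure.finite_measure_axioms)
  let ?P = "K \<Otimes>\<^sub>M (sphere_measure :: 'a measure)"
  let ?m = "\<lambda>p. fst p *\<^sub>R snd p :: 'a"
  define M where "M = distr ?P borel ?m"
  have m [measurable]: "?m \<in> ?P \<rightarrow>\<^sub>M borel" by measurable
  have M: "finite_measure M" unfolding M_def by (rule KS.finite_measure_distr[OF m])
  have sM: "sets M = sets borel" by (simp add: M_def)
  \<comment> \<open>The sign of \<nu> and the direction factor can both be read off from the point
    x, so they form a density on space after the image has been taken.\<close>
  define h where "h x = s (norm x) * (sgn x \<bullet> i)" for x :: 'a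
  have sgni [measurable]: "(\<lambda>x::'a. sgn x \<bullet> i) \<in> borel_measurable borel"
    by (intro borel_measurable_inner borel_measurable_sgn borel_measurable_const)
  have h [measurable]: "h \<in> borel_measurable borel" unfolding h_def by measurable
  have h1: "\<bar>h x\<bar> \<le> 1" for x
    unfolding h_def abs_mult using s1[of "norm x"] abs_sgn_inner_le[of x i] i by (simp add: mult_le_one)
  have hint: "integrable M h"
    using h1 h by (intro finite_measure.integrable_const_bound[OF M, of _ 1]) (auto simp: measurable_cong_sets[OF sM refl])
  note \<mu> = signed_density_finite[OF M sM h hint]
  let ?\<mu> = "signed_density M h"
  have tv: "total_variation ?\<mu> \<le> ?\<omega> * (LINT r|variation_measure \<nu>. r ^ ?n)"
  proof -
    have "total_variation ?\<mu> \<le> (LINT x|M. 1)"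
      unfolding \<mu>(3) using hint h1 M
      by (intro integral_mono) (auto simp: finite_measure.integrable_const)
    also have "\<dots> = measure ?P (UNIV \<times> UNIV)"
      by (simp add: M_def measure_distr[OF m] space_pair_measure sets_eq_imp_space_eq[OF sK])
    also have "\<dots> = measure K UNIV * ?\<omega>"
      using sphere_measure.emeasure_pair_measure_Times[of UNIV K "UNIV :: 'a set"]
      by (simp add: sK measure_def enn2real_mult)
    finally show ?thesis by (simp add: Km mult.commute)
  qed
  have "has_weak_partial_measure i (radial_ext g) ?\<mu>"
    unfolding has_weak_partial_measure_def
  proof (intro conjI ballI \<mu>)
    fix \<phi> :: "'a \<Rightarrow> real" assume \<phi>: "\<phi> \<in> C1_compact_support"
    note C1 = C1_fun_C1_compact_support[OF \<phi>]
    note t [measurable] = C1_compact_support_test(1,3)[OF \<phi>] and b = C1_compact_support_test(2,4)[OF \<phi>]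
    define B where "B r = (LINT \<theta>|sphere_measure. partial_deriv i \<phi> (r *\<^sub>R \<theta>))" for r
    have cB: "continuous_on UNIV B"
      unfolding B_def by (intro continuous_on_sphere_integral continuous_on_polar C1_fun_partial_deriv(2)[OF C1])
    have [measurable]: "B \<in> borel_measurable borel" using cB by (rule borel_measurable_continuous_onI)
    let ?\<Phi> = "sphere_flux i \<phi>"
    have "continuous_on UNIV ?\<Phi>"
      using DERIV_sphere_flux[OF C1] by (meson DERIV_isCont continuous_at_imp_continuous_on)
    then have \<Phi>m: "?\<Phi> \<in> borel_measurable borel" by (rule borel_measurable_continuous_onI)
    have \<Phi>b: "bounded (range ?\<Phi>)"
    proof -
      obtain C where C: "\<And>x. \<bar>\<phi> x\<bar> \<le> C" using b(1) by (auto simp: bounded_iff)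
      have "\<bar>?\<Phi> r\<bar> \<le> C * ?\<omega>" for r
        unfolding sphere_flux_def
      proof (rule abs_integral_sphere_measure_le)
        show "continuous_on UNIV (\<lambda>\<theta>. \<phi> (r *\<^sub>R \<theta>) * (\<theta> \<bullet> i))"
          by (intro continuous_intros continuous_on_compose2[OF C1_fun_continuous[OF C1, of UNIV]]) auto
        fix \<theta> :: 'a assume "norm \<theta> \<le> 1"
        then have "\<bar>\<theta> \<bullet> i\<bar> \<le> 1" using Basis_le_norm[OF i, of \<theta>] by simp
        then show "\<bar>\<phi> (r *\<^sub>R \<theta>) * (\<theta> \<bullet> i)\<bar> \<le> C"
          unfolding abs_mult using mult_mono[OF C[of "r *\<^sub>R \<theta>"], of "\<bar>\<theta> \<bullet> i\<bar>" 1] C[of 0] by fastforce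
      qed
      then show ?thesis by (auto simp: bounded_iff)
    qed
    have ig: "integrable lborel (\<lambda>x::'a. g (norm x) * partial_deriv i \<phi> x)"
      using int t b by (intro integrable_mult_bounded) (auto simp: integrable_radial)
    have "(LINT x|lebesgue. radial_ext g x * partial_deriv i \<phi> x) =
        (LINT x|lborel. radial_ext g x * partial_deriv i \<phi> x)"
      by (rule integral_completion) measurable
    also have "\<dots> = (LINT x|lborel. g (norm x) * partial_deriv i \<phi> x)"
      using AE_radial_ext[of g] by (intro integral_cong_AE) (auto elim!: eventually_mono)
    also have "\<dots> = (LINT r|radius_measure DIM('a). g r * B r)"
      unfolding B_def by (rule integral_polar_mult[OF ig g t(2)])
    also have "\<dots> = (LINT t|lebesgue_on {0<..}. g t * B t * t ^ ?n)"
      by (rule integral_radius_measure) measurable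
    \<comment> \<open>The spherical integral of the partial derivative is recognised as the
      derivative of the weighted flux, so the flux becomes the test function for
      \<open>g\<close>.\<close>
    also have "\<dots> = (LINT t|lebesgue_on {0<..}. g t * deriv (\<lambda>s. ?\<Phi> s * s ^ ?n) t)"
      using DERIV_imp_deriv[OF DERIV_weighted_sphere_flux[OF \<phi>]]
      by (intro Bochner_Integration.integral_cong) (auto simp: B_def)
    also have "\<dots> = - signed_integral \<nu> (\<lambda>t. ?\<Phi> t * t ^ ?n)"
      using \<nu> sphere_flux_C1_compact_support_halfline[OF \<phi>, of i]
      by (simp add: has_weighted_derivative_measure_def)
    also have "signed_integral \<nu> (\<lambda>t. ?\<Phi> t * t ^ ?n) = (LINT r|K. ?\<Phi> r * s r)"
      by (rule Kint[OF \<Phi>m \<Phi>b])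
    also have "\<dots> = (LINT r|K. LINT \<theta>|sphere_measure. \<phi> (r *\<^sub>R \<theta>) * h (r *\<^sub>R \<theta>))"
    proof (rule integral_cong_AE)
      show "AE r in K. ?\<Phi> r * s r = (LINT \<theta>|sphere_measure. \<phi> (r *\<^sub>R \<theta>) * h (r *\<^sub>R \<theta>))"
        using Kpos
      proof eventually_elim
        fix r :: real assume r: "0 < r"
        have "(LINT \<theta>|sphere_measure. \<phi> (r *\<^sub>R \<theta>) * h (r *\<^sub>R \<theta>)) =
            (LINT \<theta>|sphere_measure. \<phi> (r *\<^sub>R \<theta>) * (\<theta> \<bullet> i) * s r)"
          using AE_sphere_measure r
          by (intro integral_cong_AE) (auto elim!: eventually_mono simp: h_def sgn_scaleR sgn_div_norm)
        then show "?\<Phi> r * s r = (LINT \<theta>|sphere_measure. \<phi> (r *\<^sub>R \<theta>) * h (r *\<^sub>R \<theta>))"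
          by (simp add: sphere_flux_def)
      qed
      show "(\<lambda>r. ?\<Phi> r * s r) \<in> borel_measurable K" using \<Phi>m by measurable
    qed measurable
    also have "\<dots> = (LINT p|?P. \<phi> (?m p) * h (?m p))"
    proof (rule trans[OF _ KS.integral_fst'])
      obtain C where C: "\<And>x. \<bar>\<phi> x\<bar> \<le> C" using b(1) by (auto simp: bounded_iff)
      have "\<bar>\<phi> x * h x\<bar> \<le> C" for x
        unfolding abs_mult using mult_mono[OF C[of x] h1[of x]] C[of 0] by fastforce
      then show "integrable ?P (\<lambda>p. \<phi> (?m p) * h (?m p))"
        by (intro KS.integrable_const_bound[of _ C]) auto
    qed simp
    also have "\<dots> = (LINT x|M. \<phi> x * h x)"
      unfolding M_def by (intro integral_distr[OF m, symmetric]) measurable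
    also have "\<dots> = signed_integral ?\<mu> \<phi>" by (rule \<mu>(4)[OF t(1) b(1), symmetric])
    finally show "(LINT x|lebesgue. radial_ext g x * partial_deriv i \<phi> x) = - signed_integral ?\<mu> \<phi>" .
  qed
  with tv show ?thesis by (rule that[rotated])
qed

lemma represented_by_density_mono:
  "represented_by_density L c \<Longrightarrow> c \<le> c' \<Longrightarrow> represented_by_density L c'"
  unfolding represented_by_density_def by (meson order_trans)

text \<open>The direction factor has modulus at most 1, so neither it nor taking the image under the
  norm increases the variation. An atom of \<mu> at the origin is removed by
  \<open>sgn 0 = 0\<close>.\<close>

lemma represented_by_density_radial:
  fixes i :: "'a::euclidean_space"
  assumes \<mu>: "signed_radon_measure_on UNIV \<mu>" "finite_variation \<mu>" and i: "i \<in> Basis"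
  shows "represented_by_density (\<lambda>f. signed_integral \<mu> (\<lambda>x. f (norm x) * (sgn x \<bullet> i))) (total_variation \<mu>)"
proof -
  obtain M s where M: "finite_measure M" and sM: "sets M = sets borel"
    and s [measurable]: "s \<in> borel_measurable borel" and s1: "\<And>x. \<bar>s x\<bar> \<le> 1"
    and tv: "measure M UNIV = total_variation \<mu>"
    and int: "\<And>f. f \<in> borel_measurable borel \<Longrightarrow> bounded (range f) \<Longrightarrow>
      signed_integral \<mu> f = (LINT x|M. f x * s x)"
    by (rule finite_signed_measure_density[OF \<mu>]) (rule that)
  have sgni [measurable]: "(\<lambda>x::'a. sgn x \<bullet> i) \<in> borel_measurable borel"
    by (intro borel_measurable_inner borel_measurable_sgn borel_measurable_const)
  define k where "k x = (sgn x \<bullet> i) * s x" for x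
  have k [measurable]: "k \<in> borel_measurable borel" unfolding k_def by measurable
  have sgn1: "\<bar>sgn x \<bullet> i\<bar> \<le> 1" for x using abs_sgn_inner_le[of x i] i by simp
  have k1: "\<bar>k x\<bar> \<le> 1" for x
    unfolding k_def abs_mult using s1[of x] sgn1[of x] by (simp add: mult_le_one)
  have ik: "integrable M k"
    using k1 k by (intro finite_measure.integrable_const_bound[OF M, of _ 1]) (auto simp: measurable_cong_sets[OF sM refl])
  have "(LINT x|M. \<bar>k x\<bar>) \<le> (LINT x|M. 1)"
    using ik k1 M by (intro integral_mono) (auto simp: finite_measure.integrable_const)
  also have "\<dots> = total_variation \<mu>"
    using sets_eq_imp_space_eq[OF sM] tv by simp
  finally have le: "(LINT x|M. \<bar>k x\<bar>) \<le> total_variation \<mu>" .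
  have "represented_by_density (\<lambda>f. LINT x|M. f (norm x) * k x) (LINT x|M. \<bar>k x\<bar>)"
    using ik by (intro represented_by_density_distr[OF M sM]) auto
  then have "represented_by_density (\<lambda>f. LINT x|M. f (norm x) * k x) (total_variation \<mu>)"
    using le by (rule represented_by_density_mono)
  then show ?thesis
  proof (rule represented_by_density_cong)
    fix f :: "real \<Rightarrow> real" assume [measurable]: "f \<in> borel_measurable borel" and b: "bounded (range f)"
    obtain C where C: "\<And>x. \<bar>f x\<bar> \<le> C" using b by (auto simp: bounded_iff)
    have "\<bar>f (norm x) * (sgn x \<bullet> i)\<bar> \<le> C" for x
      unfolding abs_mult using mult_mono[OF C[of "norm x"] sgn1[of x]] C[of 0] by fastforce
    then have "bounded (range (\<lambda>x. f (norm x) * (sgn x \<bullet> i)))" by (auto simp: bounded_iff)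
    then have "signed_integral \<mu> (\<lambda>x. f (norm x) * (sgn x \<bullet> i)) = (LINT x|M. f (norm x) * (sgn x \<bullet> i) * s x)"
      by (intro int) measurable
    then show "(LINT x|M. f (norm x) * k x) = signed_integral \<mu> (\<lambda>x. f (norm x) * (sgn x \<bullet> i))"
      by (simp add: k_def mult.assoc)
  qed
qed

lemma borel_measurable_indicator_mult_continuous:
  fixes f :: "real \<Rightarrow> real"
  assumes "continuous_on S f" "S \<in> sets borel"
  shows "(\<lambda>t. indicator S t * f t) \<in> borel_measurable borel"
  using borel_measurable_continuous_on_indicator[OF assms(2,1)] by simp

text \<open>The contributions of the coordinates are added as functionals on the line, where they
  may cancel against each other. The sum has a density over one finite measure, from which \<omega>
  r^(d-1) is then divided out.\<close>

proposition radial_ext_weighted_derivative_measure: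
  fixes \<mu> :: "'a::euclidean_space \<Rightarrow> 'a signed_measure"
  assumes g [measurable]: "g \<in> borel_measurable borel" and int: "integrable (radius_measure DIM('a)) g"
    and \<mu>: "\<And>i. i \<in> Basis \<Longrightarrow> has_weak_partial_measure i (radial_ext g) (\<mu> i)"
  obtains \<nu> where "has_weighted_derivative_measure DIM('a) g \<nu>"
    and "(LINT r|variation_measure \<nu>. r ^ (DIM('a) - 1)) \<le>
      (\<Sum>i\<in>Basis. total_variation (\<mu> i)) / measure sphere_measure (UNIV :: 'a set)"
proof -
  let ?n = "DIM('a) - 1" and ?\<omega> = "measure sphere_measure (UNIV :: 'a set)"
  note \<omega> = measure_sphere_measure_pos[where 'a='a]
  have "represented_by_density
      (\<lambda>f. \<Sum>i\<in>Basis. signed_integral (\<mu> i) (\<lambda>x. f (norm x) * (sgn x \<bullet> i)))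
      (\<Sum>i\<in>Basis. total_variation (\<mu> i))"
    using \<mu> by (intro represented_by_density_sum represented_by_density_radial)
      (auto simp: has_weak_partial_measure_def)
  then obtain M h where M: "finite_measure M" and sM: "sets M = sets borel"
    and h: "h \<in> borel_measurable borel" "integrable M h"
    and hle: "(LINT x|M. \<bar>h x\<bar>) \<le> (\<Sum>i\<in>Basis. total_variation (\<mu> i))"
    and rep: "\<forall>f\<in>borel_measurable borel. bounded (range f) \<longrightarrow>
      (\<Sum>i\<in>Basis. signed_integral (\<mu> i) (\<lambda>x. f (norm x) * (sgn x \<bullet> i))) = (LINT x|M. f x * h x)"
    unfolding represented_by_density_def by blast
  define \<nu> where "\<nu> = signed_density (restrict_space M {0<..}) (\<lambda>r. h r / (?\<omega> * r ^ ?n))"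
  note \<nu> = halfline_signed_density[OF M sM h \<omega>, where n = ?n, folded \<nu>_def]
  have "has_weighted_derivative_measure DIM('a) g \<nu>"
    unfolding has_weighted_derivative_measure_def
  proof (intro conjI ballI \<nu>)
    fix \<phi> assume \<phi>: "\<phi> \<in> C1_compact_support_halfline"
    note d = C1_compact_support_halflineD(1)[OF \<phi>] and c = C1_compact_support_halflineD(2,3)[OF \<phi>]
      and \<phi>0 = C1_compact_support_halflineD(4)[OF \<phi>]
    \<comment> \<open>\<phi> is arbitrary at negative arguments. Its extension by 0 is Borel and
      bounded on the line, and because of \<open>\<phi> 0 = 0\<close> it vanishes at every t \<le>
      0, as \<open>\<nu>(4)\<close> requires.\<close>
    define f where "f t = indicator {0..} t * \<phi> t" for t
    \<comment> \<open>The divergence of the radial field as a function of the radius.\<close>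
    define v where "v t = indicator {0<..} t * (deriv \<phi> t + real ?n * (\<phi> t / t))" for t
    have [measurable]: "f \<in> borel_measurable borel" unfolding f_def
      by (intro borel_measurable_indicator_mult_continuous c) simp
    have [measurable]: "v \<in> borel_measurable borel" unfolding v_def
      by (intro borel_measurable_indicator_mult_continuous continuous_intros c continuous_on_subset[OF c(1)]) auto
    have fb: "bounded (range f)"
    proof -
      obtain R where R: "0 < R" "\<forall>t\<ge>R. \<phi> t = 0"
        using C1_compact_support_halfline_bounded[OF \<phi>] by metis
      have "bounded (insert 0 (\<phi> ` {0..R}))"
        unfolding bounded_insert
        by (intro compact_imp_bounded compact_continuous_image continuous_on_subset[OF c(1)]) auto
      moreover have "range f \<subseteq> insert 0 (\<phi> ` {0..R})"
      proof (intro image_subsetI)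
        fix t show "f t \<in> insert 0 (\<phi> ` {0..R})"
          using R(2) by (cases "t \<in> {0..R}") (auto simp: f_def indicator_def)
      qed
      ultimately show ?thesis by (rule bounded_subset)
    qed
    have field: "radial_field \<phi> i = (\<lambda>x. f (norm x) * (sgn x \<bullet> i))" for i :: 'a
      by (auto simp: radial_field_def f_def)
    note rf = radial_field_C1_compact_support[OF \<phi>]
    note t = C1_compact_support_test(3,4)[OF rf]
    have ext: "integrable lborel (radial_ext g :: 'a \<Rightarrow> real)" using int by (simp add: integrable_radial_ext)
    have iprod: "integrable lborel (\<lambda>x. radial_ext g x * partial_deriv i (radial_field \<phi> i) x)" for i :: 'a
      using t[of i i] by (intro integrable_mult_bounded[OF ext]) auto
    have "(LINT t|lebesgue_on {0<..}. g t * deriv (\<lambda>s. \<phi> s * s ^ ?n) t) =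
        (LINT t|lebesgue_on {0<..}. (g t * v t) * t ^ ?n)"
      using d by (intro Bochner_Integration.integral_cong) (auto simp: deriv_mult_power v_def)
    also have "\<dots> = (LINT r|radius_measure DIM('a). g r * v r)"
      by (rule integral_radius_measure[symmetric]) measurable
    also have "\<dots> = (LINT x|(lborel :: 'a measure). g (norm x) * v (norm x)) / ?\<omega>"
      using \<omega> by (subst integral_radial) auto
    also have "(LINT x|(lborel :: 'a measure). g (norm x) * v (norm x)) =
        (LINT x|(lborel :: 'a measure). (\<Sum>i\<in>Basis. radial_ext g x * partial_deriv i (radial_field \<phi> i) x))"
    proof (rule integral_cong_AE)
      show "(\<lambda>x::'a. g (norm x) * v (norm x)) \<in> borel_measurable lborel" by measurable
      show "(\<lambda>x::'a. \<Sum>i\<in>Basis. radial_ext g x * partial_deriv i (radial_field \<phi> i) x) \<in> borel_measurable lborel"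
        using iprod by (intro borel_measurable_sum) auto
      show "AE x::'a in lborel. g (norm x) * v (norm x) =
          (\<Sum>i\<in>Basis. radial_ext g x * partial_deriv i (radial_field \<phi> i) x)"
        using AE_lborel_singleton[of "0::'a"]
      proof eventually_elim
        fix x :: 'a assume x: "x \<noteq> 0"
        have "v (norm x) = (\<Sum>i\<in>Basis. partial_deriv i (radial_field \<phi> i) x)"
          using x by (simp add: v_def partial_deriv_radial_field[OF \<phi>] sum_radial_field_deriv)
        then show "g (norm x) * v (norm x) =
            (\<Sum>i\<in>Basis. radial_ext g x * partial_deriv i (radial_field \<phi> i) x)"
          using x by (simp add: radial_ext_def sum_distrib_left)
      qed
    qed
    also have "\<dots> = (\<Sum>i\<in>Basis. (LINT x|(lborel :: 'a measure). radial_ext g x * partial_deriv i (radial_field \<phi> i) x))"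
      using iprod by (intro Bochner_Integration.integral_sum)
    also have "\<dots> = (\<Sum>i\<in>Basis. - signed_integral (\<mu> i) (radial_field \<phi> i))"
    proof (rule sum.cong[OF refl])
      fix i :: 'a assume "i \<in> Basis"
      have "(LINT x|lborel. radial_ext g x * partial_deriv i (radial_field \<phi> i) x) =
          (LINT x|lebesgue. radial_ext g x * partial_deriv i (radial_field \<phi> i) x)"
        using iprod by (intro integral_completion[symmetric]) auto
      then show "(LINT x|lborel. radial_ext g x * partial_deriv i (radial_field \<phi> i) x) =
          - signed_integral (\<mu> i) (radial_field \<phi> i)"
        using has_weak_partial_measureD[OF \<mu>[OF \<open>i \<in> Basis\<close>] rf[of i]] by simp
    qed
    also have "\<dots> = - (LINT x|M. f x * h x)"
      using rep fb by (simp add: field sum_negf)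
    also have "- (LINT x|M. f x * h x) / ?\<omega> = - signed_integral \<nu> (\<lambda>t. f t * t ^ ?n)"
      using \<phi>0 fb by (subst \<nu>(4)) (auto simp: f_def indicator_def)
    also have "signed_integral \<nu> (\<lambda>t. f t * t ^ ?n) = signed_integral \<nu> (\<lambda>t. \<phi> t * t ^ ?n)"
    proof -
      have "space (fst \<nu>) = {0<..}" "space (snd \<nu>) = {0<..}"
        using sets_eq_imp_space_eq[OF sM] by (simp_all add: \<nu>_def signed_density_def space_restrict_space)
      then show ?thesis
        unfolding signed_integral_def
        by (intro arg_cong2[where f = "(-)"] Bochner_Integration.integral_cong) (auto simp: f_def)
    qed
    finally show "(LINT t|lebesgue_on {0<..}. g t * deriv (\<lambda>s. \<phi> s * s ^ ?n) t) =
        - signed_integral \<nu> (\<lambda>t. \<phi> t * t ^ ?n)" .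
  qed
  moreover have "(LINT r|variation_measure \<nu>. r ^ ?n) \<le> (\<Sum>i\<in>Basis. total_variation (\<mu> i)) / ?\<omega>"
    using \<nu>(3) divide_right_mono[OF hle] \<omega> by (meson less_imp_le order_trans)
  ultimately show ?thesis by (rule that)
qed

section \<open>Borel representatives and comparison of the norms\<close>

text \<open>Polar coordinates are set up for Borel functions, whose composition with the norm is
  again Borel. A Lebesgue measurable \<open>g\<close> is therefore replaced by a Borel one off a
  null set.\<close>

lemma lebesgue_on_halfline_eq_borel_AE:
  fixes g :: "real \<Rightarrow> real"
  assumes "g \<in> borel_measurable (lebesgue_on {0<..})"
  obtains g' where "g' \<in> borel_measurable borel" "AE t in lborel. 0 < t \<longrightarrow> g t = g' t"
proof -
  have "(\<lambda>t. if t \<in> {0<..} then g t else 0) \<in> borel_measurable lebesgue"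
    using assms by (subst measurable_restrict_space_iff[symmetric]) auto
  then obtain g' where "g' \<in> borel_measurable lborel" "AE t in lborel. (if t \<in> {0<..} then g t else 0) = g' t"
    using completion_ex_borel_measurable_real by blast
  then show ?thesis by (intro that[of g']) (auto elim!: eventually_mono)
qed

text \<open>The image of Lebesgue measure under the norm has a density with respect to Lebesgue
  measure on the line, so null sets of radii pull back to null sets in space.\<close>

lemma AE_radial_ext_cong:
  assumes "AE t in lborel. 0 < t \<longrightarrow> g t = g' t"
  shows "AE x in lborel. radial_ext g x = (radial_ext g' x :: real)"
proof -
  have "AE r in radius_measure DIM('a). 0 < r \<longrightarrow> g r = g' r"
    unfolding radius_measure_def using assms by (subst AE_density) (auto elim!: eventually_mono)
  then have "AE r in distr (lborel :: 'a measure) borel norm. 0 < r \<longrightarrow> g r = g' r"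
    unfolding distr_norm_lborel by (subst AE_density) (auto elim!: eventually_mono)
  then have "AE x in (lborel :: 'a measure). 0 < norm x \<longrightarrow> g (norm x) = g' (norm x)"
    by (rule AE_distrD[rotated]) simp
  then show ?thesis by eventually_elim (auto simp: radial_ext_def)
qed

text \<open>Integrals against test functions do not see null sets, so both functions have exactly
  the same weak derivative measures; the measures chosen by \<open>THE\<close> in the norm therefore
  coincide as well.\<close>

lemma
  fixes f f' :: "'a::euclidean_space \<Rightarrow> real"
  assumes f': "f' \<in> borel_measurable lebesgue" and ae: "AE x in lebesgue. f x = f' x"
  shows BV_cong_AE: "f \<in> BV \<longleftrightarrow> f' \<in> BV"
    and BV_norm_cong_AE: "BV_norm f = BV_norm f'"
proof -
  have f: "f \<in> borel_measurable lebesgue"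
    by (rule borel_measurable_AE[OF f']) (use ae in \<open>auto elim!: eventually_mono\<close>)
  have 1: "integrable lebesgue f \<longleftrightarrow> integrable lebesgue f'"
    using f f' ae by (rule integrable_cong_AE)
  have 2: "(LINT x|lebesgue. \<bar>f x\<bar>) = (LINT x|lebesgue. \<bar>f' x\<bar>)"
    using f f' ae by (intro integral_cong_AE) (auto elim!: eventually_mono)
  have "(LINT x|lebesgue. f x * partial_deriv i \<phi> x) = (LINT x|lebesgue. f' x * partial_deriv i \<phi> x)"
    if "\<phi> \<in> C1_compact_support" for i \<phi>
  proof -
    have "partial_deriv i \<phi> \<in> borel_measurable lebesgue"
      using C1_compact_support_test(3)[OF that] by (intro measurable_completion) simp
    then show ?thesis
      using f f' ae by (intro integral_cong_AE) (auto elim!: eventually_mono)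
  qed
  then have "has_weak_partial_measure i f \<mu> \<longleftrightarrow> has_weak_partial_measure i f' \<mu>" for i \<mu>
    by (simp add: has_weak_partial_measure_def)
  with 1 2 show "f \<in> BV \<longleftrightarrow> f' \<in> BV" "BV_norm f = BV_norm f'"
    by (simp_all add: BV_def BV_norm_def)
qed

lemma
  assumes g: "g \<in> borel_measurable (lebesgue_on {0<..})" and g': "g' \<in> borel_measurable (lebesgue_on {0<..})"
    and ae: "AE t in lebesgue_on {0<..}. g t = g' t"
  shows weighted_BV_cong_AE: "g \<in> weighted_BV d \<longleftrightarrow> g' \<in> weighted_BV d"
    and weighted_BV_norm_cong_AE: "weighted_BV_norm d g = weighted_BV_norm d g'"
proof -
  have pw: "(\<lambda>t::real. t ^ (d - 1)) \<in> borel_measurable (lebesgue_on {0<..})"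
    by (intro continuous_imp_measurable_on_sets_lebesgue continuous_intros) auto
  have 1: "integrable (lebesgue_on {0<..}) (\<lambda>t. \<bar>g t\<bar> * t ^ (d - 1)) \<longleftrightarrow>
      integrable (lebesgue_on {0<..}) (\<lambda>t. \<bar>g' t\<bar> * t ^ (d - 1))"
    using g g' pw ae by (intro integrable_cong_AE) (auto elim!: eventually_mono)
  have 2: "(LINT t|lebesgue_on {0<..}. \<bar>g t\<bar> * t ^ (d - 1)) = (LINT t|lebesgue_on {0<..}. \<bar>g' t\<bar> * t ^ (d - 1))"
    using g g' pw ae by (intro integral_cong_AE) (auto elim!: eventually_mono)
  have "(LINT t|lebesgue_on {0<..}. g t * deriv (\<lambda>s. \<phi> s * s ^ (d - 1)) t) =
      (LINT t|lebesgue_on {0<..}. g' t * deriv (\<lambda>s. \<phi> s * s ^ (d - 1)) t)"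
    if \<phi>: "\<phi> \<in> C1_compact_support_halfline" for \<phi>
  proof -
    have "continuous_on {0<..} (\<lambda>t. (deriv \<phi> t + real (d - 1) * (\<phi> t / t)) * t ^ (d - 1))"
      using C1_compact_support_halflineD(2,3)[OF \<phi>]
      by (intro continuous_intros) (auto intro: continuous_on_subset)
    then have "continuous_on {0<..} (deriv (\<lambda>s. \<phi> s * s ^ (d - 1)))"
      by (rule continuous_on_eq) (simp add: deriv_mult_power C1_compact_support_halflineD(1)[OF \<phi>])
    then have "deriv (\<lambda>s. \<phi> s * s ^ (d - 1)) \<in> borel_measurable (lebesgue_on {0<..})"
      by (rule continuous_imp_measurable_on_sets_lebesgue) simp
    then show ?thesis
      using g g' ae by (intro integral_cong_AE) (auto elim!: eventually_mono)
  qed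
  then have "has_weighted_derivative_measure d g \<nu> \<longleftrightarrow> has_weighted_derivative_measure d g' \<nu>" for \<nu>
    by (simp add: has_weighted_derivative_measure_def)
  with g g' 1 2 show "g \<in> weighted_BV d \<longleftrightarrow> g' \<in> weighted_BV d" "weighted_BV_norm d g = weighted_BV_norm d g'"
    by (simp_all add: weighted_BV_def weighted_BV_norm_def weighted_L1_def)
qed

lemma borel_measurable_lebesgue_on_halfline:
  fixes g :: "real \<Rightarrow> real"
  shows "g \<in> borel_measurable borel \<Longrightarrow> g \<in> borel_measurable (lebesgue_on {0<..})"
  by (intro measurable_restrict_space1 measurable_completion) simp

lemma weighted_L1_iff:
  assumes [measurable]: "g \<in> borel_measurable borel"
  shows "g \<in> weighted_L1 d \<longleftrightarrow> integrable (radius_measure d) g"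
proof -
  have "g \<in> weighted_L1 d \<longleftrightarrow> integrable (radius_measure d) (\<lambda>t. \<bar>g t\<bar>)"
    by (simp add: weighted_L1_def borel_measurable_lebesgue_on_halfline integrable_radius_measure)
  then show ?thesis by (simp add: integrable_abs_iff)
qed

text \<open>Existence in each direction comes from the two constructions. For the norms, uniqueness
  identifies the constructed measures with those chosen by \<open>THE\<close>, and what remains is
  arithmetic with \<open>L\<close>, \<open>W\<close> and \<open>T\<close>.\<close>

lemma
  assumes g [measurable]: "g \<in> borel_measurable borel"
  shows radial_ext_BV_iff_borel: "(radial_ext g :: 'a::euclidean_space \<Rightarrow> real) \<in> BV \<longleftrightarrow> g \<in> weighted_BV DIM('a)"
    and BV_norm_radial_ext_le: "g \<in> weighted_BV DIM('a) \<Longrightarrow>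
      BV_norm (radial_ext g :: 'a \<Rightarrow> real) \<le>
        DIM('a) * measure sphere_measure (UNIV :: 'a set) * weighted_BV_norm DIM('a) g"
    and weighted_BV_norm_le: "g \<in> weighted_BV DIM('a) \<Longrightarrow>
      weighted_BV_norm DIM('a) g \<le>
        1 / measure sphere_measure (UNIV :: 'a set) * BV_norm (radial_ext g :: 'a \<Rightarrow> real)"
proof -
  let ?n = "DIM('a) - 1" and ?\<omega> = "measure sphere_measure (UNIV :: 'a set)"
  let ?f = "radial_ext g :: 'a \<Rightarrow> real"
  note \<omega> = measure_sphere_measure_pos[where 'a='a]
  have int: "integrable lebesgue ?f \<longleftrightarrow> integrable (radius_measure DIM('a)) g"
    by (simp add: integrable_completion integrable_radial_ext)
  have to_BV: "\<exists>\<mu>. has_weak_partial_measure i ?f \<mu> \<and>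
      total_variation \<mu> \<le> ?\<omega> * (LINT r|variation_measure \<nu>. r ^ ?n)"
    if "integrable (radius_measure DIM('a)) g" "has_weighted_derivative_measure DIM('a) g \<nu>" "i \<in> Basis" for \<nu> i
    using radial_ext_weak_partial_measure[OF g that] by metis
  have from_BV: "\<exists>\<nu>. has_weighted_derivative_measure DIM('a) g \<nu> \<and>
      (LINT r|variation_measure \<nu>. r ^ ?n) \<le> (\<Sum>i\<in>Basis. total_variation (\<mu> i)) / ?\<omega>"
    if "integrable (radius_measure DIM('a)) g" "\<And>i. i \<in> Basis \<Longrightarrow> has_weak_partial_measure i ?f (\<mu> i)" for \<mu>
    using radial_ext_weighted_derivative_measure[OF g that] by metis
  show iff: "?f \<in> BV \<longleftrightarrow> g \<in> weighted_BV DIM('a)"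
  proof
    assume "?f \<in> BV"
    then have i: "integrable (radius_measure DIM('a)) g" and "\<forall>i\<in>Basis. \<exists>\<mu>. has_weak_partial_measure i ?f \<mu>"
      by (simp_all add: BV_def int)
    then obtain \<mu> where "\<forall>i\<in>Basis. has_weak_partial_measure i ?f (\<mu> i)" by metis
    then show "g \<in> weighted_BV DIM('a)"
      using from_BV[OF i, of \<mu>] by (auto simp: weighted_BV_def weighted_L1_iff i)
  next
    assume "g \<in> weighted_BV DIM('a)"
    then obtain \<nu> where i: "integrable (radius_measure DIM('a)) g"
      and \<nu>: "has_weighted_derivative_measure DIM('a) g \<nu>"
      by (auto simp: weighted_BV_def weighted_L1_iff)
    show "?f \<in> BV"
      unfolding BV_def using i to_BV[OF i \<nu>] int by blast
  qed
  define L where "L = (LINT t|lebesgue_on {0<..}. \<bar>g t\<bar> * t ^ ?n)"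
  have L: "(LINT x|lebesgue. \<bar>?f x\<bar>) = ?\<omega> * L"
  proof -
    have "(LINT x|lebesgue. \<bar>?f x\<bar>) = (LINT x|lborel. \<bar>?f x\<bar>)"
      by (rule integral_completion) measurable
    also have "\<dots> = (LINT x|(lborel :: 'a measure). \<bar>g (norm x)\<bar>)"
      using AE_radial_ext[of g] by (intro integral_cong_AE) (auto elim!: eventually_mono)
    also have "\<dots> = ?\<omega> * (LINT r|radius_measure DIM('a). \<bar>g r\<bar>)"
      by (rule integral_radial) measurable
    also have "(LINT r|radius_measure DIM('a). \<bar>g r\<bar>) = L"
      unfolding L_def by (rule integral_radius_measure) measurable
    finally show ?thesis .
  qed
  have "0 \<le> L" unfolding L_def
    by (intro Bochner_Integration.integral_nonneg) (auto simp: space_restrict_space)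
  assume gBV: "g \<in> weighted_BV DIM('a)"
  then obtain \<nu> where i: "integrable (radius_measure DIM('a)) g"
    and \<nu>: "has_weighted_derivative_measure DIM('a) g \<nu>"
    by (auto simp: weighted_BV_def weighted_L1_iff)
  define W where "W = (LINT r|variation_measure \<nu>. r ^ ?n)"
  have "(THE \<nu>. has_weighted_derivative_measure DIM('a) g \<nu>) = \<nu>"
    using \<nu> has_weighted_derivative_measure_unique by blast
  then have wn: "weighted_BV_norm DIM('a) g = L + W"
    by (simp add: weighted_BV_norm_def L_def W_def)
  obtain \<mu> where \<mu>: "\<forall>i\<in>Basis. has_weak_partial_measure i ?f (\<mu> i) \<and> total_variation (\<mu> i) \<le> ?\<omega> * W"
    using to_BV[OF i \<nu>] unfolding W_def by metis
  define T where "T = (\<Sum>i\<in>Basis. total_variation (\<mu> i))"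
  have "(THE m. has_weak_partial_measure i ?f m) = \<mu> i" if "i \<in> Basis" for i
    using \<mu> that has_weak_partial_measure_unique by blast
  then have n: "BV_norm ?f = ?\<omega> * L + T"
    by (simp add: BV_norm_def L T_def)
  have "T \<le> DIM('a) * (?\<omega> * W)"
    unfolding T_def using \<mu> by (intro sum_bounded_above) auto
  \<comment> \<open>The L_1 part alone would need only the factor \<omega>; it is enlarged so that
    one constant serves both parts.\<close>
  moreover have "?\<omega> * L \<le> DIM('a) * (?\<omega> * L)"
    using mult_right_mono[of 1 "real DIM('a)" "?\<omega> * L"] \<open>0 \<le> L\<close> by (simp add: Suc_leI)
  ultimately show "BV_norm ?f \<le> DIM('a) * ?\<omega> * weighted_BV_norm DIM('a) g"
    by (simp add: n wn distrib_left mult.assoc)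
  obtain \<nu>' where \<nu>': "has_weighted_derivative_measure DIM('a) g \<nu>'"
    "(LINT r|variation_measure \<nu>'. r ^ ?n) \<le> T / ?\<omega>"
    using from_BV[OF i, of \<mu>] \<mu> unfolding T_def by blast
  \<comment> \<open>\<open>W\<close> belongs to the given \<nu>, the bound to the constructed one;
    uniqueness makes them equal.\<close>
  then have "W \<le> T / ?\<omega>"
    using has_weighted_derivative_measure_unique[OF \<nu> \<nu>'(1)] by (simp add: W_def)
  then show "weighted_BV_norm DIM('a) g \<le> 1 / ?\<omega> * BV_norm ?f"
    using \<omega> by (simp add: n wn add_divide_distrib)
qed

theorem theorem12:
  assumes "2 \<le> DIM('a::euclidean_space)"
  shows "(\<forall>g \<in> borel_measurable (lebesgue_on {0<..}).
            (radial_ext g :: 'a \<Rightarrow> real) \<in> BV \<longleftrightarrow> g \<in> weighted_BV DIM('a)) \<and>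
         (\<exists>c C. 0 < c \<and> 0 < C \<and>
            (\<forall>g \<in> weighted_BV DIM('a).
               BV_norm (radial_ext g :: 'a \<Rightarrow> real) \<le> C * weighted_BV_norm DIM('a) g \<and>
               weighted_BV_norm DIM('a) g \<le> c * BV_norm (radial_ext g :: 'a \<Rightarrow> real)))"
proof -
  let ?\<omega> = "measure sphere_measure (UNIV :: 'a set)"
  \<comment> \<open>Passing to a Borel representative changes neither membership nor either norm, so
    the Borel case gives the general one with the same constants.\<close>
  have reduce: "\<exists>g'. g' \<in> borel_measurable borel \<and>
      ((radial_ext g :: 'a \<Rightarrow> real) \<in> BV \<longleftrightarrow> (radial_ext g' :: 'a \<Rightarrow> real) \<in> BV) \<and>
      BV_norm (radial_ext g :: 'a \<Rightarrow> real) = BV_norm (radial_ext g' :: 'a \<Rightarrow> real) \<and>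
      (g \<in> weighted_BV DIM('a) \<longleftrightarrow> g' \<in> weighted_BV DIM('a)) \<and>
      weighted_BV_norm DIM('a) g = weighted_BV_norm DIM('a) g'"
    if g: "g \<in> borel_measurable (lebesgue_on {0<..})" for g
  proof -
    obtain g' where g': "g' \<in> borel_measurable borel" and ae: "AE t in lborel. 0 < t \<longrightarrow> g t = g' t"
      using lebesgue_on_halfline_eq_borel_AE[OF g] by metis
    have 1: "AE x in lebesgue. radial_ext g x = (radial_ext g' (x :: 'a) :: real)"
      using AE_radial_ext_cong[OF ae] by (rule AE_completion)
    have 2: "(radial_ext g' :: 'a \<Rightarrow> real) \<in> borel_measurable lebesgue"
      using g' by (intro measurable_completion) simp
    have 3: "AE t in lebesgue_on {0<..}. g t = g' t"
      using AE_completion[OF ae] by (subst AE_restrict_space_iff) auto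
    note 4 = borel_measurable_lebesgue_on_halfline[OF g']
    show ?thesis
      using g' BV_cong_AE[OF 2 1] BV_norm_cong_AE[OF 2 1]
        weighted_BV_cong_AE[OF g 4 3] weighted_BV_norm_cong_AE[OF g 4 3] by blast
  qed
  have 1: "\<forall>g \<in> borel_measurable (lebesgue_on {0<..}).
      (radial_ext g :: 'a \<Rightarrow> real) \<in> BV \<longleftrightarrow> g \<in> weighted_BV DIM('a)"
    using reduce radial_ext_BV_iff_borel[where 'a='a] by metis
  have 2: "\<forall>g \<in> weighted_BV DIM('a).
      BV_norm (radial_ext g :: 'a \<Rightarrow> real) \<le> DIM('a) * ?\<omega> * weighted_BV_norm DIM('a) g \<and>
      weighted_BV_norm DIM('a) g \<le> 1 / ?\<omega> * BV_norm (radial_ext g :: 'a \<Rightarrow> real)"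
  proof
    fix g assume g: "g \<in> weighted_BV DIM('a)"
    then have "g \<in> borel_measurable (lebesgue_on {0<..})"
      by (simp add: weighted_BV_def weighted_L1_def)
    from reduce[OF this] obtain g' where g': "g' \<in> borel_measurable borel" "g' \<in> weighted_BV DIM('a)"
      and eq: "BV_norm (radial_ext g :: 'a \<Rightarrow> real) = BV_norm (radial_ext g' :: 'a \<Rightarrow> real)"
        "weighted_BV_norm DIM('a) g = weighted_BV_norm DIM('a) g'"
      using g by blast
    show "BV_norm (radial_ext g :: 'a \<Rightarrow> real) \<le> DIM('a) * ?\<omega> * weighted_BV_norm DIM('a) g \<and>
        weighted_BV_norm DIM('a) g \<le> 1 / ?\<omega> * BV_norm (radial_ext g :: 'a \<Rightarrow> real)"
      unfolding eq using BV_norm_radial_ext_le[OF g'] weighted_BV_norm_le[OF g'] by blast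
  qed
  show ?thesis
    using 1 2 measure_sphere_measure_pos[where 'a='a]
    by (intro conjI exI[of _ "1 / ?\<omega>"] exI[of _ "DIM('a) * ?\<omega>"]) auto
qed

end
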